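(* Let $\Omega$ be a connected wsc on $[n]$ with a free action of a finite group $G$, let $d_0,\dots,d_n$ with $d_i=d_{gi}$ for all $g,i$, let $\epsilon>0$, and let $M\in\mathrm{Her}_{d_0\cdots d_n}$ be $G$-invariant. Then (a) if $1<p\le4/3$: $\displaystyle \operatorname{rank}^{\epsilon,p}_{(\Omega,G)}(M)\le\Big\lceil C_p\Big(\frac{2\mu_p(M)}{\epsilon}\Big)^{\frac p{p-1}}\Big\rceil\cdot|G|$; (b) if $p=2$ or $4\le p<\infty$: $\displaystyle \operatorname{rank}^{\epsilon,p}_{(\Omega,G)}(M)\le\Big\lceil D_p\Big(\frac{2\mu_p(M)}{\epsilon}\Big)^{2}\Big\rceil\cdot|G|$, where $C_p=(2e^2/p^{1/p})^{p/(p-1)}$ and $D_p=2(p-1)e^4$.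
   Context: Weighted simplicial complexes: for $[n]=\{0,\dots,n\}$ with power set $\mathcal P_n$, a wsc is a function $\Omega:\mathcal P_n\to\mathbb N_0$ such that $S_1\subseteq S_2$ implies $\Omega(S_1)$ divides $\Omega(S_2)$; $S$ is a simplex if $\Omega(S)\ne0$, and every singleton is assumed to be a simplex. Facets are inclusion-maximal simplices; $\mathcal F$ is the set of facets, $\widetilde{\mathcal F}$ the multiset containing each facet $F$ exactly $\Omega(F)$ times, with collapse map $c:\widetilde{\mathcal F}\to\mathcal F$, and $\widetilde{\mathcal F}_i$ the sub-multiset of elements whose underlying facet contains $i$. Vertices $i,j$ are neighbours if some facet contains both; $\Omega$ is connected if the neighbour graph on $[n]$ is connected. An action of $G$ on $\Omega$ is an action of $G$ on $[n]$ with $\Omega(gS)=\Omega(S)$ for all $S\in\mathcal P_n$, $g\in G$ (where $gS=\{gs:s\in S\}$), together with an action of $G$ on $\widetilde{\mathcal F}$ such that $c(gF)=g\,c(F)$; it is free if the action on $\widetilde{\mathcal F}$ is free. $(\Omega,G)$-decompositions: given vector spaces $\mathcal V_i$ with $\mathcal V_i=\mathcal V_{gi}$, $G$ acts on $\mathcal V=\mathcal V_0\otimes\cdots\otimes\mathcal V_n$ by $g(v^{[0]}\otimes\cdots\otimes v^{[n]})=v^{[g0]}\otimes\cdots\otimes v^{[gn]}$; $v$ is $G$-invariant if $gv=v$ for all $g$. For a finite set $\mathcal I$ and $\alpha\in\mathcal I^{\widetilde{\mathcal F}}$ (functions $\widetilde{\mathcal F}\to\mathcal I$) write $\alpha_{|i}$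 for its restriction to $\widetilde{\mathcal F}_i$. An $(\Omega,G)$-decomposition of $v\in\mathcal V$ is a finite $\mathcal I$ and vectors $v^{[i]}_\beta\in\mathcal V_i$ ($i\in[n]$, $\beta\in\mathcal I^{\widetilde{\mathcal F}_i}$) with $v=\sum_{\alpha\in\mathcal I^{\widetilde{\mathcal F}}}v^{[0]}_{\alpha_{|0}}\otimes\cdots\otimes v^{[n]}_{\alpha_{|n}}$ and $v^{[i]}_\beta=v^{[gi]}_{{}^g\beta}$ for all $i,g,\beta$, where ${}^g\beta\in\mathcal I^{\widetilde{\mathcal F}_{gi}}$, ${}^g\beta(F)=\beta(g^{-1}F)$. $\operatorname{rank}_{(\Omega,G)}(v)$ is the minimal $|\mathcal I|$ over all such decompositions ($\infty$ if none). Matrix setting: $\mathcal V_i=\mathcal M_{d_i}$ (complex $d_i\times d_i$ matrices), $\mathcal V\cong\mathcal M_{d_0\cdots d_n}$, $\mathrm{Her}$ the Hermitian matrices, $\|\cdot\|_p$ the Schatten $p$-norm $(\sum_i s_i^p)^{1/p}$. Approximate rank: $\operatorname{rank}^{\epsilon,p}_{(\Omega,G)}(M)=\min\{\operatorname{rank}_{(\Omega,G)}(N):N\in\mathcal M_{d_0\cdots d_n},\|M-N\|_p\le\epsilon\}$. Gauge: $P_p=\{\pm\rho^{[0]}\otimes\cdots\otimes\rho^{[n]}:\rho^{[i]}\text{ psd in }\mathcal M_{d_i},\ \|\rho^{[0]}\otimes\cdots\otimes\rho^{[n]}\|_p\le1\}$, $B_p=\operatorname{conv}(P_p)$, $\mu_p(v)=\inf\{\lambda>0:v/\lambda\in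 B_p\}$. *)

theory Defs
  imports Complex_Main
    "Jordan_Normal_Form.Jordan_Normal_Form"
    "HOL-Algebra.Group_Action"
    "HOL-Computational_Algebra.Polynomial"
    "HOL-Library.Extended_Nat"
    "HOL-Library.FuncSet"
begin

text \<open>A wsc is a function Omega on subsets of {0..n} to naturals, divisibility-monotone,
  with every singleton a simplex. Values of Omega outside the power set of {0..n} are irrelevant.\<close>
definition wsc :: "nat \<Rightarrow> (nat set \<Rightarrow> nat) \<Rightarrow> bool" where
  "wsc n \<Omega> \<longleftrightarrow>
     (\<forall>S1 S2. S1 \<subseteq> S2 \<and> S2 \<subseteq> {0..n} \<longrightarrow> \<Omega> S1 dvd \<Omega> S2) \<and>
     (\<forall>i\<le>n. \<Omega> {i} \<noteq> 0)"

definition simplex :: "nat \<Rightarrow> (nat set \<Rightarrow> nat) \<Rightarrow> nat set \<Rightarrow> bool" where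
  "simplex n \<Omega> S \<longleftrightarrow> S \<subseteq> {0..n} \<and> \<Omega> S \<noteq> 0"

definition facets :: "nat \<Rightarrow> (nat set \<Rightarrow> nat) \<Rightarrow> nat set set" where
  "facets n \<Omega> = {F. simplex n \<Omega> F \<and> (\<forall>S. simplex n \<Omega> S \<and> F \<subseteq> S \<longrightarrow> S = F)}"

text \<open>The multiset of facets, each facet F repeated Omega(F) times, realised as the set of
  pairs (F,k) with k < Omega(F); the collapse map is fst.\<close>
definition Ftilde :: "nat \<Rightarrow> (nat set \<Rightarrow> nat) \<Rightarrow> (nat set \<times> nat) set" where
  "Ftilde n \<Omega> = {(F, k). F \<in> facets n \<Omega> \<and> k < \<Omega> F}"

definition Ftilde_at :: "nat \<Rightarrow> (nat set \<Rightarrow> nat) \<Rightarrow> nat \<Rightarrow> (nat set \<times> nat) set" where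
  "Ftilde_at n \<Omega> i = {x \<in> Ftilde n \<Omega>. i \<in> fst x}"

definition neighbours :: "nat \<Rightarrow> (nat set \<Rightarrow> nat) \<Rightarrow> nat \<Rightarrow> nat \<Rightarrow> bool" where
  "neighbours n \<Omega> i j \<longleftrightarrow> (\<exists>F \<in> facets n \<Omega>. i \<in> F \<and> j \<in> F)"

definition wsc_connected :: "nat \<Rightarrow> (nat set \<Rightarrow> nat) \<Rightarrow> bool" where
  "wsc_connected n \<Omega> \<longleftrightarrow> (\<forall>i\<le>n. \<forall>j\<le>n. (neighbours n \<Omega>)\<^sup>*\<^sup>* i j)"

definition wsc_action ::
  "('g, 'b) monoid_scheme \<Rightarrow> nat \<Rightarrow> (nat set \<Rightarrow> nat) \<Rightarrow> ('g \<Rightarrow> nat \<Rightarrow> nat)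
     \<Rightarrow> ('g \<Rightarrow> nat set \<times> nat \<Rightarrow> nat set \<times> nat) \<Rightarrow> bool" where
  "wsc_action G n \<Omega> \<phi> \<psi> \<longleftrightarrow>
     group_action G {0..n} \<phi> \<and>
     (\<forall>g\<in>carrier G. \<forall>S. S \<subseteq> {0..n} \<longrightarrow> \<Omega> (\<phi> g ` S) = \<Omega> S) \<and>
     group_action G (Ftilde n \<Omega>) \<psi> \<and>
     (\<forall>g\<in>carrier G. \<forall>x\<in>Ftilde n \<Omega>. fst (\<psi> g x) = \<phi> g ` fst x)"

definition free_wsc_action ::
  "('g, 'b) monoid_scheme \<Rightarrow> nat \<Rightarrow> (nat set \<Rightarrow> nat) \<Rightarrow> ('g \<Rightarrow> nat \<Rightarrow> nat)
     \<Rightarrow> ('g \<Rightarrow> nat set \<times> nat \<Rightarrow> nat set \<times> nat) \<Rightarrow> bool" where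
  "free_wsc_action G n \<Omega> \<phi> \<psi> \<longleftrightarrow>
     wsc_action G n \<Omega> \<phi> \<psi> \<and>
     (\<forall>g\<in>carrier G. \<forall>x\<in>Ftilde n \<Omega>. \<psi> g x = x \<longrightarrow> g = \<one>\<^bsub>G\<^esub>)"

definition kron :: "complex mat \<Rightarrow> complex mat \<Rightarrow> complex mat" where
  "kron A B = mat (dim_row A * dim_row B) (dim_col A * dim_col B)
     (\<lambda>(i, j). A $$ (i div dim_row B, j div dim_col B) * B $$ (i mod dim_row B, j mod dim_col B))"

text \<open>Tensor product of a list of matrices, first factor most significant.\<close>
fun kron_list :: "complex mat list \<Rightarrow> complex mat" where
  "kron_list [] = 1\<^sub>m 1"
| "kron_list (A # As) = kron A (kron_list As)"

definition tensor :: "nat \<Rightarrow> (nat \<Rightarrow> complex mat) \<Rightarrow> complex mat" where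
  "tensor n f = kron_list (map f [0..<Suc n])"

definition total_dim :: "nat \<Rightarrow> (nat \<Rightarrow> nat) \<Rightarrow> nat" where
  "total_dim n d = (\<Prod>i\<le>n. d i)"

definition mat_sum :: "nat \<Rightarrow> ('a \<Rightarrow> complex mat) \<Rightarrow> 'a set \<Rightarrow> complex mat" where
  "mat_sum D f S = mat D D (\<lambda>ij. \<Sum>a\<in>S. f a $$ ij)"

definition adj :: "complex mat \<Rightarrow> complex mat" where
  "adj A = mat (dim_col A) (dim_row A) (\<lambda>(i, j). cnj (A $$ (j, i)))"

definition hermitian :: "nat \<Rightarrow> complex mat \<Rightarrow> bool" where
  "hermitian D A \<longleftrightarrow> A \<in> carrier_mat D D \<and> adj A = A"

definition psd :: "nat \<Rightarrow> complex mat \<Rightarrow> bool" where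
  "psd D A \<longleftrightarrow> hermitian D A \<and>
     (\<forall>v \<in> carrier_vec D. 0 \<le> Re (conjugate v \<bullet> (A *\<^sub>v v)))"

definition singular_values :: "complex mat \<Rightarrow> real multiset" where
  "singular_values A = image_mset (\<lambda>x. sqrt (Re x)) (proots (char_poly (adj A * A)))"

definition schatten_norm :: "real \<Rightarrow> complex mat \<Rightarrow> real" where
  "schatten_norm p A = (\<Sum>s\<in>#singular_values A. s powr p) powr (1 / p)"

definition digit :: "nat \<Rightarrow> (nat \<Rightarrow> nat) \<Rightarrow> nat \<Rightarrow> nat \<Rightarrow> nat" where
  "digit n d a i = (a div (\<Prod>j\<in>{i<..n}. d j)) mod d i"

definition encode :: "nat \<Rightarrow> (nat \<Rightarrow> nat) \<Rightarrow> (nat \<Rightarrow> nat) \<Rightarrow> nat" where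
  "encode n d f = (\<Sum>i\<le>n. f i * (\<Prod>j\<in>{i<..n}. d j))"

text \<open>g(v0 (x) ... (x) vn) = v_{g0} (x) ... (x) v_{gn}, extended linearly; on matrix entries with
  multi-indices a, b this reads (gM)[a,b] = M[a o g^-1, b o g^-1].\<close>
definition perm_act :: "('g, 'b) monoid_scheme \<Rightarrow> ('g \<Rightarrow> nat \<Rightarrow> nat) \<Rightarrow> nat \<Rightarrow> (nat \<Rightarrow> nat)
    \<Rightarrow> 'g \<Rightarrow> complex mat \<Rightarrow> complex mat" where
  "perm_act G \<phi> n d g M = mat (total_dim n d) (total_dim n d)
     (\<lambda>(a, b). M $$ (encode n d (\<lambda>j. digit n d a (\<phi> (inv\<^bsub>G\<^esub> g) j)),
                     encode n d (\<lambda>j. digit n d b (\<phi> (inv\<^bsub>G\<^esub> g) j))))"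

definition G_invariant :: "('g, 'b) monoid_scheme \<Rightarrow> ('g \<Rightarrow> nat \<Rightarrow> nat) \<Rightarrow> nat \<Rightarrow> (nat \<Rightarrow> nat)
    \<Rightarrow> complex mat \<Rightarrow> bool" where
  "G_invariant G \<phi> n d M \<longleftrightarrow> (\<forall>g\<in>carrier G. perm_act G \<phi> n d g M = M)"

text \<open>Index set I = {..<r} (any finite index set can be relabelled this way).\<close>
definition twist :: "('g, 'b) monoid_scheme \<Rightarrow> nat \<Rightarrow> (nat set \<Rightarrow> nat) \<Rightarrow> ('g \<Rightarrow> nat \<Rightarrow> nat)
    \<Rightarrow> ('g \<Rightarrow> nat set \<times> nat \<Rightarrow> nat set \<times> nat) \<Rightarrow> 'g \<Rightarrow> nat
    \<Rightarrow> (nat set \<times> nat \<Rightarrow> nat) \<Rightarrow> (nat set \<times> nat \<Rightarrow> nat)" where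
  "twist G n \<Omega> \<phi> \<psi> g i \<beta> = restrict (\<lambda>F. \<beta> (\<psi> (inv\<^bsub>G\<^esub> g) F)) (Ftilde_at n \<Omega> (\<phi> g i))"

definition has_decomp :: "('g, 'b) monoid_scheme \<Rightarrow> nat \<Rightarrow> (nat set \<Rightarrow> nat) \<Rightarrow> ('g \<Rightarrow> nat \<Rightarrow> nat)
    \<Rightarrow> ('g \<Rightarrow> nat set \<times> nat \<Rightarrow> nat set \<times> nat) \<Rightarrow> (nat \<Rightarrow> nat) \<Rightarrow> complex mat \<Rightarrow> nat \<Rightarrow> bool" where
  "has_decomp G n \<Omega> \<phi> \<psi> d N r \<longleftrightarrow>
     (\<exists>v :: nat \<Rightarrow> (nat set \<times> nat \<Rightarrow> nat) \<Rightarrow> complex mat.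
        (\<forall>i\<le>n. \<forall>\<beta> \<in> Ftilde_at n \<Omega> i \<rightarrow>\<^sub>E {..<r}. v i \<beta> \<in> carrier_mat (d i) (d i)) \<and>
        (\<forall>i\<le>n. \<forall>g\<in>carrier G. \<forall>\<beta> \<in> Ftilde_at n \<Omega> i \<rightarrow>\<^sub>E {..<r}.
            v i \<beta> = v (\<phi> g i) (twist G n \<Omega> \<phi> \<psi> g i \<beta>)) \<and>
        N = mat_sum (total_dim n d)
              (\<lambda>\<alpha>. tensor n (\<lambda>i. v i (restrict \<alpha> (Ftilde_at n \<Omega> i))))
              (Ftilde n \<Omega> \<rightarrow>\<^sub>E {..<r}))"

definition rank_OG :: "('g, 'b) monoid_scheme \<Rightarrow> nat \<Rightarrow> (nat set \<Rightarrow> nat) \<Rightarrow> ('g \<Rightarrow> nat \<Rightarrow> nat)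
    \<Rightarrow> ('g \<Rightarrow> nat set \<times> nat \<Rightarrow> nat set \<times> nat) \<Rightarrow> (nat \<Rightarrow> nat) \<Rightarrow> complex mat \<Rightarrow> enat" where
  "rank_OG G n \<Omega> \<phi> \<psi> d N = Inf {enat r | r. has_decomp G n \<Omega> \<phi> \<psi> d N r}"

definition approx_rank_OG :: "real \<Rightarrow> real \<Rightarrow> ('g, 'b) monoid_scheme \<Rightarrow> nat \<Rightarrow> (nat set \<Rightarrow> nat)
    \<Rightarrow> ('g \<Rightarrow> nat \<Rightarrow> nat) \<Rightarrow> ('g \<Rightarrow> nat set \<times> nat \<Rightarrow> nat set \<times> nat) \<Rightarrow> (nat \<Rightarrow> nat)
    \<Rightarrow> complex mat \<Rightarrow> enat" where
  "approx_rank_OG \<epsilon> p G n \<Omega> \<phi> \<psi> d M =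
     Inf {rank_OG G n \<Omega> \<phi> \<psi> d N | N.
            N \<in> carrier_mat (total_dim n d) (total_dim n d) \<and> schatten_norm p (M - N) \<le> \<epsilon>}"

definition P_set :: "real \<Rightarrow> nat \<Rightarrow> (nat \<Rightarrow> nat) \<Rightarrow> complex mat set" where
  "P_set p n d = {s \<cdot>\<^sub>m tensor n \<rho> | s \<rho>. (s = 1 \<or> s = -1) \<and>
       (\<forall>i\<le>n. psd (d i) (\<rho> i)) \<and> schatten_norm p (tensor n \<rho>) \<le> 1}"

definition conv_mat :: "nat \<Rightarrow> complex mat set \<Rightarrow> complex mat set" where
  "conv_mat D P = {mat_sum D (\<lambda>k. complex_of_real (c k) \<cdot>\<^sub>m A k) {..<m} | (m::nat) c A.
       (\<forall>k<m. 0 \<le> c k \<and> A k \<in> P) \<and> (\<Sum>k<m. c k) = 1}"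

definition B_set :: "real \<Rightarrow> nat \<Rightarrow> (nat \<Rightarrow> nat) \<Rightarrow> complex mat set" where
  "B_set p n d = conv_mat (total_dim n d) (P_set p n d)"

definition mu :: "real \<Rightarrow> nat \<Rightarrow> (nat \<Rightarrow> nat) \<Rightarrow> complex mat \<Rightarrow> real" where
  "mu p n d v = Inf {t::real. 0 < t \<and> complex_of_real (1 / t) \<cdot>\<^sub>m v \<in> B_set p n d}"

end

theory Submission
  imports Defs "HOL-Analysis.Convex" "Jordan_Normal_Form.Schur_Decomposition"
begin

text \<open>Writing \<open>M / t\<close> as a convex combination of elements of \<open>P_p\<close>, one picks elements greedily so that
  the partial sums of deviations from the barycentre grow slowly in Schatten norm; the mean of the
  first \<open>k\<close> choices then approximates \<open>M / t\<close>. For \<open>p < 2\<close> the growth is controlled by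
  \<open>\<parallel>A + B\<parallel>^p + \<parallel>A - B\<parallel>^p \<le> 2 \<parallel>A\<parallel>^p + 2 \<parallel>B\<parallel>^p\<close>, for \<open>p \<ge> 2\<close> by a second-order upper bound of
  \<open>\<parallel>S + B\<parallel>^p\<close> around \<open>S\<close>. Averaging the approximation over \<open>G\<close> does not increase the error and turns each
  elementary tensor into \<open>|G|\<close> elementary tensors permuted by \<open>G\<close>. Freeness yields an equivariant map from
  the facets to \<open>G\<close>, by which a local index determines the group element, and connectedness forces the
  local indices to agree, so \<open>k |G|\<close> indices suffice. The constants of the statement are larger than those
  of the greedy argument, which absorbs the fact that the infimum \<open>mu\<close> need not be attained.\<close>

no_notation inner (infixl "\<bullet>" 70)

section \<open>Unitary diagonalisation\<close>

text \<open>Matrix functions never appear. A Hermitian matrix is handled through a witness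
  \<open>spectral D A U l\<close>, and two of them are compared through the squared moduli of the
  entries of \<open>adj U * V\<close>, which form a doubly stochastic matrix. Each trace inequality
  thus becomes a tangent-line or Taylor inequality for real powers, averaged against such weights.
  Estimates are stated for the p-th power of the norm, where eigenvalues contribute separately and
  convexity does the work of the triangle inequality. For p \<ge> 2 the obstacle is that the
  second-order bound has the norm of the new partial sum on its right-hand side too. Solving this
  implicit inequality leaves an alternative that does not refer to the previous sum; linear growth
  handles it during the first steps, the accumulated bound later. Combinatorially, a constant label
  on all facets would be unchanged by the group and could not record a group element; labels must be
  shifted facet by facet. The infimum \<open>mu\<close> needs a nonempty set, which rests on psd
  tensors spanning the Hermitian matrices over the reals.\<close>

lemma adj_carrier [simp, intro]: "A \<in> carrier_mat m n \<Longrightarrow> adj A \<in> carrier_mat n m"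
  by (auto simp: adj_def)

lemma dim_adj [simp]: "dim_row (adj A) = dim_col A" "dim_col (adj A) = dim_row A"
  by (auto simp: adj_def)

lemma index_adj [simp]: "i < dim_col A \<Longrightarrow> j < dim_row A \<Longrightarrow> adj A $$ (i, j) = cnj (A $$ (j, i))"
  by (auto simp: adj_def)

lemma adj_adj [simp]: "adj (adj A) = A"
  by (rule eq_matI) auto

lemma square_mat_eqI:
  assumes "A \<in> carrier_mat D D" "B \<in> carrier_mat D D"
    and "\<And>i j. i < D \<Longrightarrow> j < D \<Longrightarrow> A $$ (i, j) = B $$ (i, j)"
  shows "A = B"
  using assms by (intro eq_matI) auto

lemma mult_carrier_square [simp]:
  "A \<in> carrier_mat D D \<Longrightarrow> B \<in> carrier_mat D D \<Longrightarrow> A * B \<in> carrier_mat D D"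
  by auto

lemma minus_carrier_square [simp]:
  "A \<in> carrier_mat D D \<Longrightarrow> B \<in> carrier_mat D D \<Longrightarrow> A - B \<in> carrier_mat D D"
  for A B :: "complex mat"
  by (rule minus_carrier_mat)

lemma mat_sum_carrier [simp, intro]: "mat_sum D f K \<in> carrier_mat D D"
  by (simp add: mat_sum_def)

lemma dim_mat_sum [simp]: "dim_row (mat_sum D f K) = D" "dim_col (mat_sum D f K) = D"
  by (simp_all add: mat_sum_def)

lemma index_mat_sum [simp]: "i < D \<Longrightarrow> j < D \<Longrightarrow> mat_sum D f K $$ (i, j) = (\<Sum>k\<in>K. f k $$ (i, j))"
  by (simp add: mat_sum_def)

lemma index_mult_mat_sum:
  assumes "A \<in> carrier_mat m l" "B \<in> carrier_mat l n" "i < m" "j < n"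
  shows "(A * B) $$ (i, j) = (\<Sum>k<l. A $$ (i, k) * B $$ (k, j))"
  using assms by (auto simp: scalar_prod_def atLeast0LessThan)

lemma adj_mult:
  assumes "A \<in> carrier_mat m l" "B \<in> carrier_mat l n"
  shows "adj (A * B) = adj B * adj A"
proof (rule eq_matI)
  fix i j assume "i < dim_row (adj B * adj A)" "j < dim_col (adj B * adj A)"
  then have ij: "i < n" "j < m" using assms by auto
  have "adj (A * B) $$ (i, j) = cnj ((A * B) $$ (j, i))" using assms ij by auto
  also have "\<dots> = (\<Sum>k<l. cnj (A $$ (j, k)) * cnj (B $$ (k, i)))"
    by (subst index_mult_mat_sum[OF assms ij(2,1)]) simp
  also have "\<dots> = (adj B * adj A) $$ (i, j)"
    using assms ij by (subst index_mult_mat_sum[of _ n l _ m]) (auto intro!: sum.cong)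
  finally show "adj (A * B) $$ (i, j) = (adj B * adj A) $$ (i, j)" .
qed (use assms in auto)

section \<open>Eigendecomposition data\<close>

definition unitary_mat :: "nat \<Rightarrow> complex mat \<Rightarrow> bool" where
  "unitary_mat D U \<longleftrightarrow> U \<in> carrier_mat D D \<and> adj U * U = 1\<^sub>m D"

definition real_diag :: "nat \<Rightarrow> (nat \<Rightarrow> real) \<Rightarrow> complex mat" where
  "real_diag D l = mat D D (\<lambda>(i, j). if i = j then complex_of_real (l i) else 0)"

text \<open>The eigenbasis is part of the data because overlaps between eigenbases carry the later
  estimates; no order of the eigenvalues is ever needed.\<close>

definition spectral :: "nat \<Rightarrow> complex mat \<Rightarrow> complex mat \<Rightarrow> (nat \<Rightarrow> real) \<Rightarrow> bool" where
  "spectral D A U l \<longleftrightarrow> unitary_mat D U \<and> A = U * real_diag D l * adj U"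

lemma real_diag_carrier [simp, intro]: "real_diag D l \<in> carrier_mat D D"
  by (auto simp: real_diag_def)

lemma dim_real_diag [simp]: "dim_row (real_diag D l) = D" "dim_col (real_diag D l) = D"
  by (auto simp: real_diag_def)

lemma index_real_diag [simp]:
  "i < D \<Longrightarrow> j < D \<Longrightarrow> real_diag D l $$ (i, j) = (if i = j then complex_of_real (l i) else 0)"
  by (auto simp: real_diag_def)

lemma adj_real_diag [simp]: "adj (real_diag D l) = real_diag D l"
  by (rule eq_matI) (auto simp: real_diag_def)

lemma index_mult_real_diag:
  assumes "A \<in> carrier_mat m D" "i < m" "j < D"
  shows "(A * real_diag D l) $$ (i, j) = A $$ (i, j) * complex_of_real (l j)"
  using assms by (subst index_mult_mat_sum[of _ m D _ D]) (auto simp: if_distrib cong: if_cong)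

lemma index_real_diag_mult:
  assumes "A \<in> carrier_mat D m" "i < D" "j < m"
  shows "(real_diag D l * A) $$ (i, j) = complex_of_real (l i) * A $$ (i, j)"
  using assms by (subst index_mult_mat_sum[of _ D D _ m]) (auto simp: if_distribR if_distrib[where f="\<lambda>x. x * _"] cong: if_cong)

lemma unitary_mat_carrier: "unitary_mat D U \<Longrightarrow> U \<in> carrier_mat D D"
  by (simp add: unitary_mat_def)

lemma unitary_mat_adj_mult: "unitary_mat D U \<Longrightarrow> adj U * U = 1\<^sub>m D"
  by (simp add: unitary_mat_def)

lemma unitary_mat_mult_adj: "unitary_mat D U \<Longrightarrow> U * adj U = 1\<^sub>m D"
  unfolding unitary_mat_def using mat_mult_left_right_inverse[of "adj U" D U] by auto

lemma unitary_mat_adj: "unitary_mat D U \<Longrightarrow> unitary_mat D (adj U)"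
  using unitary_mat_mult_adj unfolding unitary_mat_def by auto

lemma unitary_mat_mult:
  assumes "unitary_mat D U" "unitary_mat D V"
  shows "unitary_mat D (U * V)"
proof -
  have c: "U \<in> carrier_mat D D" "V \<in> carrier_mat D D" using assms by (auto simp: unitary_mat_def)
  have "adj (U * V) * (U * V) = (adj V * adj U) * (U * V)" using adj_mult[OF c] by simp
  also have "\<dots> = adj V * ((adj U * U) * V)"
    using c by (simp add: assoc_mult_mat[of _ D D _ D _ D])
  also have "\<dots> = 1\<^sub>m D" using assms c by (simp add: unitary_mat_def)
  finally show ?thesis using c by (simp add: unitary_mat_def)
qed

lemma spectral_carrier: "spectral D A U l \<Longrightarrow> A \<in> carrier_mat D D"
  unfolding spectral_def unitary_mat_def by auto

lemma spectral_hermitian: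
  assumes "spectral D A U l" shows "hermitian D A"
proof -
  have c: "U \<in> carrier_mat D D" using assms by (simp add: spectral_def unitary_mat_def)
  have "adj A = adj (adj U) * adj (U * real_diag D l)"
    using assms c unfolding spectral_def by (simp add: adj_mult[of _ D D _ D])
  also have "\<dots> = U * (real_diag D l * adj U)" using c by (simp add: adj_mult[of _ D D _ D])
  also have "\<dots> = A" using assms c by (simp add: spectral_def assoc_mult_mat[of _ D D _ D _ D])
  finally show ?thesis using spectral_carrier[OF assms] by (simp add: hermitian_def)
qed

lemma spectralI:
  assumes U: "unitary_mat D U" and A: "A \<in> carrier_mat D D" and e: "A * U = U * real_diag D l"
  shows "spectral D A U l"
proof -
  have c: "U \<in> carrier_mat D D" using U by (simp add: unitary_mat_def)
  have "A = A * (U * adj U)" using unitary_mat_mult_adj[OF U] A by simp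
  also have "\<dots> = U * real_diag D l * adj U"
    using A c e by (simp flip: assoc_mult_mat[of _ D D _ D _ D])
  finally show ?thesis using U by (simp add: spectral_def)
qed

lemma complex_scalar_prod_conj_self:
  fixes v :: "complex vec"
  shows "v \<bullet>c v = complex_of_real (\<Sum>k<dim_vec v. (cmod (v $ k))\<^sup>2)"
  unfolding scalar_prod_def
  by (auto intro!: sum.cong simp: complex_norm_square atLeast0LessThan simp del: of_real_power)

text \<open>Gram-Schmidt keeps the first vector of a basis that starts with \<open>v\<close> and
  yields orthogonal vectors that are not yet normalised. Dividing by the norms \<open>nn j\<close>
  makes the columns orthonormal, and column 0 remains a multiple of \<open>v\<close>.\<close>

lemma unitary_completion:
  fixes v :: "complex vec"
  assumes v: "v \<in> carrier_vec D" and v0: "v \<noteq> 0\<^sub>v D"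
  obtains W c where "unitary_mat D W" "col W 0 = c \<cdot>\<^sub>v v" "c \<noteq> 0"
proof -
  interpret cof_vec_space D "TYPE(complex)" .
  define b where "b = basis_completion v"
  from basis_completion[OF v v0, folded b_def]
  have dist_b: "distinct b" and indep: "\<not> lin_dep (set b)" and b: "set b \<subseteq> carrier_vec D"
    and hdb: "hd b = v" and len_b: "length b = D" by auto
  have D0: "D \<noteq> 0" using v v0 by auto
  then obtain vs where bv: "b = v # vs" using hdb len_b by (cases b) auto
  define ws where "ws = gram_schmidt D b"
  from gram_schmidt_result[OF b dist_b indep refl, folded ws_def]
  have ws: "set ws \<subseteq> carrier_vec D" "corthogonal ws" "length ws = D"
    by (auto simp: len_b)
  have hdws: "ws ! 0 = v"
    using gram_schmidt_hd[OF v, of vs, folded bv] ws(3) D0 unfolding ws_def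
    by (metis hd_conv_nth list.size(3))
  define nn where "nn j = sqrt (\<Sum>k<D. (cmod (ws ! j $ k))\<^sup>2)" for j
  have wc: "ws ! j \<in> carrier_vec D" if "j < D" for j using ws that by auto
  have ip: "ws ! i \<bullet>c ws ! j = (\<Sum>k<D. ws ! i $ k * cnj (ws ! j $ k))" if "i < D" "j < D" for i j
    using wc that unfolding scalar_prod_def by (auto simp: atLeast0LessThan intro!: sum.cong)
  have nn2: "ws ! j \<bullet>c ws ! j = complex_of_real ((nn j)\<^sup>2)" if "j < D" for j
    using complex_scalar_prod_conj_self[of "ws ! j"] wc[OF that] unfolding nn_def
    by (simp add: sum_nonneg)
  have nn0: "nn j \<noteq> 0" if "j < D" for j
    using corthogonalD[OF ws(2), of j j] nn2[OF that] that ws(3) by auto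
  define W where "W = mat D D (\<lambda>(i, j). ws ! j $ i / complex_of_real (nn j))"
  have Wc: "W \<in> carrier_mat D D" by (simp add: W_def)
  have "adj W * W = 1\<^sub>m D"
  proof (rule square_mat_eqI[of _ D])
    fix i j assume ij: "i < D" "j < D"
    have "(adj W * W) $$ (i, j) = (\<Sum>k<D. cnj (ws ! i $ k / nn i) * (ws ! j $ k / nn j))"
      using ij Wc by (subst index_mult_mat_sum[of _ D D _ D]) (auto intro!: sum.cong simp: W_def)
    also have "\<dots> = (ws ! j \<bullet>c ws ! i) / (complex_of_real (nn i) * complex_of_real (nn j))"
      unfolding ip[OF ij(2,1)] by (simp add: sum_divide_distrib field_simps)
    also have "\<dots> = 1\<^sub>m D $$ (i, j)"
      using ij nn2[OF ij(1)] nn0[OF ij(1)] corthogonalD[OF ws(2), of j i] ws(3)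
      by (auto simp: power2_eq_square)
    finally show "(adj W * W) $$ (i, j) = 1\<^sub>m D $$ (i, j)" .
  qed (use Wc in auto)
  then have "unitary_mat D W" using Wc by (simp add: unitary_mat_def)
  moreover have "col W 0 = (1 / complex_of_real (nn 0)) \<cdot>\<^sub>v v"
    by (rule eq_vecI) (use D0 v hdws in \<open>auto simp: W_def\<close>)
  ultimately show ?thesis using that nn0[of 0] D0 by auto
qed

lemma complex_eigenvector_exists:
  fixes A :: "complex mat"
  assumes "A \<in> carrier_mat (Suc D) (Suc D)"
  obtains v e where "v \<in> carrier_vec (Suc D)" "v \<noteq> 0\<^sub>v (Suc D)" "A *\<^sub>v v = e \<cdot>\<^sub>v v"
proof -
  obtain as where as: "char_poly A = (\<Prod>a\<leftarrow>as. [:- a, 1:])" "length as = Suc D"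
    using char_poly_factorized[OF assms] by auto
  then obtain e es where "as = e # es" by (cases as) auto
  then have "poly (char_poly A) e = 0" unfolding as by simp
  then have "eigenvalue A e" using eigenvalue_root_char_poly[OF assms] by simp
  then show ?thesis using that assms unfolding eigenvalue_def eigenvector_def by auto
qed

text \<open>Deflation by induction on the dimension: in an orthonormal basis whose first vector is
  an eigenvector, the first column of the matrix vanishes below the diagonal, and by symmetry the
  rest of the first row vanishes too. The remaining block is Hermitian and smaller.\<close>

theorem hermitian_spectral:
  assumes "hermitian D A"
  shows "\<exists>U l. spectral D A U l"
  using assms
proof (induction D arbitrary: A)
  case 0
  have "spectral 0 A (1\<^sub>m 0) (\<lambda>_. 0)"
    unfolding spectral_def unitary_mat_def using 0 by (auto simp: hermitian_def intro!: eq_matI)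
  then show ?case by blast
next
  case (Suc D A)
  let ?n = "Suc D"
  have A: "A \<in> carrier_mat ?n ?n" and hA: "adj A = A" using Suc.prems by (auto simp: hermitian_def)
  obtain v e where v: "v \<in> carrier_vec ?n" "v \<noteq> 0\<^sub>v ?n" "A *\<^sub>v v = e \<cdot>\<^sub>v v"
    using complex_eigenvector_exists[OF A] .
  obtain W c where W: "unitary_mat ?n W" and cW: "col W 0 = c \<cdot>\<^sub>v v"
    using unitary_completion[OF v(1,2)] .
  have Wc: "W \<in> carrier_mat ?n ?n" using W by (simp add: unitary_mat_def)
  define A' where "A' = adj W * (A * W)"
  have A': "A' \<in> carrier_mat ?n ?n" using A Wc by (auto simp: A'_def)
  have hA': "adj A' = A'"
    using A Wc hA unfolding A'_def
    by (simp add: adj_mult[of _ ?n ?n _ ?n] assoc_mult_mat[of _ ?n ?n _ ?n _ ?n])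
  have AW0: "(A * W) $$ (i, 0) = e * W $$ (i, 0)" if "i < ?n" for i
  proof -
    have "col (A * W) 0 = A *\<^sub>v col W 0" using A Wc by auto
    also have "\<dots> = e \<cdot>\<^sub>v col W 0" unfolding cW using v A
      by (simp add: mult_mat_vec[of _ ?n ?n] smult_smult_assoc mult.commute)
    finally have "col (A * W) 0 $ i = (e \<cdot>\<^sub>v col W 0) $ i" by simp
    then show ?thesis using A Wc that by auto
  qed
  have A'0: "A' $$ (i, 0) = (if i = 0 then e else 0)" if "i < ?n" for i
  proof -
    have "A' $$ (i, 0) = (\<Sum>k<?n. adj W $$ (i, k) * (e * W $$ (k, 0)))"
      unfolding A'_def using A Wc that AW0
      by (subst index_mult_mat_sum[of _ ?n ?n _ ?n]) (auto intro!: sum.cong simp del: index_mult_mat)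
    also have "\<dots> = e * (adj W * W) $$ (i, 0)"
      using Wc that by (subst index_mult_mat_sum[of _ ?n ?n _ ?n])
        (auto simp: sum_distrib_left mult.left_commute simp del: index_adj sum.lessThan_Suc intro!: sum.cong)
    finally show ?thesis using W that by (auto simp: unitary_mat_def)
  qed
  have A'0': "A' $$ (0, i) = (if i = 0 then e else 0)" if "i < ?n" for i
  proof (cases "i = 0")
    case False
    have "A' $$ (0, i) = cnj (A' $$ (i, 0))" using hA' A' that by (metis index_adj carrier_matD zero_less_Suc)
    then show ?thesis using A'0[OF that] False by simp
  qed (use A'0[of 0] in simp)
  have e: "e = complex_of_real (Re e)"
  proof -
    have "A' $$ (0, 0) = cnj (A' $$ (0, 0))" using hA' A' by (metis index_adj carrier_matD zero_less_Suc)
    then have "e = cnj e" using A'0[of 0] by simp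
    then show ?thesis by (metis Reals_cnj_iff of_real_Re)
  qed
  define A3 where "A3 = mat D D (\<lambda>(i, j). A' $$ (Suc i, Suc j))"
  have "hermitian D A3"
    unfolding hermitian_def
  proof
    show "adj A3 = A3"
    proof (rule square_mat_eqI[of _ D])
      fix i j assume ij: "i < D" "j < D"
      have "A' $$ (Suc i, Suc j) = cnj (A' $$ (Suc j, Suc i))"
        using hA' A' ij by (metis index_adj carrier_matD Suc_mono)
      then show "adj A3 $$ (i, j) = A3 $$ (i, j)" using ij by (simp add: A3_def adj_def)
    qed (auto simp: A3_def)
  qed (simp add: A3_def)
  then obtain U3 l3 where s3: "spectral D A3 U3 l3" using Suc.IH by blast
  have U3: "unitary_mat D U3" and U3c: "U3 \<in> carrier_mat D D"
    using s3 by (auto simp: spectral_def unitary_mat_def)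
  have A3U: "A3 * U3 = U3 * real_diag D l3"
    using s3 U3c unitary_mat_adj_mult[OF U3] unfolding spectral_def
    by (simp add: assoc_mult_mat[of _ D D _ D _ D])
  \<comment> \<open>Block matrix with blocks 1 and \<open>U3\<close>; it diagonalises
    \<open>A'\<close>, with \<open>e\<close> placed in front of the eigenvalues
    \<open>l3\<close>.\<close>
  define U' where "U' = mat ?n ?n (\<lambda>(i, j). case (i, j) of (0, 0) \<Rightarrow> 1 | (Suc a, Suc b) \<Rightarrow> U3 $$ (a, b) | _ \<Rightarrow> 0)"
  define l where "l i = (case i of 0 \<Rightarrow> Re e | Suc a \<Rightarrow> l3 a)" for i
  have U'c: "U' \<in> carrier_mat ?n ?n" by (simp add: U'_def)
  have U'i [simp]: "U' $$ (0, 0) = 1" "a < D \<Longrightarrow> U' $$ (Suc a, 0) = 0" "a < D \<Longrightarrow> U' $$ (0, Suc a) = 0"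
      "a < D \<Longrightarrow> b < D \<Longrightarrow> U' $$ (Suc a, Suc b) = U3 $$ (a, b)" for a b
    by (auto simp: U'_def)
  have "adj U' * U' = 1\<^sub>m ?n"
  proof (rule square_mat_eqI[of _ "?n"])
    fix i j assume ij: "i < ?n" "j < ?n"
    have "(adj U' * U') $$ (i, j) = cnj (U' $$ (0, i)) * U' $$ (0, j)
        + (\<Sum>k<D. cnj (U' $$ (Suc k, i)) * U' $$ (Suc k, j))"
      using U'c ij by (subst index_mult_mat_sum[of _ ?n ?n _ ?n])
        (auto simp: sum.lessThan_Suc_shift simp del: sum.lessThan_Suc)
    also have "\<dots> = 1\<^sub>m ?n $$ (i, j)"
    proof (cases i; cases j)
      fix a b assume ab: "i = Suc a" "j = Suc b"
      then have "(\<Sum>k<D. cnj (U' $$ (Suc k, i)) * U' $$ (Suc k, j)) = (adj U3 * U3) $$ (a, b)"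
        using ij U3c by (subst index_mult_mat_sum[of _ D D _ D]) auto
      then show ?thesis using ab ij unitary_mat_adj_mult[OF U3] by simp
    qed (use ij in auto)
    finally show "(adj U' * U') $$ (i, j) = 1\<^sub>m ?n $$ (i, j)" .
  qed (use U'c in auto)
  then have U': "unitary_mat ?n U'" using U'c by (simp add: unitary_mat_def)
  have A'U': "A' * U' = U' * real_diag ?n l"
  proof (rule square_mat_eqI[of _ "?n"])
    fix i j assume ij: "i < ?n" "j < ?n"
    have "(A' * U') $$ (i, j) = A' $$ (i, 0) * U' $$ (0, j) + (\<Sum>k<D. A' $$ (i, Suc k) * U' $$ (Suc k, j))"
      using U'c A' ij by (subst index_mult_mat_sum[of _ ?n ?n _ ?n])
        (auto simp: sum.lessThan_Suc_shift simp del: sum.lessThan_Suc)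
    also have "\<dots> = U' $$ (i, j) * complex_of_real (l j)"
    proof (cases i; cases j)
      fix a b assume ab: "i = Suc a" "j = Suc b"
      then have "(\<Sum>k<D. A' $$ (i, Suc k) * U' $$ (Suc k, j)) = (A3 * U3) $$ (a, b)"
        using ij U3c by (subst index_mult_mat_sum[of _ D D _ D]) (auto simp: A3_def)
      also have "\<dots> = U3 $$ (a, b) * complex_of_real (l3 b)"
        unfolding A3U using ab ij U3c by (subst index_mult_real_diag[of _ D]) auto
      finally show ?thesis using ab ij A'0 by (simp add: l_def)
    qed (use ij A'0 A'0' e in \<open>auto simp: l_def\<close>)
    finally show "(A' * U') $$ (i, j) = (U' * real_diag ?n l) $$ (i, j)"
      using U'c ij by (subst index_mult_real_diag[of _ ?n]) auto
  qed (use A' U'c in \<open>auto simp: real_diag_def\<close>)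
  have "W * A' = (W * adj W) * (A * W)"
    unfolding A'_def using Wc A by (simp add: assoc_mult_mat[of _ ?n ?n _ ?n _ ?n])
  then have WA': "W * A' = A * W" using unitary_mat_mult_adj[OF W] A Wc by simp
  have "A * (W * U') = W * A' * U'"
    using A Wc U'c WA' by (simp add: assoc_mult_mat[of _ ?n ?n _ ?n _ ?n])
  also have "\<dots> = (W * U') * real_diag ?n l"
    using A' Wc U'c A'U' by (simp add: assoc_mult_mat[of _ ?n ?n _ ?n _ ?n])
  finally have "spectral ?n A (W * U') l"
    using spectralI[OF unitary_mat_mult[OF W U'] A] by simp
  then show ?case by blast
qed

text \<open>The p-th power of the norm, without the outer root: for Hermitian matrices a plain sum
  over eigenvalues, in which convexity and the parallelogram inequality take their simplest
  form.\<close>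

definition schatten_power :: "real \<Rightarrow> complex mat \<Rightarrow> real" where
  "schatten_power p A = (\<Sum>s\<in>#singular_values A. s powr p)"

lemma schatten_norm_power: "schatten_norm p A = schatten_power p A powr (1 / p)"
  by (simp add: schatten_norm_def schatten_power_def)

lemma schatten_power_nonneg:
  "schatten_power p A \<ge> 0"
proof -
  have "(\<Sum>s\<in>#X. s powr p) \<ge> 0" for X :: "real multiset" by (induction X) auto
  then show ?thesis unfolding schatten_power_def .
qed

section \<open>Scalar inequalities for powers\<close>

text \<open>Young's inequality with the conjugate exponents p and p / (p - 1) gives the tangent line
  without differentiating, so that x = 0 is covered.\<close>

lemma powr_tangent:
  fixes x y p :: real
  assumes "p \<ge> 1" "x \<ge> 0" "y \<ge> 0"
  shows "x powr p + p * x powr (p - 1) * (y - x) \<le> y powr p"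
proof (cases "p = 1")
  case True
  then show ?thesis using assms by auto
next
  case False
  note assms = assms False
  have "y * x powr (p - 1) \<le> y powr p / p + (x powr (p - 1)) powr (p / (p - 1)) / (p / (p - 1))"
    using assms by (intro Youngs_inequality) (auto simp: field_simps)
  also have "(x powr (p - 1)) powr (p / (p - 1)) = x powr p"
    using assms by (simp add: powr_powr)
  finally have "p * (y * x powr (p - 1)) \<le> y powr p + (p - 1) * x powr p"
    using assms by (simp add: field_simps)
  moreover have "x powr (p - 1) * x = x powr p"
    using assms by (cases "x = 0") (auto simp: powr_diff)
  ultimately show ?thesis by (simp add: algebra_simps)
qed

lemma abs_powr_tangent:
  fixes x y p :: real
  assumes "p \<ge> 1"
  shows "\<bar>x\<bar> powr p + p * (sgn x * \<bar>x\<bar> powr (p - 1)) * (y - x) \<le> \<bar>y\<bar> powr p"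
proof -
  have "\<bar>x\<bar> powr p + p * \<bar>x\<bar> powr (p - 1) * (\<bar>y\<bar> - \<bar>x\<bar>) \<le> \<bar>y\<bar> powr p"
    using powr_tangent[of p "\<bar>x\<bar>" "\<bar>y\<bar>"] assms by simp
  moreover have "p * \<bar>x\<bar> powr (p - 1) * (sgn x * (y - x)) \<le> p * \<bar>x\<bar> powr (p - 1) * (\<bar>y\<bar> - \<bar>x\<bar>)"
    using assms by (intro mult_left_mono) (auto simp: sgn_if)
  ultimately show ?thesis by (simp add: mult_ac)
qed

lemma powr_tangent_concave:
  fixes x y q :: real
  assumes "0 < q" "q \<le> 1" "x > 0" "y \<ge> 0"
  shows "y powr q \<le> x powr q + q * x powr (q - 1) * (y - x)"
proof (cases "y = 0")
  case True
  have "x powr (q - 1) * x = x powr q" using assms by (simp add: powr_diff)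
  then have "x powr q + q * x powr (q - 1) * (y - x) = (1 - q) * x powr q"
    using True by (simp add: algebra_simps)
  then show ?thesis using assms True by simp
next
  case False
  have "y powr q * x powr (1 - q) \<le> q * y + (1 - q) * x"
    using Youngs_inequality_0[of q "1 - q" y x] assms False by simp
  then have "y powr q * x powr (1 - q) * x powr (q - 1) \<le> (q * y + (1 - q) * x) * x powr (q - 1)"
    by (intro mult_right_mono) auto
  also have "y powr q * x powr (1 - q) * x powr (q - 1) = y powr q"
    using assms by (simp add: mult.assoc flip: powr_add)
  finally have "y powr q \<le> (q * y + (1 - q) * x) * x powr (q - 1)" .
  moreover have "x powr (q - 1) * x = x powr q" using assms by (simp add: powr_diff)
  ultimately show ?thesis by (simp add: algebra_simps)
qed

lemma powr_second_order_pos: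
  fixes x y p :: real
  assumes "p \<ge> 2" "x > 0" "y > 0"
  shows "y powr p \<le> x powr p + p * x powr (p - 1) * (y - x)
           + p * (p - 1) / 2 * max x y powr (p - 2) * (y - x)\<^sup>2"
proof (cases "y = x")
  case False
  define df where "df m t = (if m = 0 then t powr p else if m = Suc 0 then p * t powr (p - 1)
      else p * (p - 1) * t powr (p - 2))" for m :: nat and t :: real
  have "\<exists>t. (if y < x then y < t \<and> t < x else x < t \<and> t < y) \<and>
      y powr p = (\<Sum>m<2. df m x / fact m * (y - x) ^ m) + df 2 t / fact 2 * (y - x) ^ 2"
  proof (rule Taylor[where a = "min x y" and b = "max x y"])
    show "\<forall>m t. m < 2 \<and> min x y \<le> t \<and> t \<le> max x y \<longrightarrow> DERIV (df m) t :> df (Suc m) t"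
    proof (intro allI impI)
      fix m :: nat and t assume h: "m < 2 \<and> min x y \<le> t \<and> t \<le> max x y"
      then have t: "t > 0" using assms by (auto simp: min_def split: if_splits)
      consider "m = 0" | "m = 1" using h by linarith
      then show "DERIV (df m) t :> df (Suc m) t"
      proof cases
        case 1 then show ?thesis unfolding df_def using t
          by (auto intro!: derivative_eq_intros)
      next
        case 2 
        have "DERIV (\<lambda>t. p * t powr (p - 1)) t :> p * (p - 1) * t powr (p - 2)"
          using t by (auto intro!: derivative_eq_intros)
        then show ?thesis using 2 unfolding df_def by simp
      qed
    qed
  qed (use False in \<open>auto simp: df_def\<close>)
  then obtain t where t: "if y < x then y < t \<and> t < x else x < t \<and> t < y"
    and eq: "y powr p = (\<Sum>m<2. df m x / fact m * (y - x) ^ m) + df 2 t / fact 2 * (y - x) ^ 2"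
    by blast
  have "t powr (p - 2) \<le> max x y powr (p - 2)"
    using t assms by (intro powr_mono2) (auto split: if_splits)
  then have "p * (p - 1) / 2 * t powr (p - 2) * (y - x)\<^sup>2
     \<le> p * (p - 1) / 2 * max x y powr (p - 2) * (y - x)\<^sup>2"
    using assms by (intro mult_right_mono mult_left_mono) auto
  then show ?thesis unfolding eq by (simp add: df_def numeral_2_eq_2)
qed simp

text \<open>For positive x and y this is Taylor's formula, whose intermediate point is at most the
  maximum. For y \<le> 0 the segment from x to y meets the point 0; there both sides are expanded in
  x and z = -y and compared coefficient by coefficient.\<close>

lemma powr_second_order_max:
  fixes x y p :: real
  assumes p: "p \<ge> 2" and x: "x \<ge> 0"
  shows "\<bar>y\<bar> powr p \<le> x powr p + p * x powr (p - 1) * (y - x)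
           + p * (p - 1) / 2 * max x \<bar>y\<bar> powr (p - 2) * (y - x)\<^sup>2"
proof -
  define m where "m = max x \<bar>y\<bar>"
  have split: "t powr p = t powr (p - 2) * t\<^sup>2" "t powr (p - 1) = t powr (p - 2) * t" if "t \<ge> 0" for t :: real
    using that by (cases "t = 0"; simp add: powr_diff power2_eq_square field_simps)+
  \<comment> \<open>The coefficients 1, p - 1 and p of the expansion for y \<le> 0, against those of
    \<open>p * (p - 1) / 2 * (x + z)\<^sup>2\<close>.\<close>
  have pp: "1 \<le> p * (p - 1) / 2" "p - 1 \<le> p * (p - 1) / 2" "p \<le> p * (p - 1)"
  proof -
    have "0 \<le> (p - 2) * (p - 1)" "0 \<le> p * (p - 2)" "0 \<le> (p - 2) * (p + 1)" using p by simp_all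
    then show "1 \<le> p * (p - 1) / 2" "p - 1 \<le> p * (p - 1) / 2" "p \<le> p * (p - 1)"
      by (simp_all add: algebra_simps)
  qed
  consider "x > 0" "y > 0" | "y \<le> 0" | "x = 0" using x by linarith
  then show ?thesis
  proof cases
    case 1
    then show ?thesis using powr_second_order_pos[OF p, of x y] by simp
  next
    case 2
    define z where "z = - y"
    have z: "z \<ge> 0" "\<bar>y\<bar> = z" "y = - z" using 2 by (auto simp: z_def)
    have mz: "z powr (p - 2) \<le> m powr (p - 2)" "x powr (p - 2) \<le> m powr (p - 2)"
      using p x z unfolding m_def by (auto intro!: powr_mono2)
    have "\<bar>y\<bar> powr p - x powr p - p * x powr (p - 1) * (y - x)
        = z powr (p - 2) * z\<^sup>2 + (p - 1) * (x powr (p - 2) * x\<^sup>2) + p * (x powr (p - 2) * (x * z))"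
      unfolding z(2) unfolding z(3) split[OF z(1)] split[OF x] by (simp add: algebra_simps power2_eq_square)
    also have "\<dots> \<le> m powr (p - 2) * z\<^sup>2 + (p - 1) * (m powr (p - 2) * x\<^sup>2) + p * (m powr (p - 2) * (x * z))"
      using mz p x z by (intro add_mono mult_right_mono mult_left_mono) auto
    also have "\<dots> = m powr (p - 2) * (1 * z\<^sup>2 + (p - 1) * x\<^sup>2 + p * (x * z))"
      by (simp add: algebra_simps)
    also have "\<dots> \<le> m powr (p - 2) * (p * (p - 1) / 2 * z\<^sup>2 + p * (p - 1) / 2 * x\<^sup>2 + p * (p - 1) * (x * z))"
      using pp x z by (intro add_mono mult_right_mono mult_left_mono) auto
    also have "\<dots> = p * (p - 1) / 2 * m powr (p - 2) * (y - x)\<^sup>2"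
      unfolding z(3) by (simp add: power2_eq_square field_simps)
    finally show ?thesis unfolding m_def by simp
  next
    case 3
    have "1 * (\<bar>y\<bar> powr (p - 2) * \<bar>y\<bar>\<^sup>2) \<le> p * (p - 1) / 2 * (\<bar>y\<bar> powr (p - 2) * \<bar>y\<bar>\<^sup>2)"
      using pp by (intro mult_right_mono) auto
    then show ?thesis using 3 p unfolding split(1)[of "\<bar>y\<bar>", simplified] by (simp add: max_def)
  qed
qed

text \<open>The maximum is replaced by a sum so that the remainder separates into a term weighted by
  x alone and one weighted by y alone; in a double sum over two eigenbases each can then be summed
  over the other index first.\<close>

lemma abs_powr_second_order:
  fixes x y p :: real
  assumes p: "p \<ge> 2"
  shows "\<bar>y\<bar> powr p \<le> \<bar>x\<bar> powr p + p * (sgn x * \<bar>x\<bar> powr (p - 1)) * (y - x)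
           + p * (p - 1) / 2 * (\<bar>x\<bar> powr (p - 2) + \<bar>y\<bar> powr (p - 2)) * (y - x)\<^sup>2"
proof -
  have "max \<bar>x\<bar> \<bar>y\<bar> powr (p - 2) \<le> \<bar>x\<bar> powr (p - 2) + \<bar>y\<bar> powr (p - 2)"
    by (simp add: max_def)
  then have *: "p * (p - 1) / 2 * max \<bar>x\<bar> \<bar>y\<bar> powr (p - 2) * (y - x)\<^sup>2
      \<le> p * (p - 1) / 2 * (\<bar>x\<bar> powr (p - 2) + \<bar>y\<bar> powr (p - 2)) * (y - x)\<^sup>2"
    using p by (intro mult_right_mono mult_left_mono) auto
  have sq: "(- y - - x)\<^sup>2 = (y - x)\<^sup>2" by (simp add: power2_eq_square algebra_simps)
  have "\<bar>y\<bar> powr p \<le> \<bar>x\<bar> powr p + p * (sgn x * \<bar>x\<bar> powr (p - 1)) * (y - x)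
           + p * (p - 1) / 2 * max \<bar>x\<bar> \<bar>y\<bar> powr (p - 2) * (y - x)\<^sup>2"
  proof (cases "x \<ge> 0")
    case True
    then show ?thesis using powr_second_order_max[OF p True, of y] p by (cases "x = 0") auto
  next
    case False
    have "\<bar>- y\<bar> powr p \<le> (- x) powr p + p * (- x) powr (p - 1) * (- y - - x)
           + p * (p - 1) / 2 * max (- x) \<bar>- y\<bar> powr (p - 2) * (- y - - x)\<^sup>2"
      by (rule powr_second_order_max[OF p]) (use False in auto)
    then show ?thesis using False unfolding sq by (simp add: algebra_simps)
  qed
  then show ?thesis using * by linarith
qed

section \<open>Hoelder's inequality for finite sums and the scalar recursion\<close>

lemma Holder_sum:
  fixes a b :: "'i \<Rightarrow> real"
  assumes "r > 1" "s > 1" "1 / r + 1 / s = 1" and a: "\<And>i. i \<in> I \<Longrightarrow> a i \<ge> 0" and b: "\<And>i. i \<in> I \<Longrightarrow> b i \<ge> 0"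
  shows "(\<Sum>i\<in>I. a i * b i) \<le> (\<Sum>i\<in>I. a i powr r) powr (1 / r) * (\<Sum>i\<in>I. b i powr s) powr (1 / s)"
proof (cases "finite I")
  case True
  define A where "A = (\<Sum>i\<in>I. a i powr r)"
  define B where "B = (\<Sum>i\<in>I. b i powr s)"
  have nn: "A \<ge> 0" "B \<ge> 0" unfolding A_def B_def by (auto intro!: sum_nonneg)
  show ?thesis
  proof (cases "A = 0 \<or> B = 0")
    case t: True
    have "a i * b i = 0" if "i \<in> I" for i
      using t that True a[of i] b[of i] unfolding A_def B_def
      by (auto simp: sum_nonneg_eq_0_iff)
    then have "(\<Sum>i\<in>I. a i * b i) = 0" by (rule sum.neutral[rule_format])
    then show ?thesis by simp
  next
    case False
    then have pos: "A > 0" "B > 0" using nn by auto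
    define A' where "A' = A powr (1 / r)"
    define B' where "B' = B powr (1 / s)"
    have A': "A' > 0" "A' powr r = A" and B': "B' > 0" "B' powr s = B"
      using pos assms by (auto simp: A'_def B'_def powr_powr)
    have "(\<Sum>i\<in>I. (a i / A') * (b i / B')) \<le> (\<Sum>i\<in>I. a i powr r / A / r + b i powr s / B / s)"
    proof (rule sum_mono)
      fix i assume "i \<in> I"
      then have "(a i / A') * (b i / B') \<le> (a i / A') powr r / r + (b i / B') powr s / s"
        using a b A' B' assms by (intro Youngs_inequality) auto
      also have "\<dots> = a i powr r / A / r + b i powr s / B / s"
        using a b A' B' \<open>i \<in> I\<close> by (simp add: powr_divide)
      finally show "(a i / A') * (b i / B') \<le> a i powr r / A / r + b i powr s / B / s" .
    qed
    also have "\<dots> = A / A / r + B / B / s"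
      unfolding sum.distrib sum_divide_distrib[symmetric] A_def[symmetric] B_def[symmetric] ..
    also have "\<dots> = 1" using pos assms by simp
    finally have "(\<Sum>i\<in>I. a i * b i) / (A' * B') \<le> 1"
      by (simp add: sum_divide_distrib)
    then show ?thesis using A' B' unfolding A'_def B'_def A_def B_def by (simp add: field_simps)
  qed
qed simp

lemma Holder_sum_weights:
  fixes l b :: "'i \<Rightarrow> real"
  assumes p: "p \<ge> 2" and b: "\<And>i. i \<in> I \<Longrightarrow> b i \<ge> 0"
  shows "(\<Sum>i\<in>I. \<bar>l i\<bar> powr (p - 2) * b i)
     \<le> (\<Sum>i\<in>I. \<bar>l i\<bar> powr p) powr ((p - 2) / p) * (\<Sum>i\<in>I. b i powr (p / 2)) powr (2 / p)"
proof (cases "p = 2")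
  case False
  then have p: "p > 2" using p by simp
  have "(\<Sum>i\<in>I. \<bar>l i\<bar> powr (p - 2) * b i)
     \<le> (\<Sum>i\<in>I. (\<bar>l i\<bar> powr (p - 2)) powr (p / (p - 2))) powr (1 / (p / (p - 2)))
        * (\<Sum>i\<in>I. b i powr (p / 2)) powr (1 / (p / 2))"
    using p b by (intro Holder_sum) (auto simp: field_simps)
  then show ?thesis using p by (simp add: powr_powr)
next
  case True
  \<comment> \<open>For p = 2 the conjugate exponent is infinite and \<open>0 powr 0 = 0\<close>:
    the first factor on the right is 1 unless the sum of powers is 0, and in that case the left side
    is 0 as well.\<close>
  show ?thesis
  proof (cases "(\<Sum>i\<in>I. \<bar>l i\<bar> powr p) = 0")
    case t: True
    show ?thesis
    proof (cases "finite I")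
      case fin: True
      then have "\<bar>l i\<bar> powr (p - 2) * b i = 0" if "i \<in> I" for i
        using t that True by (auto simp: sum_nonneg_eq_0_iff)
      then have "(\<Sum>i\<in>I. \<bar>l i\<bar> powr (p - 2) * b i) = 0" by (rule sum.neutral[rule_format])
      then show ?thesis by simp
    qed simp
  next
    case False
    have "(\<Sum>i\<in>I. \<bar>l i\<bar> powr (p - 2) * b i) \<le> (\<Sum>i\<in>I. b i)"
      using True b by (intro sum_mono) (auto simp: mult_left_le_one_le)
    then show ?thesis using True False b by (simp add: sum_nonneg)
  qed
qed

text \<open>The unknown y occurs on both sides. For x < y, division by \<open>y powr p\<close>
  leaves the single ratio \<open>r\<close>. If \<open>r powr (p / 2)\<close> is at least 1/2, the
  tangent of this power at r, evaluated at 1, bounds 1 - r and gives the increment; otherwise the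
  remainder alone exceeds 1/2 and y itself is small.\<close>

lemma powr_recursion_step:
  fixes x y R p :: real
  assumes p: "p \<ge> 2" and x: "x \<ge> 0" and y: "y \<ge> 0"
    and le: "y powr p \<le> x powr p + p * (p - 1) / 2 * (x powr (p - 2) + y powr (p - 2)) * R\<^sup>2"
  shows "y\<^sup>2 \<le> x\<^sup>2 + 4 * (p - 1) * R\<^sup>2 \<or> y\<^sup>2 \<le> 2 * p * (p - 1) * R\<^sup>2"
proof (cases "y \<le> x")
  case True
  then have "y\<^sup>2 \<le> x\<^sup>2" using y by (intro power_mono) auto
  moreover have "0 \<le> 4 * (p - 1) * R\<^sup>2" using p by simp
  ultimately show ?thesis by linarith
next
  case False
  then have yx: "x < y" "y > 0" using x by auto
  define r where "r = x\<^sup>2 / y\<^sup>2"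
  have r: "0 \<le> r" "r < 1" using x yx by (auto simp: r_def field_simps power_strict_mono)
  have rp: "r powr (p / 2) = x powr p / y powr p"
    using x yx unfolding r_def
    by (cases "x = 0") (auto simp: powr_divide powr_powr simp flip: powr_numeral)
  have "x powr (p - 2) \<le> y powr (p - 2)" using x yx p by (intro powr_mono2) auto
  then have "p * (p - 1) / 2 * (x powr (p - 2) + y powr (p - 2)) * R\<^sup>2
      \<le> p * (p - 1) / 2 * (2 * y powr (p - 2)) * R\<^sup>2"
    using p by (intro mult_right_mono mult_left_mono) auto
  then have "y powr p \<le> x powr p + p * (p - 1) * R\<^sup>2 * y powr (p - 2)"
    using le by (simp add: mult_ac)
  also have "y powr (p - 2) = y powr p / y\<^sup>2" using yx by (simp add: powr_diff)
  finally have "y powr p \<le> y powr p * (r powr (p / 2) + p * (p - 1) * R\<^sup>2 / y\<^sup>2)"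
    using yx unfolding rp by (simp add: distrib_left mult_ac)
  then have main: "1 \<le> r powr (p / 2) + p * (p - 1) * R\<^sup>2 / y\<^sup>2"
    using yx by simp
  show ?thesis
  proof (cases "r powr (p / 2) \<ge> 1 / 2")
    case True
    then have r0: "r > 0" using r(1) by (cases "r = 0") auto
    have "r powr (p / 2) + p / 2 * r powr (p / 2 - 1) * (1 - r) \<le> 1"
      using powr_tangent[of "p / 2" r 1] p r by simp
    moreover have "1 / 2 \<le> r powr (p / 2 - 1)"
    proof -
      have "r powr (p / 2) \<le> r powr (p / 2 - 1)" using r r0 by (intro powr_mono') auto
      then show ?thesis using True by linarith
    qed
    \<comment> \<open>The slope is at least p / 4, against p (p - 1) in the remainder: this is the
      origin of the factor 4 (p - 1).\<close>
    then have "p / 2 * (1 / 2) * (1 - r) \<le> p / 2 * r powr (p / 2 - 1) * (1 - r)"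
      using p r by (intro mult_right_mono mult_left_mono) auto
    ultimately have "p / 2 * (1 / 2) * (1 - r) \<le> p * (p - 1) * R\<^sup>2 / y\<^sup>2" using main by linarith
    then have "p / 4 * (1 - r) * y\<^sup>2 \<le> p * (p - 1) * R\<^sup>2" using yx by (simp add: field_simps)
    moreover have "(1 - r) * y\<^sup>2 = y\<^sup>2 - x\<^sup>2" using yx by (simp add: r_def field_simps)
    ultimately have "p * (y\<^sup>2 - x\<^sup>2) \<le> p * ((p - 1) * (R\<^sup>2 * 4))" by (simp add: mult.assoc)
    then have "y\<^sup>2 - x\<^sup>2 \<le> (p - 1) * (R\<^sup>2 * 4)" using p by simp
    also have "\<dots> = 4 * (p - 1) * R\<^sup>2" by simp
    finally show ?thesis by linarith
  next
    case False
    then have "1 / 2 \<le> p * (p - 1) * R\<^sup>2 / y\<^sup>2" using main by linarith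
    then show ?thesis using yx by (simp add: field_simps)
  qed
qed

section \<open>Trace inequalities for Hermitian matrices\<close>

text \<open>Jensen's inequality in each row: the tangent at the row average \<open>x\<close> loses
  its linear term because the row sums to 1. Unit column sums then remove the weights.\<close>

lemma doubly_stochastic_powr_le:
  fixes c :: "nat \<Rightarrow> nat \<Rightarrow> real" and l :: "nat \<Rightarrow> real"
  assumes p: "p \<ge> 1" and c: "\<And>i k. c i k \<ge> 0"
    and row: "\<And>i. i < D \<Longrightarrow> (\<Sum>k<D. c i k) = 1" and col: "\<And>k. k < D \<Longrightarrow> (\<Sum>i<D. c i k) = 1"
  shows "(\<Sum>i<D. \<bar>\<Sum>k<D. c i k * l k\<bar> powr p) \<le> (\<Sum>k<D. \<bar>l k\<bar> powr p)"
proof -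
  have "(\<Sum>i<D. \<bar>\<Sum>k<D. c i k * l k\<bar> powr p) \<le> (\<Sum>i<D. \<Sum>k<D. c i k * \<bar>l k\<bar> powr p)"
  proof (rule sum_mono)
    fix i assume i: "i \<in> {..<D}"
    define x where "x = (\<Sum>k<D. c i k * l k)"
    define s where "s = p * (sgn x * \<bar>x\<bar> powr (p - 1))"
    have "(\<Sum>k<D. c i k * (\<bar>x\<bar> powr p + s * (l k - x))) \<le> (\<Sum>k<D. c i k * \<bar>l k\<bar> powr p)"
      unfolding s_def using c by (intro sum_mono mult_left_mono abs_powr_tangent[OF p]) auto
    moreover have "(\<Sum>k<D. c i k * (\<bar>x\<bar> powr p + s * (l k - x)))
        = (\<bar>x\<bar> powr p - s * x) * (\<Sum>k<D. c i k) + s * (\<Sum>k<D. c i k * l k)"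
      by (simp add: sum_distrib_left algebra_simps sum.distrib sum_subtractf)
    moreover have "\<dots> = \<bar>x\<bar> powr p" using row i by (simp add: x_def)
    ultimately show "\<bar>\<Sum>k<D. c i k * l k\<bar> powr p \<le> (\<Sum>k<D. c i k * \<bar>l k\<bar> powr p)"
      unfolding x_def by simp
  qed
  also have "\<dots> = (\<Sum>k<D. (\<Sum>i<D. c i k) * \<bar>l k\<bar> powr p)"
    by (subst sum.swap) (simp add: sum_distrib_right)
  also have "\<dots> = (\<Sum>k<D. \<bar>l k\<bar> powr p)" using col by simp
  finally show ?thesis .
qed

lemma doubly_stochastic_powr_ge:
  fixes c :: "nat \<Rightarrow> nat \<Rightarrow> real" and l :: "nat \<Rightarrow> real"
  assumes q: "0 < q" "q \<le> 1" and c: "\<And>i k. c i k \<ge> 0" and l: "\<And>k. k < D \<Longrightarrow> l k \<ge> 0"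
    and row: "\<And>i. i < D \<Longrightarrow> (\<Sum>k<D. c i k) = 1" and col: "\<And>k. k < D \<Longrightarrow> (\<Sum>i<D. c i k) = 1"
  shows "(\<Sum>k<D. l k powr q) \<le> (\<Sum>i<D. (\<Sum>k<D. c i k * l k) powr q)"
proof -
  have "(\<Sum>k<D. l k powr q) = (\<Sum>k<D. (\<Sum>i<D. c i k) * l k powr q)" using col by simp
  also have "\<dots> = (\<Sum>i<D. \<Sum>k<D. c i k * l k powr q)"
    by (subst sum.swap) (simp add: sum_distrib_right)
  also have "\<dots> \<le> (\<Sum>i<D. (\<Sum>k<D. c i k * l k) powr q)"
  proof (rule sum_mono)
    fix i assume i: "i \<in> {..<D}"
    define x where "x = (\<Sum>k<D. c i k * l k)"
    have x0: "x \<ge> 0" unfolding x_def using c l by (intro sum_nonneg) auto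
    \<comment> \<open>A concave power has no tangent at 0. If the average is 0, then so is every
      \<open>c i k * l k\<close>, hence every term on the left.\<close>
    have "(\<Sum>k<D. c i k * l k powr q) \<le> x powr q"
    proof (cases "x = 0")
      case True
      then have "\<forall>k\<in>{..<D}. c i k * l k = 0"
        unfolding x_def using c l by (subst (asm) sum_nonneg_eq_0_iff) auto
      then have "(\<Sum>k<D. c i k * l k powr q) = 0" by (intro sum.neutral) auto
      then show ?thesis by simp
    next
      case False
      define s where "s = q * x powr (q - 1)"
      have "(\<Sum>k<D. c i k * l k powr q) \<le> (\<Sum>k<D. c i k * (x powr q + s * (l k - x)))"
        unfolding s_def using c l x0 False q
        by (intro sum_mono mult_left_mono powr_tangent_concave) auto
      also have "\<dots> = (x powr q - s * x) * (\<Sum>k<D. c i k) + s * (\<Sum>k<D. c i k * l k)"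
        by (simp add: sum_distrib_left algebra_simps sum.distrib sum_subtractf)
      also have "\<dots> = x powr q" using row i by (simp add: x_def)
      finally show ?thesis .
    qed
    then show "(\<Sum>k<D. c i k * l k powr q) \<le> (\<Sum>k<D. c i k * l k) powr q" by (simp add: x_def)
  qed
  finally show ?thesis .
qed

section \<open>Overlaps of orthonormal bases and quadratic forms\<close>

lemma cmod_square_sum_row:
  assumes "X \<in> carrier_mat D D" "i < D"
  shows "(X * adj X) $$ (i, i) = complex_of_real (\<Sum>j<D. (cmod (X $$ (i, j)))\<^sup>2)"
  using assms by (subst index_mult_mat_sum[of _ D D _ D])
    (auto simp: complex_norm_square simp del: of_real_power intro!: sum.cong)

lemma cmod_square_sum_col:
  assumes "X \<in> carrier_mat D D" "i < D"
  shows "(adj X * X) $$ (i, i) = complex_of_real (\<Sum>j<D. (cmod (X $$ (j, i)))\<^sup>2)"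
  using assms by (subst index_mult_mat_sum[of _ D D _ D])
    (auto simp: complex_norm_square mult.commute simp del: of_real_power intro!: sum.cong)

lemma unitary_mat_row_sum:
  assumes "unitary_mat D C" "i < D"
  shows "(\<Sum>j<D. (cmod (C $$ (i, j)))\<^sup>2) = 1"
  using cmod_square_sum_row[OF unitary_mat_carrier[OF assms(1)] assms(2)]
    unitary_mat_mult_adj[OF assms(1)] assms(2) by (metis index_one_mat(1) of_real_eq_1_iff)

lemma unitary_mat_col_sum:
  assumes "unitary_mat D C" "i < D"
  shows "(\<Sum>j<D. (cmod (C $$ (j, i)))\<^sup>2) = 1"
  using cmod_square_sum_col[OF unitary_mat_carrier[OF assms(1)] assms(2)]
    unitary_mat_adj_mult[OF assms(1)] assms(2) by (metis index_one_mat(1) of_real_eq_1_iff)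

lemma sandwich_entry:
  assumes "X \<in> carrier_mat D D" "A \<in> carrier_mat D D" "Y \<in> carrier_mat D D" "i < D" "j < D"
  shows "(adj X * A * Y) $$ (i, j) = (\<Sum>b<D. \<Sum>a<D. cnj (X $$ (a, i)) * A $$ (a, b) * Y $$ (b, j))"
proof -
  have "(adj X * A * Y) $$ (i, j) = (\<Sum>b<D. (adj X * A) $$ (i, b) * Y $$ (b, j))"
    using assms by (subst index_mult_mat_sum[of _ D D _ D]) auto
  also have "\<dots> = (\<Sum>b<D. \<Sum>a<D. cnj (X $$ (a, i)) * A $$ (a, b) * Y $$ (b, j))"
  proof (rule sum.cong[OF refl])
    fix b assume "b \<in> {..<D}"
    then show "(adj X * A) $$ (i, b) * Y $$ (b, j) = (\<Sum>a<D. cnj (X $$ (a, i)) * A $$ (a, b) * Y $$ (b, j))"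
      using assms by (subst index_mult_mat_sum[of _ D D _ D]) (auto simp: sum_distrib_right)
  qed
  finally show ?thesis .
qed

lemma sandwich_entry_add:
  assumes "X \<in> carrier_mat D D" "A \<in> carrier_mat D D" "B \<in> carrier_mat D D" "Y \<in> carrier_mat D D" "i < D" "j < D"
  shows "(adj X * (A + B) * Y) $$ (i, j) = (adj X * A * Y) $$ (i, j) + (adj X * B * Y) $$ (i, j)"
  using assms by (simp add: sandwich_entry[of _ D] algebra_simps sum.distrib del: index_mult_mat(1))

lemma sandwich_entry_mat_sum:
  assumes "X \<in> carrier_mat D D" "\<And>k. k \<in> K \<Longrightarrow> A k \<in> carrier_mat D D" "Y \<in> carrier_mat D D" "i < D" "j < D"
  shows "(adj X * mat_sum D (\<lambda>k. of_real (c k) \<cdot>\<^sub>m A k) K * Y) $$ (i, j)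
     = (\<Sum>k\<in>K. complex_of_real (c k) * (adj X * A k * Y) $$ (i, j))"
proof -
  have sm: "(of_real (c k) \<cdot>\<^sub>m A k) $$ (a, b) = complex_of_real (c k) * A k $$ (a, b)"
    if "k \<in> K" "a < D" "b < D" for k a b using assms(2)[OF that(1)] that by auto
  have "(adj X * mat_sum D (\<lambda>k. of_real (c k) \<cdot>\<^sub>m A k) K * Y) $$ (i, j)
     = (\<Sum>b<D. \<Sum>a<D. \<Sum>k\<in>K. complex_of_real (c k) * (cnj (X $$ (a, i)) * A k $$ (a, b) * Y $$ (b, j)))"
    using assms by (subst sandwich_entry[of _ D])
      (auto simp: mat_sum_def sm sum_distrib_left sum_distrib_right mult_ac intro!: sum.cong)
  also have "\<dots> = (\<Sum>k\<in>K. \<Sum>b<D. \<Sum>a<D. complex_of_real (c k) * (cnj (X $$ (a, i)) * A k $$ (a, b) * Y $$ (b, j)))"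
    by (simp add: sum.swap[of _ _ K])
  also have "\<dots> = (\<Sum>k\<in>K. complex_of_real (c k) * (adj X * A k * Y) $$ (i, j))"
    using assms by (intro sum.cong refl) (simp add: sandwich_entry[of _ D] sum_distrib_left del: index_mult_mat(1))
  finally show ?thesis .
qed

lemma spectral_sandwich:
  assumes "spectral D A U l" "X \<in> carrier_mat D D" "Y \<in> carrier_mat D D"
  shows "adj X * A * Y = (adj X * U) * (real_diag D l * (adj U * Y))"
  using assms unfolding spectral_def unitary_mat_def
  by (simp add: assoc_mult_mat[of _ D D _ D _ D])

text \<open>The quadratic form at column j of \<open>Z\<close>, written in the eigenbasis. A unitary
  \<open>Z\<close> gives doubly stochastic weights; \<open>spectral_sum_inverse_le\<close> tests
  with a \<open>Z\<close> that involves an inverse.\<close>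

lemma spectral_sandwich_diag:
  assumes s: "spectral D A U l" and Z: "Z \<in> carrier_mat D D" and j: "j < D"
  shows "(adj Z * A * Z) $$ (j, j) = complex_of_real (\<Sum>k<D. (cmod ((adj U * Z) $$ (k, j)))\<^sup>2 * l k)"
proof -
  have U: "U \<in> carrier_mat D D" using s by (simp add: spectral_def unitary_mat_def)
  have "adj Z * U = adj (adj U * Z)" using U Z by (simp add: adj_mult[of _ D D _ D])
  then have "(adj Z * A * Z) $$ (j, j)
      = (\<Sum>k<D. cnj ((adj U * Z) $$ (k, j)) * (complex_of_real (l k) * (adj U * Z) $$ (k, j)))"
    unfolding spectral_sandwich[OF s Z Z] using U Z j
    by (subst index_mult_mat_sum[of _ D D _ D])
      (auto simp: index_real_diag_mult[of _ D D] simp del: index_mult_mat(1) intro!: sum.cong)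
  then show ?thesis by (simp add: complex_norm_square mult_ac del: of_real_power)
qed

lemma spectral_sandwich_left:
  assumes s: "spectral D A U l" and Z: "Z \<in> carrier_mat D D" and ij: "i < D" "j < D"
  shows "(adj U * A * Z) $$ (i, j) = complex_of_real (l i) * (adj U * Z) $$ (i, j)"
proof -
  have U: "U \<in> carrier_mat D D" "adj U * U = 1\<^sub>m D" using s by (auto simp: spectral_def unitary_mat_def)
  have "adj U * A * Z = real_diag D l * (adj U * Z)"
    unfolding spectral_sandwich[OF s U(1) Z] U(2) using U Z by simp
  then show ?thesis using U Z ij by (simp add: index_real_diag_mult[of _ D D] del: index_mult_mat(1))
qed

lemma spectral_sandwich_right:
  assumes s: "spectral D A V m" and Z: "Z \<in> carrier_mat D D" and ij: "i < D" "j < D"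
  shows "(adj Z * A * V) $$ (i, j) = complex_of_real (m j) * (adj Z * V) $$ (i, j)"
proof -
  have V: "V \<in> carrier_mat D D" "adj V * V = 1\<^sub>m D" using s by (auto simp: spectral_def unitary_mat_def)
  have "adj Z * A * V = (adj Z * V) * real_diag D m"
    unfolding spectral_sandwich[OF s Z V(1)] V(2) using V Z by simp
  then show ?thesis using V Z ij by (simp add: index_mult_real_diag[of _ D D] del: index_mult_mat(1))
qed

lemma spectral_square:
  assumes s: "spectral D A U l"
  shows "spectral D (A * A) U (\<lambda>i. (l i)\<^sup>2)"
proof (rule spectralI)
  show "unitary_mat D U" using s by (simp add: spectral_def)
  then have U: "U \<in> carrier_mat D D" "adj U * U = 1\<^sub>m D" by (auto simp: unitary_mat_def)
  have A: "A \<in> carrier_mat D D" using spectral_carrier[OF s] .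
  then show "A * A \<in> carrier_mat D D" by simp
  have AU: "A * U = U * real_diag D l" using s U unfolding spectral_def
    by (simp add: assoc_mult_mat[of _ D D _ D _ D])
  have "A * A * U = A * (U * real_diag D l)" using A U AU by (simp add: assoc_mult_mat[of _ D D _ D _ D])
  also have "\<dots> = (A * U) * real_diag D l" using A U by (simp add: assoc_mult_mat[of _ D D _ D _ D])
  also have "\<dots> = U * (real_diag D l * real_diag D l)" using U AU by (simp add: assoc_mult_mat[of _ D D _ D _ D])
  also have "real_diag D l * real_diag D l = real_diag D (\<lambda>i. (l i)\<^sup>2)"
    by (rule eq_matI)
      (auto simp: index_mult_real_diag[of _ D] power2_eq_square simp del: index_mult_mat(1))
  finally show "A * A * U = U * real_diag D (\<lambda>i. (l i)\<^sup>2)" .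
qed

text \<open>The bridge from the definition by roots of a characteristic polynomial:
  \<open>adj A * A\<close> is similar to the diagonal matrix of the squares of \<open>l\<close>, and
  their square roots are the absolute values.\<close>

lemma schatten_power_spectral:
  assumes "spectral D A U l"
  shows "schatten_power p A = (\<Sum>i<D. \<bar>l i\<bar> powr p)"
proof -
  have U: "unitary_mat D U" and Uc: "U \<in> carrier_mat D D"
    using assms by (auto simp: spectral_def unitary_mat_def)
  have Ac: "A \<in> carrier_mat D D" and hA: "adj A = A"
    using spectral_hermitian[OF assms] by (auto simp: hermitian_def)
  let ?L = "real_diag D (\<lambda>i. (l i)\<^sup>2)"
  have "adj A * A = U * ?L * adj U"
    using spectral_square[OF assms] unfolding hA by (simp add: spectral_def)
  then have "similar_mat_wit (adj A * A) ?L U (adj U)"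
    using Uc Ac unitary_mat_adj_mult[OF U] unitary_mat_mult_adj[OF U]
    by (intro similar_mat_witI[of _ _ D]) auto
  then have "char_poly (adj A * A) = char_poly ?L"
    by (intro char_poly_similar) (auto simp: similar_mat_def)
  also have "\<dots> = (\<Prod>a\<leftarrow>diag_mat ?L. [:- a, 1:])"
    by (rule char_poly_upper_triangular[of _ D]) (auto simp: upper_triangular_def)
  also have "diag_mat ?L = map (\<lambda>i. complex_of_real ((l i)\<^sup>2)) [0..<D]"
    by (auto simp: diag_mat_def real_diag_def)
  finally have cp: "char_poly (adj A * A) = (\<Prod>i\<leftarrow>[0..<D]. [:- complex_of_real ((l i)\<^sup>2), 1:])"
    by (simp add: o_def del: of_real_power)
  have "proots (\<Prod>i\<leftarrow>xs. [:- complex_of_real ((l i)\<^sup>2), 1:]) = mset (map (\<lambda>i. complex_of_real ((l i)\<^sup>2)) xs)" for xs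
  proof (induction xs)
    case (Cons x xs)
    have "(\<Prod>i\<leftarrow>xs. [:- complex_of_real ((l i)\<^sup>2), 1:]) \<noteq> 0"
      by (auto simp: prod_list_zero_iff)
    then show ?case using Cons by (simp add: proots_mult del: of_real_power mult_pCons_left)
  qed simp
  then have "singular_values A = image_mset (\<lambda>i. \<bar>l i\<bar>) (mset [0..<D])"
    unfolding singular_values_def cp by (simp add: multiset.map_comp o_def del: mset_upt of_real_power)
  then show ?thesis
    unfolding schatten_power_def
    by (simp add: multiset.map_comp o_def sum_unfold_sum_mset atLeast0LessThan)
qed

lemma hermitian_mat_sum:
  assumes "\<And>k. k \<in> K \<Longrightarrow> hermitian D (A k)"
  shows "hermitian D (mat_sum D A K)"
  unfolding hermitian_def
proof
  show "adj (mat_sum D A K) = mat_sum D A K"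
  proof (rule square_mat_eqI[of _ D])
    fix i j assume ij: "i < D" "j < D"
    have "cnj (A k $$ (j, i)) = A k $$ (i, j)" if "k \<in> K" for k
      using assms[OF that] ij unfolding hermitian_def by (metis index_adj carrier_matD)
    then show "adj (mat_sum D A K) $$ (i, j) = mat_sum D A K $$ (i, j)"
      using ij by (simp add: mat_sum_def adj_def)
  qed (auto simp: mat_sum_def)
qed (simp add: mat_sum_def)

lemma hermitian_smult:
  assumes "hermitian D A" shows "hermitian D (of_real c \<cdot>\<^sub>m A)"
proof -
  have A: "A \<in> carrier_mat D D" "adj A = A" using assms by (auto simp: hermitian_def)
  have "adj (of_real c \<cdot>\<^sub>m A) = of_real c \<cdot>\<^sub>m adj A" using A(1) by (intro eq_matI) auto
  then show ?thesis using A by (simp add: hermitian_def)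
qed

lemma hermitian_add:
  assumes "hermitian D A" "hermitian D B" shows "hermitian D (A + B)"
proof -
  have A: "A \<in> carrier_mat D D" "adj A = A" "B \<in> carrier_mat D D" "adj B = B" using assms by (auto simp: hermitian_def)
  have "adj (A + B) = adj A + adj B" using A(1,3) by (intro eq_matI) auto
  then show ?thesis using A by (simp add: hermitian_def)
qed

lemma hermitian_minus:
  assumes "hermitian D A" "hermitian D B" shows "hermitian D (A - B)"
proof -
  have A: "A \<in> carrier_mat D D" "adj A = A" "B \<in> carrier_mat D D" "adj B = B" using assms by (auto simp: hermitian_def)
  have "adj (A - B) = adj A - adj B" using A(1,3) by (intro eq_matI) auto
  then show ?thesis using A by (simp add: hermitian_def minus_carrier_mat)
qed

text \<open>Peierls' inequality: the diagonal in any orthonormal basis is a doubly stochastic average of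
  the eigenvalues.\<close>

lemma diagonal_powr_le_schatten_power:
  assumes A: "hermitian D A" and E: "unitary_mat D E" and p: "p \<ge> 1"
  shows "(\<Sum>i<D. \<bar>Re ((adj E * A * E) $$ (i, i))\<bar> powr p) \<le> schatten_power p A"
proof -
  obtain U l where s: "spectral D A U l" using hermitian_spectral[OF A] by blast
  have UE: "unitary_mat D (adj U * E)"
    using s E by (intro unitary_mat_mult unitary_mat_adj) (auto simp: spectral_def)
  have "(\<Sum>i<D. \<bar>\<Sum>k<D. (cmod ((adj U * E) $$ (k, i)))\<^sup>2 * l k\<bar> powr p) \<le> (\<Sum>k<D. \<bar>l k\<bar> powr p)"
    using unitary_mat_row_sum[OF UE] unitary_mat_col_sum[OF UE] p
    by (intro doubly_stochastic_powr_le) auto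
  then show ?thesis
    unfolding schatten_power_spectral[OF s]
    using spectral_sandwich_diag[OF s unitary_mat_carrier[OF E]] by (simp del: index_mult_mat(1))
qed

lemma spectral_eigenvalue_entry:
  assumes s: "spectral D A E m" and i: "i < D"
  shows "(adj E * A * E) $$ (i, i) = complex_of_real (m i)"
  using spectral_sandwich_left[OF s, of E i i] unitary_mat_carrier[of D E] unitary_mat_adj_mult[of D E] s i
  by (simp add: spectral_def del: index_mult_mat(1))

text \<open>In an eigenbasis of the combination each eigenvalue is the same combination of diagonal
  entries of the \<open>A k\<close>. Scalar convexity applies to each of them, and Peierls'
  inequality bounds the diagonals of the single \<open>A k\<close>.\<close>

lemma schatten_power_convex:
  assumes A: "\<And>k. k \<in> K \<Longrightarrow> hermitian D (A k)" and p: "p \<ge> 1"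
    and c: "\<And>k. k \<in> K \<Longrightarrow> c k \<ge> 0" "(\<Sum>k\<in>K. c k) = 1"
  shows "schatten_power p (mat_sum D (\<lambda>k. of_real (c k) \<cdot>\<^sub>m A k) K)
     \<le> (\<Sum>k\<in>K. c k * schatten_power p (A k))"
proof -
  let ?S = "mat_sum D (\<lambda>k. of_real (c k) \<cdot>\<^sub>m A k) K"
  have "hermitian D ?S" using A by (intro hermitian_mat_sum hermitian_smult)
  then obtain E m where s: "spectral D ?S E m" using hermitian_spectral by blast
  have E: "unitary_mat D E" using s by (simp add: spectral_def)
  define a where "a k i = Re ((adj E * A k * E) $$ (i, i))" for k i
  have m: "m i = (\<Sum>k\<in>K. c k * a k i)" if "i < D" for i
  proof -
    have "complex_of_real (m i) = (\<Sum>k\<in>K. complex_of_real (c k) * (adj E * A k * E) $$ (i, i))"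
      unfolding spectral_eigenvalue_entry[OF s that, symmetric]
      using A that unitary_mat_carrier[OF E] by (intro sandwich_entry_mat_sum) (auto simp: hermitian_def)
    then have "Re (complex_of_real (m i)) = (\<Sum>k\<in>K. c k * a k i)" unfolding a_def by simp
    then show ?thesis by simp
  qed
  have "(\<Sum>i<D. \<bar>m i\<bar> powr p) \<le> (\<Sum>i<D. \<Sum>k\<in>K. c k * \<bar>a k i\<bar> powr p)"
  proof (rule sum_mono)
    fix i assume "i \<in> {..<D}"
    define x where "x = m i"
    have x: "x = (\<Sum>k\<in>K. c k * a k i)" using \<open>i \<in> {..<D}\<close> m by (simp add: x_def)
    define t where "t = p * (sgn x * \<bar>x\<bar> powr (p - 1))"
    have "(\<Sum>k\<in>K. c k * (\<bar>x\<bar> powr p + t * (a k i - x))) \<le> (\<Sum>k\<in>K. c k * \<bar>a k i\<bar> powr p)"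
      unfolding t_def using c by (intro sum_mono mult_left_mono abs_powr_tangent[OF p]) auto
    moreover have "(\<Sum>k\<in>K. c k * (\<bar>x\<bar> powr p + t * (a k i - x)))
        = (\<bar>x\<bar> powr p - t * x) * (\<Sum>k\<in>K. c k) + t * (\<Sum>k\<in>K. c k * a k i)"
      by (simp add: sum_distrib_left sum_distrib_right algebra_simps sum.distrib sum_subtractf)
    moreover have "\<dots> = \<bar>x\<bar> powr p" unfolding c(2) x[symmetric] by simp
    ultimately show "\<bar>m i\<bar> powr p \<le> (\<Sum>k\<in>K. c k * \<bar>a k i\<bar> powr p)" unfolding x_def by simp
  qed
  also have "\<dots> = (\<Sum>k\<in>K. c k * (\<Sum>i<D. \<bar>a k i\<bar> powr p))"
    by (subst sum.swap) (simp add: sum_distrib_left)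
  also have "\<dots> \<le> (\<Sum>k\<in>K. c k * schatten_power p (A k))"
    unfolding a_def using c A by (intro sum_mono mult_left_mono diagonal_powr_le_schatten_power[OF _ E p]) auto
  finally show ?thesis unfolding schatten_power_spectral[OF s] .
qed

lemma schatten_power_smult:
  assumes "hermitian D A"
  shows "schatten_power p (of_real c \<cdot>\<^sub>m A) = \<bar>c\<bar> powr p * schatten_power p A"
proof -
  obtain U l where s: "spectral D A U l" using hermitian_spectral[OF assms] by blast
  have U: "U \<in> carrier_mat D D" "adj U * U = 1\<^sub>m D" and A: "A = U * real_diag D l * adj U"
    using s by (auto simp: spectral_def unitary_mat_def)
  have "of_real c \<cdot>\<^sub>m A = U * (of_real c \<cdot>\<^sub>m real_diag D l) * adj U"
    unfolding A using U by (simp add: mult_smult_distrib[of _ D D _ D] mult_smult_assoc_mat[of _ D D _ D])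
  also have "of_real c \<cdot>\<^sub>m real_diag D l = real_diag D (\<lambda>i. c * l i)"
    by (rule eq_matI) auto
  finally have "spectral D (of_real c \<cdot>\<^sub>m A) U (\<lambda>i. c * l i)"
    using s by (simp add: spectral_def)
  then show ?thesis
    unfolding schatten_power_spectral[OF s] by (simp add: schatten_power_spectral abs_mult powr_mult sum_distrib_left)
qed

section \<open>Smoothness of the Schatten norms\<close>

lemma spectral_sum_eigenvalue:
  assumes P: "spectral D P U a" and Q: "spectral D Q V b" and W: "spectral D (P + Q) E w" and i: "i < D"
  shows "w i = (\<Sum>k<D. (cmod ((adj U * E) $$ (k, i)))\<^sup>2 * a k) + (\<Sum>k<D. (cmod ((adj V * E) $$ (k, i)))\<^sup>2 * b k)"
proof -
  have c: "P \<in> carrier_mat D D" "Q \<in> carrier_mat D D" "E \<in> carrier_mat D D"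
    using P Q W spectral_carrier by (auto simp: spectral_def unitary_mat_def)
  have "complex_of_real (w i) = (adj E * P * E) $$ (i, i) + (adj E * Q * E) $$ (i, i)"
    unfolding spectral_eigenvalue_entry[OF W i, symmetric] using c i by (intro sandwich_entry_add)
  then show ?thesis
    unfolding spectral_sandwich_diag[OF P c(3) i] spectral_sandwich_diag[OF Q c(3) i] of_real_add[symmetric]
    by (simp only: of_real_eq_iff)
qed

text \<open>If \<open>P u = a u\<close> for a unit vector \<open>u\<close>, then \<open>a * \<langle>u, (P + Q)\<^sup>-\<^sup>1 u\<rangle> \<le> 1\<close>: test \<open>P \<le> P + Q\<close> against
  \<open>(P + Q)\<^sup>-\<^sup>1 u\<close>. Division by zero discards the kernel of \<open>P + Q\<close>.\<close>

lemma spectral_sum_inverse_le: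
  assumes P: "spectral D P U a" and Q: "spectral D Q V b" and W: "spectral D (P + Q) E w"
    and nn: "\<And>k. k < D \<Longrightarrow> a k \<ge> 0" "\<And>k. k < D \<Longrightarrow> b k \<ge> 0" and j: "j < D"
  shows "a j * (\<Sum>i<D. (cmod ((adj U * E) $$ (j, i)))\<^sup>2 / w i) \<le> 1"
proof -
  have c: "P \<in> carrier_mat D D" "Q \<in> carrier_mat D D" "E \<in> carrier_mat D D" "U \<in> carrier_mat D D" "V \<in> carrier_mat D D"
    using P Q W spectral_carrier by (auto simp: spectral_def unitary_mat_def)
  have EE: "adj E * E = 1\<^sub>m D" using W by (simp add: spectral_def unitary_mat_def)
  define C where "C = adj E * U"
  have C: "C \<in> carrier_mat D D" using c by (simp add: C_def)
  have CU: "adj U * E = adj C" unfolding C_def using c by (simp add: adj_mult[of _ D D _ D])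
  define s where "s = (\<Sum>i<D. (cmod (C $$ (i, j)))\<^sup>2 / w i)"
  have s: "(\<Sum>i<D. (cmod ((adj U * E) $$ (j, i)))\<^sup>2 / w i) = s"
    unfolding s_def CU using C j by simp
  \<comment> \<open>Column j of \<open>Z\<close> is the pseudo-inverse of \<open>P + Q\<close>
    applied to eigenvector j of \<open>P\<close>.\<close>
  define Z where "Z = E * (real_diag D (\<lambda>i. 1 / w i) * C)"
  have Z: "Z \<in> carrier_mat D D" using c C by (simp add: Z_def)
  have EZ: "adj E * Z = real_diag D (\<lambda>i. 1 / w i) * C"
    unfolding Z_def using c C EE by (simp flip: assoc_mult_mat[of _ D D _ D _ D])
  have EZ_entry: "(adj E * Z) $$ (k, j) = C $$ (k, j) / complex_of_real (w k)" if "k < D" for k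
    unfolding EZ using that j C by (simp add: index_real_diag_mult[of _ D D] del: index_mult_mat(1))
  have wnn: "w i \<ge> 0" if "i < D" for i
    unfolding spectral_sum_eigenvalue[OF P Q W that] using nn by (intro add_nonneg_nonneg sum_nonneg) auto
  have UZ: "(adj U * Z) $$ (j, j) = complex_of_real s"
  proof -
    have "adj U * Z = adj C * (real_diag D (\<lambda>i. 1 / w i) * C)"
      unfolding Z_def CU[symmetric] using c C by (simp add: assoc_mult_mat[of _ D D _ D _ D])
    then have "(adj U * Z) $$ (j, j) = (\<Sum>k<D. cnj (C $$ (k, j)) * (complex_of_real (1 / w k) * C $$ (k, j)))"
      using C j by (simp add: index_mult_mat_sum[of "adj C" D D _ D] index_real_diag_mult[of _ D D] del: index_mult_mat(1))
    also have "\<dots> = complex_of_real s"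
      unfolding s_def by (simp add: complex_norm_square mult_ac del: of_real_power)
    finally show ?thesis .
  qed
  have "(adj Z * (P + Q) * Z) $$ (j, j) = (adj Z * P * Z) $$ (j, j) + (adj Z * Q * Z) $$ (j, j)"
    using c Z j by (intro sandwich_entry_add)
  then have eq: "(\<Sum>k<D. (cmod ((adj E * Z) $$ (k, j)))\<^sup>2 * w k)
     = (\<Sum>k<D. (cmod ((adj U * Z) $$ (k, j)))\<^sup>2 * a k) + (\<Sum>k<D. (cmod ((adj V * Z) $$ (k, j)))\<^sup>2 * b k)"
    unfolding spectral_sandwich_diag[OF P Z j] spectral_sandwich_diag[OF Q Z j] spectral_sandwich_diag[OF W Z j]
      of_real_add[symmetric] by (simp only: of_real_eq_iff)
  have "(\<Sum>k<D. (cmod ((adj E * Z) $$ (k, j)))\<^sup>2 * w k) = s"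
    unfolding s_def
  proof (rule sum.cong[OF refl])
    fix k assume "k \<in> {..<D}"
    then have k: "k < D" by simp
    show "(cmod ((adj E * Z) $$ (k, j)))\<^sup>2 * w k = (cmod (C $$ (k, j)))\<^sup>2 / w k"
      unfolding EZ_entry[OF k] by (simp add: norm_divide power2_eq_square)
  qed
  \<comment> \<open>Of the two nonnegative forms on the right only the term of \<open>P\<close> at
    its own eigenvector j is kept. Its overlap is \<open>s\<close>, while the form of
    \<open>P + Q\<close> also equals \<open>s\<close>.\<close>
  moreover have "(cmod ((adj U * Z) $$ (j, j)))\<^sup>2 * a j \<le> (\<Sum>k<D. (cmod ((adj U * Z) $$ (k, j)))\<^sup>2 * a k)"
    using j nn by (intro member_le_sum) auto
  moreover have "0 \<le> (\<Sum>k<D. (cmod ((adj V * Z) $$ (k, j)))\<^sup>2 * b k)"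
    using nn by (intro sum_nonneg) auto
  ultimately have "s\<^sup>2 * a j \<le> s" unfolding UZ using eq by simp
  moreover have "s \<ge> 0" unfolding s_def using wnn by (intro sum_nonneg) auto
  ultimately have "a j * s \<le> 1"
    by (cases "s = 0") (auto simp: power2_eq_square mult_ac)
  then show ?thesis unfolding s .
qed

text \<open>In trace form, tr (P + Q)^(q-1) P \<le> tr P^q. For one eigenvector of \<open>P\<close>
  the weights \<open>c k i\<close> are a probability distribution in i, so bounding the concave
  power 1 - q of 1 / w by its tangent at 1 / a reduces the claim to
  \<open>spectral_sum_inverse_le\<close>.\<close>

lemma spectral_sum_weighted_powr_le:
  assumes P: "spectral D P U a" and Q: "spectral D Q V b" and W: "spectral D (P + Q) E w"
    and nn: "\<And>k. k < D \<Longrightarrow> a k \<ge> 0" "\<And>k. k < D \<Longrightarrow> b k \<ge> 0" and q: "0 < q" "q < 1"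
  shows "(\<Sum>i<D. w i powr (q - 1) * (\<Sum>k<D. (cmod ((adj U * E) $$ (k, i)))\<^sup>2 * a k)) \<le> (\<Sum>k<D. a k powr q)"
proof -
  define c where "c k i = (cmod ((adj U * E) $$ (k, i)))\<^sup>2" for k i
  have c0: "c k i \<ge> 0" for k i by (simp add: c_def)
  have UE: "unitary_mat D (adj U * E)"
    using P W by (intro unitary_mat_mult unitary_mat_adj) (auto simp: spectral_def)
  have c1: "(\<Sum>i<D. c k i) = 1" if "k < D" for k
    using unitary_mat_row_sum[OF UE that] by (simp add: c_def)
  have wnn: "w i \<ge> 0" if "i < D" for i
    unfolding spectral_sum_eigenvalue[OF P Q W that] using nn by (intro add_nonneg_nonneg sum_nonneg) auto
  have "(\<Sum>i<D. w i powr (q - 1) * (\<Sum>k<D. c k i * a k)) = (\<Sum>k<D. a k * (\<Sum>i<D. c k i * w i powr (q - 1)))"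
    unfolding sum_distrib_left by (subst sum.swap) (simp add: mult_ac)
  also have "\<dots> \<le> (\<Sum>k<D. a k powr q)"
  proof (rule sum_mono)
    fix k assume "k \<in> {..<D}"
    then have k: "k < D" by simp
    show "a k * (\<Sum>i<D. c k i * w i powr (q - 1)) \<le> a k powr q"
    proof (cases "a k = 0")
      case False
      then have ak: "a k > 0" using nn(1)[OF k] by simp
      define x where "x = 1 / a k"
      have x: "x > 0" using ak by (simp add: x_def)
      define t where "t = (1 - q) * x powr (1 - q - 1)"
      have t: "t \<ge> 0" using q by (simp add: t_def)
      have "(\<Sum>i<D. c k i * w i powr (q - 1)) \<le> (\<Sum>i<D. c k i * (x powr (1 - q) + t * (1 / w i - x)))"
      proof (rule sum_mono)
        fix i assume "i \<in> {..<D}"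
        then have wi: "w i \<ge> 0" using wnn by simp
        \<comment> \<open>Both sides are 0 when \<open>w i\<close> is 0, by the conventions for
          division and \<open>powr\<close>.\<close>
        have "w i powr (q - 1) = (1 / w i) powr (1 - q)"
          using wi q by (cases "w i = 0") (simp_all add: powr_divide powr_diff)
        also have "\<dots> \<le> x powr (1 - q) + t * (1 / w i - x)"
          unfolding t_def using q x wi by (intro powr_tangent_concave) auto
        finally show "c k i * w i powr (q - 1) \<le> c k i * (x powr (1 - q) + t * (1 / w i - x))"
          using c0 by (intro mult_left_mono)
      qed
      also have "\<dots> = (x powr (1 - q) - t * x) * (\<Sum>i<D. c k i) + t * (\<Sum>i<D. c k i / w i)"
        by (simp add: sum_distrib_left sum_distrib_right algebra_simps sum.distrib sum_subtractf)
      also have "\<dots> = x powr (1 - q) + t * ((\<Sum>i<D. c k i / w i) - x)"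
        unfolding c1[OF k] by (simp add: algebra_simps)
      also have "\<dots> \<le> x powr (1 - q)"
      proof -
        have "(\<Sum>i<D. c k i / w i) \<le> x"
          using spectral_sum_inverse_le[OF P Q W nn k] ak unfolding x_def c_def by (simp add: field_simps)
        then have "t * ((\<Sum>i<D. c k i / w i) - x) \<le> 0" using t by (simp add: mult_nonneg_nonpos)
        then show ?thesis by simp
      qed
      finally have "a k * (\<Sum>i<D. c k i * w i powr (q - 1)) \<le> a k * x powr (1 - q)"
        using ak by simp
      also have "\<dots> = a k powr q" using ak unfolding x_def by (simp add: powr_divide powr_diff)
      finally show ?thesis .
    qed simp
  qed
  finally show ?thesis unfolding c_def .
qed

text \<open>Rotfel'd's inequality.\<close>

lemma spectral_sum_powr_subadditive:
  assumes P: "spectral D P U a" and Q: "spectral D Q V b" and W: "spectral D (P + Q) E w"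
    and nn: "\<And>k. k < D \<Longrightarrow> a k \<ge> 0" "\<And>k. k < D \<Longrightarrow> b k \<ge> 0" and q: "0 < q" "q < 1"
  shows "(\<Sum>i<D. w i powr q) \<le> (\<Sum>k<D. a k powr q) + (\<Sum>k<D. b k powr q)"
proof -
  have wnn: "w i \<ge> 0" if "i < D" for i
    unfolding spectral_sum_eigenvalue[OF P Q W that] using nn by (intro add_nonneg_nonneg sum_nonneg) auto
  have "P + Q = Q + P" using spectral_carrier[OF P] spectral_carrier[OF Q] by (rule comm_add_mat)
  then have W': "spectral D (Q + P) E w" using W by simp
  have "(\<Sum>i<D. w i powr q) = (\<Sum>i<D. w i powr (q - 1) * w i)"
  proof (rule sum.cong[OF refl])
    fix i assume "i \<in> {..<D}"
    then show "w i powr q = w i powr (q - 1) * w i"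
      using wnn[of i] by (cases "w i = 0") (auto simp: powr_diff)
  qed
  \<comment> \<open>One factor \<open>w i\<close> is split into its contributions from
    \<open>P\<close> and \<open>Q\<close>, while the power q - 1 stays with the sum; each half is
    then bounded separately.\<close>
  also have "\<dots> = (\<Sum>i<D. w i powr (q - 1) * (\<Sum>k<D. (cmod ((adj U * E) $$ (k, i)))\<^sup>2 * a k))
       + (\<Sum>i<D. w i powr (q - 1) * (\<Sum>k<D. (cmod ((adj V * E) $$ (k, i)))\<^sup>2 * b k))"
    unfolding sum.distrib[symmetric] distrib_left[symmetric]
    using spectral_sum_eigenvalue[OF P Q W] by (intro sum.cong) auto
  also have "\<dots> \<le> (\<Sum>k<D. a k powr q) + (\<Sum>k<D. b k powr q)"
    using spectral_sum_weighted_powr_le[OF P Q W nn q] spectral_sum_weighted_powr_le[OF Q P W' nn(2,1) q]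
    by (rule add_mono)
  finally show ?thesis .
qed

lemma schatten_power_square_spectral:
  assumes "spectral D A U l"
  shows "schatten_power p A = (\<Sum>k<D. (l k)\<^sup>2 powr (p / 2))"
proof -
  have "\<bar>x\<bar> powr p = x\<^sup>2 powr (p / 2)" for x :: real
  proof -
    have "x\<^sup>2 powr (p / 2) = (\<bar>x\<bar> powr 2) powr (p / 2)" by (cases "x = 0") auto
    then show ?thesis unfolding powr_powr by simp
  qed
  then show ?thesis unfolding schatten_power_spectral[OF assms] by simp
qed

text \<open>The opposite direction to Peierls' inequality, since p / 2 \<le> 1 makes the power
  concave. The inner sum is the squared norm of \<open>A\<close> times column i of
  \<open>E\<close>.\<close>

lemma schatten_power_le_column_norms:
  assumes A: "spectral D A U l" and E: "unitary_mat D E" and p: "0 < p" "p \<le> 2"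
  shows "schatten_power p A \<le> (\<Sum>i<D. (\<Sum>k<D. (cmod ((adj U * E) $$ (k, i)))\<^sup>2 * (l k)\<^sup>2) powr (p / 2))"
proof -
  have UE: "unitary_mat D (adj U * E)"
    using A E by (intro unitary_mat_mult unitary_mat_adj) (auto simp: spectral_def)
  show ?thesis unfolding schatten_power_square_spectral[OF A]
    using unitary_mat_row_sum[OF UE] unitary_mat_col_sum[OF UE] p
    by (intro doubly_stochastic_powr_ge) auto
qed

lemma powr_midpoint_concave:
  fixes x y q :: real
  assumes "0 < q" "q \<le> 1" "x \<ge> 0" "y \<ge> 0"
  shows "x powr q + y powr q \<le> 2 * ((x + y) / 2) powr q"
proof (cases "x + y = 0")
  case False
  then have m: "(x + y) / 2 > 0" using assms by auto
  have "q * ((x + y) / 2) powr (q - 1) * (x - (x + y) / 2) + q * ((x + y) / 2) powr (q - 1) * (y - (x + y) / 2) = 0"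
    unfolding distrib_left[symmetric] by (simp add: field_simps)
  then show ?thesis
    using powr_tangent_concave[OF assms(1,2) m, of x] powr_tangent_concave[OF assms(1,2) m, of y] assms
    by linarith
next
  case True
  then have "x = 0" "y = 0" using assms by auto
  then show ?thesis by simp
qed

text \<open>McCarthy's half of Clarkson's inequality. The parallelogram law
  \<open>(A + B)\<^sup>2 + (A - B)\<^sup>2 = 2 (A\<^sup>2 + B\<^sup>2)\<close> is read in an eigenbasis of \<open>A\<^sup>2 + B\<^sup>2\<close>.\<close>

theorem schatten_power_parallelogram:
  assumes A: "hermitian D A" and B: "hermitian D B" and p: "0 < p" "p < 2"
  shows "schatten_power p (A + B) + schatten_power p (A - B) \<le> 2 * schatten_power p A + 2 * schatten_power p B"
proof -
  have c: "A \<in> carrier_mat D D" "B \<in> carrier_mat D D" using A B by (auto simp: hermitian_def)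
  obtain U a where sA: "spectral D A U a" using hermitian_spectral[OF A] by blast
  obtain V b where sB: "spectral D B V b" using hermitian_spectral[OF B] by blast
  obtain S x where sS: "spectral D (A + B) S x" using hermitian_spectral[OF hermitian_add[OF A B]] by blast
  obtain T y where sT: "spectral D (A - B) T y" using hermitian_spectral[OF hermitian_minus[OF A B]] by blast
  note sA2 = spectral_square[OF sA] and sB2 = spectral_square[OF sB]
    and sS2 = spectral_square[OF sS] and sT2 = spectral_square[OF sT]
  obtain E w where sW: "spectral D (A * A + B * B) E w"
    using hermitian_spectral[OF hermitian_add[OF spectral_hermitian[OF sA2] spectral_hermitian[OF sB2]]] by blast
  have E: "unitary_mat D E" using sW by (simp add: spectral_def)
  have Ec: "E \<in> carrier_mat D D" using unitary_mat_carrier[OF E] .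
  define X where "X i = (\<Sum>k<D. (cmod ((adj S * E) $$ (k, i)))\<^sup>2 * (x k)\<^sup>2)" for i
  define Y where "Y i = (\<Sum>k<D. (cmod ((adj T * E) $$ (k, i)))\<^sup>2 * (y k)\<^sup>2)" for i
  \<comment> \<open>Diagonal entries in the basis \<open>E\<close>: by the parallelogram law those
    of the squares of A + B and A - B have mean \<open>w i\<close>.\<close>
  have XY: "(X i + Y i) / 2 = w i" if i: "i < D" for i
  proof -
    have m: "(A + B) * (A + B) + (A - B) * (A - B) = (A * A + B * B) + (A * A + B * B)"
    proof (rule square_mat_eqI[of _ D])
      fix r s assume rs: "r < D" "s < D"
      show "((A + B) * (A + B) + (A - B) * (A - B)) $$ (r, s) = (A * A + B * B + (A * A + B * B)) $$ (r, s)"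
        using c rs by (simp add: index_mult_mat_sum[of _ D D _ D] algebra_simps sum.distrib sum_subtractf del: index_mult_mat(1))
    qed (use c in auto)
    have "(adj E * ((A + B) * (A + B) + (A - B) * (A - B)) * E) $$ (i, i) = complex_of_real (X i + Y i)"
      using c Ec i unfolding X_def Y_def
      by (simp add: sandwich_entry_add[of _ D] spectral_sandwich_diag[OF sS2 Ec i] spectral_sandwich_diag[OF sT2 Ec i]
          del: index_mult_mat(1))
    moreover have "(adj E * ((A * A + B * B) + (A * A + B * B)) * E) $$ (i, i) = complex_of_real (2 * w i)"
      using c Ec i
      by (simp add: sandwich_entry_add[of _ D "A * A + B * B"] spectral_eigenvalue_entry[OF sW i] del: index_mult_mat(1))
    ultimately have "complex_of_real (X i + Y i) = complex_of_real (2 * w i)" unfolding m by simp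
    then have "X i + Y i = 2 * w i" by (simp only: of_real_eq_iff)
    then show ?thesis by simp
  qed
  have "schatten_power p (A + B) + schatten_power p (A - B) \<le> (\<Sum>i<D. X i powr (p / 2)) + (\<Sum>i<D. Y i powr (p / 2))"
    unfolding X_def Y_def
    using schatten_power_le_column_norms[OF sS E, of p] schatten_power_le_column_norms[OF sT E, of p] p by simp
  also have "\<dots> = (\<Sum>i<D. X i powr (p / 2) + Y i powr (p / 2))" by (simp add: sum.distrib)
  also have "\<dots> \<le> (\<Sum>i<D. 2 * ((X i + Y i) / 2) powr (p / 2))"
    using p unfolding X_def Y_def by (intro sum_mono powr_midpoint_concave) (auto intro!: sum_nonneg)
  also have "\<dots> = 2 * (\<Sum>i<D. w i powr (p / 2))" using XY by (simp add: sum_distrib_left)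
  \<comment> \<open>\<open>w\<close> lists the eigenvalues of a sum of two matrices with nonnegative
    eigenvalues \<open>(a k)\<^sup>2\<close> and \<open>(b k)\<^sup>2\<close>, and p / 2 < 1, so
    Rotfel'd's inequality applies.\<close>
  also have "\<dots> \<le> 2 * ((\<Sum>k<D. (a k)\<^sup>2 powr (p / 2)) + (\<Sum>k<D. (b k)\<^sup>2 powr (p / 2)))"
    using p by (intro mult_left_mono spectral_sum_powr_subadditive[OF sA2 sB2 sW]) auto
  finally show ?thesis
    unfolding schatten_power_square_spectral[OF sA] schatten_power_square_spectral[OF sB] by simp
qed

section \<open>The second-order upper bound, the case p \<ge> 2\<close>

lemma Holder_schatten_power:
  assumes l: "spectral D S U l" and B: "hermitian D B" and E: "unitary_mat D E" and p: "p \<ge> 2"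
  shows "(\<Sum>i<D. \<bar>l i\<bar> powr (p - 2) * Re ((adj E * (B * B) * E) $$ (i, i)))
     \<le> schatten_power p S powr ((p - 2) / p) * schatten_power p B powr (2 / p)"
proof -
  obtain T b where sB: "spectral D B T b" using hermitian_spectral[OF B] by blast
  define e where "e i = Re ((adj E * (B * B) * E) $$ (i, i))" for i
  have e: "e i \<ge> 0" if "i < D" for i
    unfolding e_def spectral_sandwich_diag[OF spectral_square[OF sB] unitary_mat_carrier[OF E] that]
    by (simp add: sum_nonneg)
  \<comment> \<open>Peierls' inequality for the square of \<open>B\<close>, with exponent p / 2
    \<ge> 1.\<close>
  have "(\<Sum>i<D. \<bar>e i\<bar> powr (p / 2)) \<le> schatten_power (p / 2) (B * B)"
    unfolding e_def using diagonal_powr_le_schatten_power[OF spectral_hermitian[OF spectral_square[OF sB]] E] p by simp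
  also have "\<dots> = schatten_power p B"
    unfolding schatten_power_spectral[OF spectral_square[OF sB]] schatten_power_square_spectral[OF sB] by simp
  finally have le: "(\<Sum>i<D. e i powr (p / 2)) \<le> schatten_power p B" using e by simp
  have "(\<Sum>i<D. \<bar>l i\<bar> powr (p - 2) * e i)
     \<le> (\<Sum>i<D. \<bar>l i\<bar> powr p) powr ((p - 2) / p) * (\<Sum>i<D. e i powr (p / 2)) powr (2 / p)"
    using e by (intro Holder_sum_weights[OF p]) auto
  also have "\<dots> \<le> schatten_power p S powr ((p - 2) / p) * schatten_power p B powr (2 / p)"
    unfolding schatten_power_spectral[OF l] using le p
    by (intro mult_left_mono powr_mono2) (auto intro!: sum_nonneg)
  finally show ?thesis unfolding e_def .
qed

text \<open>Klein's double sum over both eigenbases replaces the differentiation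
  of eigenvalues.\<close>

theorem schatten_power_second_order:
  assumes S: "spectral D S U l" and B: "hermitian D B" and p: "p \<ge> 2"
  shows "schatten_power p (S + B) \<le> schatten_power p S
      + p * (\<Sum>i<D. sgn (l i) * \<bar>l i\<bar> powr (p - 1) * Re ((adj U * B * U) $$ (i, i)))
      + p * (p - 1) / 2 * (schatten_power p S powr ((p - 2) / p) + schatten_power p (S + B) powr ((p - 2) / p))
          * schatten_power p B powr (2 / p)"
proof -
  have Sh: "hermitian D S" using spectral_hermitian[OF S] .
  obtain V m where sV: "spectral D (S + B) V m" using hermitian_spectral[OF hermitian_add[OF Sh B]] by blast
  have c: "S \<in> carrier_mat D D" "B \<in> carrier_mat D D" and adjB: "adj B = B" using Sh B by (auto simp: hermitian_def)
  have U: "unitary_mat D U" and V: "unitary_mat D V" using S sV by (auto simp: spectral_def)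
  have Uc: "U \<in> carrier_mat D D" and Vc: "V \<in> carrier_mat D D" using U V by (auto simp: unitary_mat_def)
  define C where "C = adj U * V"
  have Cu: "unitary_mat D C" unfolding C_def using U V by (intro unitary_mat_mult unitary_mat_adj)
  have Cc: "C \<in> carrier_mat D D" using unitary_mat_carrier[OF Cu] .
  have VU: "adj V * U = adj C" unfolding C_def using Uc Vc by (simp add: adj_mult[of _ D D _ D])
  define k where "k i j = (cmod (C $$ (i, j)))\<^sup>2" for i j
  have k0: "k i j \<ge> 0" for i j by (simp add: k_def)
  have row: "(\<Sum>j<D. k i j) = 1" if "i < D" for i using unitary_mat_row_sum[OF Cu that] by (simp add: k_def)
  have col: "(\<Sum>i<D. k i j) = 1" if "j < D" for j using unitary_mat_col_sum[OF Cu that] by (simp add: k_def)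
  define \<beta> where "\<beta> i = Re ((adj U * B * U) $$ (i, i))" for i
  \<comment> \<open>Averaging the new eigenvalues against row i gives the quadratic form of
    \<open>S + B\<close> at the i-th eigenvector of \<open>S\<close>; its difference to
    \<open>l i\<close> is the first-order term.\<close>
  have beta: "(\<Sum>j<D. k i j * (m j - l i)) = \<beta> i" if i: "i < D" for i
  proof -
    have "(adj U * (S + B) * U) $$ (i, i) = (adj U * S * U) $$ (i, i) + (adj U * B * U) $$ (i, i)"
      using c Uc i by (intro sandwich_entry_add)
    then have "complex_of_real (\<Sum>j<D. (cmod ((adj V * U) $$ (j, i)))\<^sup>2 * m j)
        = complex_of_real (l i) + (adj U * B * U) $$ (i, i)"
      unfolding spectral_sandwich_diag[OF sV Uc i] spectral_eigenvalue_entry[OF S i] .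
    then have "Re (complex_of_real (\<Sum>j<D. (cmod ((adj V * U) $$ (j, i)))\<^sup>2 * m j)) = l i + \<beta> i"
      unfolding \<beta>_def by (simp del: index_mult_mat(1))
    moreover have "(\<Sum>j<D. (cmod ((adj V * U) $$ (j, i)))\<^sup>2 * m j) = (\<Sum>j<D. k i j * m j)"
      unfolding VU k_def using Cc i by (intro sum.cong) auto
    ultimately have "(\<Sum>j<D. k i j * m j) = l i + \<beta> i" by (simp only: Re_complex_of_real)
    moreover have "(\<Sum>j<D. k i j * (m j - l i)) = (\<Sum>j<D. k i j * m j) - (\<Sum>j<D. k i j) * l i"
      by (simp add: algebra_simps sum_subtractf sum_distrib_right sum_distrib_left)
    ultimately show ?thesis using row[OF i] by simp
  qed
  define X where "X = adj U * B * V"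
  have Xc: "X \<in> carrier_mat D D" unfolding X_def using c Uc Vc by simp
  have adjX: "adj X = adj V * B * U"
    unfolding X_def using c Uc Vc adjB by (simp add: adj_mult[of _ D D _ D] assoc_mult_mat[of _ D D _ D _ D])
  \<comment> \<open>Between the two eigenbases \<open>B\<close>, as the difference of S + B and S,
    has the entries \<open>(m j - l i) * C $$ (i, j)\<close>. Row and column sums of their squared
    moduli are therefore diagonals of the square of \<open>B\<close> in the two bases.\<close>
  have Xk: "k i j * (m j - l i)\<^sup>2 = (cmod (X $$ (i, j)))\<^sup>2" if ij: "i < D" "j < D" for i j
  proof -
    have "(adj U * (S + B) * V) $$ (i, j) = (adj U * S * V) $$ (i, j) + X $$ (i, j)"
      unfolding X_def using c Uc Vc ij by (intro sandwich_entry_add)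
    then have "X $$ (i, j) = complex_of_real (m j - l i) * C $$ (i, j)"
      unfolding spectral_sandwich_right[OF sV Uc ij] spectral_sandwich_left[OF S Vc ij] C_def
      by (simp add: algebra_simps del: index_mult_mat(1))
    then show ?thesis unfolding k_def by (simp add: norm_mult power_mult_distrib del: of_real_diff)
  qed
  have XX: "X * adj X = adj U * (B * B) * U"
  proof -
    have "X * adj X = adj U * B * (V * adj V) * (B * U)"
      unfolding adjX unfolding X_def using c Uc Vc by (simp add: assoc_mult_mat[of _ D D _ D _ D])
    then show ?thesis unfolding unitary_mat_mult_adj[OF V] using c Uc by (simp add: assoc_mult_mat[of _ D D _ D _ D])
  qed
  have XX': "adj X * X = adj V * (B * B) * V"
  proof -
    have "adj X * X = adj V * B * (U * adj U) * (B * V)"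
      unfolding adjX unfolding X_def using c Uc Vc by (simp add: assoc_mult_mat[of _ D D _ D _ D])
    then show ?thesis unfolding unitary_mat_mult_adj[OF U] using c Vc by (simp add: assoc_mult_mat[of _ D D _ D _ D])
  qed
  have rX: "(\<Sum>j<D. k i j * (m j - l i)\<^sup>2) = Re ((adj U * (B * B) * U) $$ (i, i))" if i: "i < D" for i
    unfolding XX[symmetric] cmod_square_sum_row[OF Xc i] using Xk i by simp
  have cX: "(\<Sum>i<D. k i j * (m j - l i)\<^sup>2) = Re ((adj V * (B * B) * V) $$ (j, j))" if j: "j < D" for j
    unfolding XX'[symmetric] cmod_square_sum_col[OF Xc j] using Xk j by simp
  have "schatten_power p (S + B) = (\<Sum>j<D. (\<Sum>i<D. k i j) * \<bar>m j\<bar> powr p)"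
    unfolding schatten_power_spectral[OF sV] using col by simp
  also have "\<dots> = (\<Sum>i<D. \<Sum>j<D. k i j * \<bar>m j\<bar> powr p)"
    unfolding sum_distrib_right by (rule sum.swap)
  also have "\<dots> \<le> (\<Sum>i<D. \<Sum>j<D. k i j * (\<bar>l i\<bar> powr p + p * (sgn (l i) * \<bar>l i\<bar> powr (p - 1)) * (m j - l i)
           + p * (p - 1) / 2 * (\<bar>l i\<bar> powr (p - 2) + \<bar>m j\<bar> powr (p - 2)) * (m j - l i)\<^sup>2))"
    using k0 by (intro sum_mono mult_left_mono abs_powr_second_order[OF p])
  also have "\<dots> = (\<Sum>i<D. \<bar>l i\<bar> powr p * (\<Sum>j<D. k i j))
      + p * (\<Sum>i<D. sgn (l i) * \<bar>l i\<bar> powr (p - 1) * (\<Sum>j<D. k i j * (m j - l i)))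
      + p * (p - 1) / 2 * ((\<Sum>i<D. \<bar>l i\<bar> powr (p - 2) * (\<Sum>j<D. k i j * (m j - l i)\<^sup>2))
          + (\<Sum>i<D. \<Sum>j<D. \<bar>m j\<bar> powr (p - 2) * (k i j * (m j - l i)\<^sup>2)))"
    by (simp only: distrib_left distrib_right sum.distrib sum_distrib_left sum_distrib_right mult_ac)
  also have "(\<Sum>i<D. \<Sum>j<D. \<bar>m j\<bar> powr (p - 2) * (k i j * (m j - l i)\<^sup>2))
      = (\<Sum>j<D. \<bar>m j\<bar> powr (p - 2) * (\<Sum>i<D. k i j * (m j - l i)\<^sup>2))"
    by (subst sum.swap) (simp add: sum_distrib_left)
  also have "(\<Sum>i<D. \<bar>l i\<bar> powr p * (\<Sum>j<D. k i j)) = schatten_power p S"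
    unfolding schatten_power_spectral[OF S] using row by simp
  also have "(\<Sum>i<D. sgn (l i) * \<bar>l i\<bar> powr (p - 1) * (\<Sum>j<D. k i j * (m j - l i)))
      = (\<Sum>i<D. sgn (l i) * \<bar>l i\<bar> powr (p - 1) * \<beta> i)"
    using beta by simp
  also have "(\<Sum>i<D. \<bar>l i\<bar> powr (p - 2) * (\<Sum>j<D. k i j * (m j - l i)\<^sup>2))
      = (\<Sum>i<D. \<bar>l i\<bar> powr (p - 2) * Re ((adj U * (B * B) * U) $$ (i, i)))"
    by (intro sum.cong refl) (use rX in \<open>auto simp del: index_mult_mat(1)\<close>)
  also have "(\<Sum>j<D. \<bar>m j\<bar> powr (p - 2) * (\<Sum>i<D. k i j * (m j - l i)\<^sup>2))
      = (\<Sum>j<D. \<bar>m j\<bar> powr (p - 2) * Re ((adj V * (B * B) * V) $$ (j, j)))"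
    by (intro sum.cong refl) (use cX in \<open>auto simp del: index_mult_mat(1)\<close>)
  also have "schatten_power p S + p * (\<Sum>i<D. sgn (l i) * \<bar>l i\<bar> powr (p - 1) * \<beta> i)
      + p * (p - 1) / 2 * ((\<Sum>i<D. \<bar>l i\<bar> powr (p - 2) * Re ((adj U * (B * B) * U) $$ (i, i)))
        + (\<Sum>j<D. \<bar>m j\<bar> powr (p - 2) * Re ((adj V * (B * B) * V) $$ (j, j))))
     \<le> schatten_power p S + p * (\<Sum>i<D. sgn (l i) * \<bar>l i\<bar> powr (p - 1) * \<beta> i)
      + p * (p - 1) / 2 * (schatten_power p S powr ((p - 2) / p) * schatten_power p B powr (2 / p)
        + schatten_power p (S + B) powr ((p - 2) / p) * schatten_power p B powr (2 / p))"
    using p by (intro add_left_mono mult_left_mono add_mono Holder_schatten_power[OF S B U p] Holder_schatten_power[OF sV B V p]) auto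
  finally show ?thesis unfolding \<beta>_def by (simp only: distrib_right mult.assoc)
qed

section \<open>Approximate Caratheodory theorem\<close>

lemma weighted_average_le:
  fixes c x :: "nat \<Rightarrow> real"
  assumes c: "\<And>k. k < m \<Longrightarrow> c k \<ge> 0" "(\<Sum>k<m. c k) = 1" and le: "(\<Sum>k<m. c k * x k) \<le> t"
  obtains k where "k < m" "x k \<le> t"
proof (rule ccontr)
  assume *: "\<not> thesis"
  then have gt: "x k > t" if "k < m" for k using that \<open>\<And>k. k < m \<Longrightarrow> x k \<le> t \<Longrightarrow> thesis\<close> by force
  have nn: "\<forall>k\<in>{..<m}. c k * (x k - t) \<ge> 0" using c(1) gt by (simp add: less_imp_le)
  have "(\<Sum>k<m. c k * (x k - t)) = (\<Sum>k<m. c k * x k) - (\<Sum>k<m. c k) * t"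
    by (simp add: algebra_simps sum_subtractf sum_distrib_left sum_distrib_right)
  then have "(\<Sum>k<m. c k * (x k - t)) \<le> 0" using le c(2) by simp
  then have "(\<Sum>k<m. c k * (x k - t)) = 0" using sum_nonneg[of "{..<m}"] nn by (metis (no_types, lifting) order_antisym)
  then have "\<forall>k\<in>{..<m}. c k * (x k - t) = 0" using nn by (subst (asm) sum_nonneg_eq_0_iff) auto
  then have "\<forall>k\<in>{..<m}. c k = 0" using gt by force
  then show False using c(2) by simp
qed

lemma index_smult_carrier:
  "A \<in> carrier_mat D D \<Longrightarrow> i < D \<Longrightarrow> j < D \<Longrightarrow> (c \<cdot>\<^sub>m A) $$ (i, j) = c * A $$ (i, j)"
  by auto

lemma index_minus_carrier:
  "B \<in> carrier_mat D D \<Longrightarrow> i < D \<Longrightarrow> j < D \<Longrightarrow> (A - B) $$ (i, j) = A $$ (i, j) - B $$ (i, j)"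
  by auto

lemma hermitian_carrier: "hermitian D A \<Longrightarrow> A \<in> carrier_mat D D"
  by (simp add: hermitian_def)

text \<open>A - B is twice the midpoint of A and -B, so convexity stands in for the triangle
  inequality.\<close>

lemma schatten_power_minus_le:
  assumes A: "hermitian D A" and B: "hermitian D B" and p: "p \<ge> 1"
  shows "schatten_power p (A - B) \<le> 2 powr p * ((schatten_power p A + schatten_power p B) / 2)"
proof -
  define F where "F k = (if k = (0::nat) then A else of_real (-1) \<cdot>\<^sub>m B)" for k
  have F: "hermitian D (F k)" for k unfolding F_def using A hermitian_smult[OF B, of "-1"] by auto
  note c = hermitian_carrier[OF A] hermitian_carrier[OF B]
  let ?M = "mat_sum D (\<lambda>k. of_real (1 / 2) \<cdot>\<^sub>m F k) {..<2}"
  have "A - B = of_real 2 \<cdot>\<^sub>m ?M"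
    by (rule eq_matI) (use c in \<open>auto simp: F_def numeral_2_eq_2 field_simps\<close>)
  moreover have "hermitian D ?M" using F by (intro hermitian_mat_sum hermitian_smult)
  ultimately have "schatten_power p (A - B) = 2 powr p * schatten_power p ?M"
    using schatten_power_smult[of D ?M p 2] by simp
  also have "schatten_power p ?M \<le> (\<Sum>k<2. 1 / 2 * schatten_power p (F k))"
    using F p by (intro schatten_power_convex) auto
  also have "(\<Sum>k<2. 1 / 2 * schatten_power p (F k)) = (schatten_power p A + schatten_power p B) / 2"
    using schatten_power_smult[OF B, of p "-1"] by (simp add: F_def numeral_2_eq_2)
  finally show ?thesis by simp
qed

lemma hermitian_zero: "hermitian D (0\<^sub>m D D)"
  unfolding hermitian_def by (auto intro!: eq_matI)

lemma schatten_power_zero: "schatten_power p (0\<^sub>m D D) = 0"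
  using schatten_power_smult[OF hermitian_zero, of p 0 D] by simp

section \<open>Greedy selection around a barycentre\<close>

context
  fixes D m :: nat and c :: "nat \<Rightarrow> real" and A :: "nat \<Rightarrow> complex mat" and a :: "complex mat" and p :: real
  assumes hA: "\<And>k. k < m \<Longrightarrow> hermitian D (A k)" and p1: "p > 1"
    and unit: "\<And>k. k < m \<Longrightarrow> schatten_power p (A k) \<le> 1"
    and c0: "\<And>k. k < m \<Longrightarrow> c k \<ge> 0" and c1: "(\<Sum>k<m. c k) = 1"
    and a_eq: "a = mat_sum D (\<lambda>k. of_real (c k) \<cdot>\<^sub>m A k) {..<m}"
begin

lemma barycentre_hermitian: "hermitian D a"
  unfolding a_eq using hA by (intro hermitian_mat_sum hermitian_smult) auto

lemma barycentre_schatten_power_le: "schatten_power p a \<le> 1"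
proof -
  have "schatten_power p a \<le> (\<Sum>k<m. c k * schatten_power p (A k))"
    unfolding a_eq using hA c0 c1 p1 by (intro schatten_power_convex) auto
  also have "\<dots> \<le> (\<Sum>k<m. c k * 1)" using c0 unit by (intro sum_mono mult_left_mono) auto
  finally show ?thesis using c1 by simp
qed

lemma deviation_hermitian: "k < m \<Longrightarrow> hermitian D (A k - a)"
  using hA barycentre_hermitian by (intro hermitian_minus)

lemma deviation_schatten_power_le: "k < m \<Longrightarrow> schatten_power p (A k - a) \<le> 2 powr p"
proof -
  assume k: "k < m"
  have "schatten_power p (A k - a) \<le> 2 powr p * ((schatten_power p (A k) + schatten_power p a) / 2)"
    using hA[OF k] barycentre_hermitian p1 by (intro schatten_power_minus_le) auto
  also have "\<dots> \<le> 2 powr p * 1"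
    using unit[OF k] barycentre_schatten_power_le by (intro mult_left_mono) auto
  finally show ?thesis by simp
qed

lemma deviation_average_entry:
  assumes "i < D" "j < D"
  shows "(\<Sum>k<m. complex_of_real (c k) * (A k - a) $$ (i, j)) = 0"
proof -
  have Ac: "A k \<in> carrier_mat D D" if "k < m" for k using hermitian_carrier[OF hA[OF that]] .
  have ac: "a \<in> carrier_mat D D" using hermitian_carrier[OF barycentre_hermitian] .
  have s1: "(\<Sum>k<m. complex_of_real (c k)) = 1" using c1 by (metis of_real_1 of_real_sum)
  have "a $$ (i, j) = (\<Sum>k<m. complex_of_real (c k) * A k $$ (i, j))"
    unfolding a_eq using Ac assms by (auto intro!: sum.cong index_smult_carrier[of _ D])
  moreover have "(\<Sum>k<m. complex_of_real (c k) * (A k - a) $$ (i, j))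
     = (\<Sum>k<m. complex_of_real (c k) * A k $$ (i, j)) - (\<Sum>k<m. complex_of_real (c k)) * a $$ (i, j)"
    using Ac ac assms by (simp add: algebra_simps sum_subtractf sum_distrib_right sum_distrib_left)
  ultimately show ?thesis using s1 by simp
qed

text \<open>The matrices S - X_k, with X_k the deviations, average to S, so Jensen's inequality
  bounds the mean power of S - X_k from below by that of S. Inserted into the averaged parallelogram
  inequality, this lets the power of S + X_k grow on average by at most 2 * 2^p, and some k is no
  worse than the average.\<close>

lemma greedy_step_low:
  assumes S: "hermitian D S" and p2: "p < 2"
  obtains k where "k < m" "schatten_power p (S + (A k - a)) \<le> schatten_power p S + 2 * 2 powr p"
proof -
  let ?X = "\<lambda>k. A k - a"
  have Sc: "S \<in> carrier_mat D D" using hermitian_carrier[OF S] .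
  have Xc: "?X k \<in> carrier_mat D D" if "k < m" for k using hermitian_carrier[OF deviation_hermitian[OF that]] .
  have s1: "(\<Sum>k<m. complex_of_real (c k)) = 1" using c1 by (metis of_real_1 of_real_sum)
  have "S = mat_sum D (\<lambda>k. of_real (c k) \<cdot>\<^sub>m (S - ?X k)) {..<m}"
  proof (rule square_mat_eqI[of _ D])
    fix i j assume ij: "i < D" "j < D"
    have ix: "(of_real (c k) \<cdot>\<^sub>m (S - ?X k)) $$ (i, j) = complex_of_real (c k) * (S $$ (i, j) - ?X k $$ (i, j))"
      if "k < m" for k
      using Sc Xc[OF that] ij
      by (subst index_smult_carrier[of _ D]) (auto simp: index_minus_carrier[of "?X k" D] simp del: index_minus_mat(1))
    have "mat_sum D (\<lambda>k. of_real (c k) \<cdot>\<^sub>m (S - ?X k)) {..<m} $$ (i, j)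
       = (\<Sum>k<m. complex_of_real (c k) * (S $$ (i, j) - ?X k $$ (i, j)))"
      using ij ix by simp
    also have "\<dots> = (\<Sum>k<m. complex_of_real (c k)) * S $$ (i, j) - (\<Sum>k<m. complex_of_real (c k) * ?X k $$ (i, j))"
      by (simp add: right_diff_distrib sum_subtractf sum_distrib_right del: index_minus_mat)
    also have "\<dots> = S $$ (i, j)" unfolding s1 deviation_average_entry[OF ij] by simp
    finally show "S $$ (i, j) = mat_sum D (\<lambda>k. of_real (c k) \<cdot>\<^sub>m (S - ?X k)) {..<m} $$ (i, j)" ..
  qed (use Sc in auto)
  then have "schatten_power p S = schatten_power p (mat_sum D (\<lambda>k. of_real (c k) \<cdot>\<^sub>m (S - ?X k)) {..<m})"
    by (rule arg_cong)
  also have "\<dots> \<le> (\<Sum>k<m. c k * schatten_power p (S - ?X k))"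
    using S hA barycentre_hermitian c0 c1 p1 by (intro schatten_power_convex hermitian_minus) auto
  finally have jensen: "schatten_power p S \<le> (\<Sum>k<m. c k * schatten_power p (S - ?X k))" .
  have "(\<Sum>k<m. c k * schatten_power p (S + ?X k))
     \<le> (\<Sum>k<m. c k * (2 * schatten_power p S + 2 * 2 powr p - schatten_power p (S - ?X k)))"
  proof (intro sum_mono mult_left_mono)
    fix k assume "k \<in> {..<m}"
    then have k: "k < m" by simp
    show "schatten_power p (S + ?X k) \<le> 2 * schatten_power p S + 2 * 2 powr p - schatten_power p (S - ?X k)"
      using schatten_power_parallelogram[OF S deviation_hermitian[OF k] _ p2] p1 deviation_schatten_power_le[OF k] by simp
  qed (use c0 in auto)
  also have "\<dots> = (\<Sum>k<m. c k) * (2 * schatten_power p S + 2 * 2 powr p) - (\<Sum>k<m. c k * schatten_power p (S - ?X k))"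
    by (simp only: right_diff_distrib sum_subtractf sum_distrib_right)
  also have "\<dots> \<le> schatten_power p S + 2 * 2 powr p" unfolding c1 using jensen by simp
  finally show ?thesis by (rule weighted_average_le[OF c0 c1, rotated 1]) (auto intro: that)
qed

text \<open>The linear term of the second-order bound has average 0 because the deviations do, so
  some k makes it nonpositive. Only the quadratic remainder is left; its factor
  \<open>2\<^sup>2\<close> comes from deviations of norm at most 2.\<close>

lemma greedy_step_high:
  assumes S: "hermitian D S" and p2: "p \<ge> 2"
  obtains k where "k < m" "schatten_power p (S + (A k - a)) \<le> schatten_power p S
      + p * (p - 1) / 2 * (schatten_power p S powr ((p - 2) / p) + schatten_power p (S + (A k - a)) powr ((p - 2) / p)) * 2\<^sup>2"
proof -
  let ?X = "\<lambda>k. A k - a"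
  have Xc: "?X k \<in> carrier_mat D D" if "k < m" for k using hermitian_carrier[OF deviation_hermitian[OF that]] .
  obtain U l where s: "spectral D S U l" using hermitian_spectral[OF S] by blast
  have Uc: "U \<in> carrier_mat D D" using s by (simp add: spectral_def unitary_mat_def)
  define f where "f i = sgn (l i) * \<bar>l i\<bar> powr (p - 1)" for i
  define L where "L k = (\<Sum>i<D. f i * Re ((adj U * ?X k * U) $$ (i, i)))" for k
  have avg: "(\<Sum>k<m. c k * Re ((adj U * ?X k * U) $$ (i, i))) = 0" if i: "i < D" for i
  proof -
    let ?Z = "mat_sum D (\<lambda>k. of_real (c k) \<cdot>\<^sub>m ?X k) {..<m}"
    have ix: "(of_real (c k) \<cdot>\<^sub>m ?X k) $$ (r, s) = complex_of_real (c k) * ?X k $$ (r, s)"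
      if "k < m" "r < D" "s < D" for k r s
      using Xc[OF that(1)] that by (metis carrier_matD index_smult_mat(1))
    have "?Z = 0\<^sub>m D D"
      by (rule eq_matI) (auto simp: ix deviation_average_entry simp del: index_minus_mat index_smult_mat(1))
    then have "(adj U * ?Z * U) $$ (i, i) = 0" using Uc i by simp
    moreover have "(adj U * ?Z * U) $$ (i, i) = (\<Sum>k<m. complex_of_real (c k) * (adj U * ?X k * U) $$ (i, i))"
      using Uc i Xc by (intro sandwich_entry_mat_sum) auto
    ultimately have "Re (\<Sum>k<m. complex_of_real (c k) * (adj U * ?X k * U) $$ (i, i)) = 0" by simp
    then show ?thesis by (simp del: index_mult_mat)
  qed
  have "(\<Sum>k<m. c k * L k) = (\<Sum>i<D. f i * (\<Sum>k<m. c k * Re ((adj U * ?X k * U) $$ (i, i))))"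
    unfolding L_def sum_distrib_left by (subst sum.swap) (simp add: mult_ac del: index_mult_mat)
  also have "\<dots> = 0" using avg by simp
  finally obtain k where k: "k < m" "L k \<le> 0" using weighted_average_le[OF c0 c1, of L 0] by auto
  have le: "schatten_power p (?X k) powr (2 / p) \<le> 2\<^sup>2"
  proof -
    have "schatten_power p (?X k) powr (2 / p) \<le> (2 powr p) powr (2 / p)"
      using deviation_schatten_power_le[OF k(1)] p2 schatten_power_nonneg by (intro powr_mono2) auto
    then show ?thesis using p2 by (simp add: powr_powr)
  qed
  let ?K = "p * (p - 1) / 2 * (schatten_power p S powr ((p - 2) / p) + schatten_power p (S + ?X k) powr ((p - 2) / p))"
  have "schatten_power p (S + ?X k) \<le> schatten_power p S + p * L k + ?K * schatten_power p (?X k) powr (2 / p)"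
    using schatten_power_second_order[OF s deviation_hermitian[OF k(1)] p2] unfolding L_def f_def .
  also have "\<dots> \<le> schatten_power p S + 0 + ?K * 2\<^sup>2"
    using le k(2) p2 by (intro add_mono mult_left_mono) (auto simp: mult_nonneg_nonpos)
  finally show ?thesis using that[OF k(1)] by simp
qed

definition partial_deviation :: "(nat \<Rightarrow> nat) \<Rightarrow> nat \<Rightarrow> complex mat" where
  "partial_deviation ix k = mat_sum D (\<lambda>i. A (ix i) - a) {..<k}"

lemma partial_deviation_Suc:
  assumes "l < m"
  shows "partial_deviation (ix(k := l)) (Suc k) = partial_deviation ix k + (A l - a)"
  using hermitian_carrier[OF deviation_hermitian[OF assms]]
  by (intro eq_matI) (auto simp: partial_deviation_def simp del: index_minus_mat)

lemma partial_deviation_hermitian: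
  assumes "\<forall>i<k. ix i < m"
  shows "hermitian D (partial_deviation ix k)"
  unfolding partial_deviation_def using assms deviation_hermitian by (intro hermitian_mat_sum) auto

lemma partial_deviation_0: "schatten_power p (partial_deviation ix 0) = 0"
proof -
  have "partial_deviation ix 0 = 0\<^sub>m D D" by (rule eq_matI) (auto simp: partial_deviation_def)
  then show ?thesis by (simp add: schatten_power_zero)
qed

text \<open>Linear growth, from k deviations of norm at most 2. It serves the first steps of
  \<open>greedy_high\<close>, where it is stronger than square-root growth.\<close>

lemma partial_deviation_trivial_bound:
  assumes "\<forall>i<k. ix i < m" "k > 0"
  shows "schatten_power p (partial_deviation ix k) \<le> (2 * real k) powr p"
proof -
  define t where "t = 1 / real k"
  have t: "t \<ge> 0" "real k * t = 1" using assms by (auto simp: t_def)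
  let ?M = "mat_sum D (\<lambda>i. of_real t \<cdot>\<^sub>m (A (ix i) - a)) {..<k}"
  have h: "hermitian D (A (ix i) - a)" if "i < k" for i using assms that deviation_hermitian by auto
  have "complex_of_real (real k) * complex_of_real t = 1" unfolding of_real_mult[symmetric] t(2) by simp
  then have kt: "complex_of_real (real k) * (complex_of_real t * z) = z" for z by (metis mult.assoc mult_1)
  have "partial_deviation ix k = of_real (real k) \<cdot>\<^sub>m ?M"
  proof (rule square_mat_eqI[of _ D])
    fix r s assume rs: "r < D" "s < D"
    have "(of_real (real k) \<cdot>\<^sub>m ?M) $$ (r, s)
        = (\<Sum>i<k. complex_of_real (real k) * (complex_of_real t * (A (ix i) - a) $$ (r, s)))"
      using rs hermitian_carrier[OF h]
      by (auto simp: index_smult_carrier[of _ D] sum_distrib_left simp del: index_smult_mat(1) index_minus_mat(1) intro!: sum.cong)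
    then show "partial_deviation ix k $$ (r, s) = (of_real (real k) \<cdot>\<^sub>m ?M) $$ (r, s)"
      unfolding kt partial_deviation_def using rs by (simp del: index_minus_mat(1))
  qed (auto simp: partial_deviation_def)
  moreover have "hermitian D ?M" using h by (intro hermitian_mat_sum hermitian_smult) auto
  ultimately have "schatten_power p (partial_deviation ix k) = real k powr p * schatten_power p ?M"
    using schatten_power_smult[of D ?M p "real k"] by simp
  also have "schatten_power p ?M \<le> (\<Sum>i<k. t * schatten_power p (A (ix i) - a))"
    using h p1 t by (intro schatten_power_convex) auto
  also have "\<dots> \<le> (\<Sum>i<k. t * 2 powr p)"
    using deviation_schatten_power_le assms t by (intro sum_mono mult_left_mono) auto
  also have "\<dots> = 2 powr p" using t(2) by (simp flip: mult.assoc)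
  finally show ?thesis using assms by (simp add: powr_mult mult_ac)
qed

lemma greedy_low:
  assumes "p < 2"
  shows "\<exists>ix. (\<forall>i<k. ix i < m) \<and> schatten_power p (partial_deviation ix k) \<le> real k * (2 * 2 powr p)"
proof (induction k)
  case 0
  then show ?case using partial_deviation_0 by auto
next
  case (Suc k)
  then obtain ix where ix: "\<forall>i<k. ix i < m" "schatten_power p (partial_deviation ix k) \<le> real k * (2 * 2 powr p)" by auto
  obtain l where l: "l < m"
    "schatten_power p (partial_deviation ix k + (A l - a)) \<le> schatten_power p (partial_deviation ix k) + 2 * 2 powr p"
    using greedy_step_low[OF partial_deviation_hermitian[OF ix(1)] assms] .
  then have "schatten_power p (partial_deviation (ix(k := l)) (Suc k)) \<le> real (Suc k) * (2 * 2 powr p)"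
    unfolding partial_deviation_Suc[OF l(1)] using ix(2) by (simp add: algebra_simps)
  moreover have "\<forall>i<Suc k. (ix(k := l)) i < m" using ix l by (auto simp: less_Suc_eq)
  ultimately show ?case by blast
qed

text \<open>The invariant is that the squared norm grows linearly with slope 16 (p - 1). The first
  alternative of \<open>powr_recursion_step\<close> with R = 2 adds exactly this slope; the second
  bounds the new sum by a constant, which is compared with the invariant directly.\<close>

lemma greedy_high:
  assumes p2: "p \<ge> 2"
  shows "\<exists>ix. (\<forall>i<k. ix i < m) \<and> (schatten_power p (partial_deviation ix k) powr (1 / p))\<^sup>2 \<le> 4 * (p - 1) * real k * 2\<^sup>2"
proof (induction k)
  case 0
  then show ?case using partial_deviation_0 by auto
next
  case (Suc k)
  then obtain ix where ix: "\<forall>i<k. ix i < m"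
    "(schatten_power p (partial_deviation ix k) powr (1 / p))\<^sup>2 \<le> 4 * (p - 1) * real k * 2\<^sup>2" by auto
  define S where "S = partial_deviation ix k"
  obtain l where l: "l < m" "schatten_power p (S + (A l - a)) \<le> schatten_power p S
      + p * (p - 1) / 2 * (schatten_power p S powr ((p - 2) / p) + schatten_power p (S + (A l - a)) powr ((p - 2) / p)) * 2\<^sup>2"
    using greedy_step_high[OF partial_deviation_hermitian[OF ix(1)] p2] unfolding S_def .
  define x where "x = schatten_power p S powr (1 / p)"
  define y where "y = schatten_power p (S + (A l - a)) powr (1 / p)"
  have sp: "schatten_power p M = (schatten_power p M powr (1 / p)) powr p"
    "schatten_power p M powr ((p - 2) / p) = (schatten_power p M powr (1 / p)) powr (p - 2)" for M
    using schatten_power_nonneg p2 by (auto simp: powr_powr)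
  have ind: "\<forall>i<Suc k. (ix(k := l)) i < m" using ix l by (auto simp: less_Suc_eq)
  have pd: "partial_deviation (ix(k := l)) (Suc k) = S + (A l - a)"
    unfolding S_def using partial_deviation_Suc[OF l(1)] .
  have y0: "y \<ge> 0" and x0: "x \<ge> 0" by (auto simp: x_def y_def)
  have "y powr p \<le> x powr p + p * (p - 1) / 2 * (x powr (p - 2) + y powr (p - 2)) * 2\<^sup>2"
    using l(2) unfolding x_def y_def sp[symmetric] .
  then consider (inc) "y\<^sup>2 \<le> x\<^sup>2 + 4 * (p - 1) * 2\<^sup>2" | (small) "y\<^sup>2 \<le> 2 * p * (p - 1) * 2\<^sup>2"
    using powr_recursion_step[OF p2 x0 y0] by blast
  then have "y\<^sup>2 \<le> 4 * (p - 1) * real (Suc k) * 2\<^sup>2"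
  proof cases
    case inc
    then show ?thesis using ix(2) unfolding x_def S_def by (simp add: algebra_simps)
  next
    case small
    show ?thesis
    \<comment> \<open>Up to 4 (p - 1) steps the bound \<open>2 * real (Suc k)\<close> on the norm
      implies the invariant. Beyond that, 2 p (p - 1) \<le> 16 (p - 1)^2 puts the constant below
      it.\<close>
    proof (cases "real (Suc k) \<le> 4 * (p - 1)")
      case True
      have "schatten_power p (S + (A l - a)) \<le> (2 * real (Suc k)) powr p"
        using partial_deviation_trivial_bound[OF ind] unfolding pd by simp
      then have "y \<le> ((2 * real (Suc k)) powr p) powr (1 / p)"
        unfolding y_def using p2 schatten_power_nonneg by (intro powr_mono2) auto
      also have "\<dots> = 2 * real (Suc k)" using p2 by (simp add: powr_powr)
      finally have "y\<^sup>2 \<le> (2 * real (Suc k))\<^sup>2" using y0 by (intro power_mono)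
      also have "\<dots> = real (Suc k) * real (Suc k) * 2\<^sup>2" by (simp only: power2_eq_square mult_ac)
      also have "\<dots> \<le> 4 * (p - 1) * real (Suc k) * 2\<^sup>2"
        using True by (intro mult_right_mono) auto
      finally show ?thesis .
    next
      case False
      have "2 * p * (p - 1) \<le> 4 * (p - 1) * (4 * (p - 1))"
      proof -
        have "2 * p * (p - 1) \<le> (16 * (p - 1)) * (p - 1)" using p2 by (intro mult_right_mono) auto
        then show ?thesis by (simp add: algebra_simps)
      qed
      also have "\<dots> \<le> 4 * (p - 1) * real (Suc k)" using False p2 by (intro mult_left_mono) auto
      finally have "2 * p * (p - 1) * 2\<^sup>2 \<le> 4 * (p - 1) * real (Suc k) * 2\<^sup>2" by (intro mult_right_mono) auto
      then show ?thesis using small by linarith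
    qed
  qed
  then show ?case using ind pd unfolding y_def by metis
qed

lemma empirical_mean_deviation:
  assumes ix: "\<forall>i<k. ix i < m" and k: "k > 0"
  shows "schatten_power p (a - mat_sum D (\<lambda>i. of_real (1 / real k) \<cdot>\<^sub>m A (ix i)) {..<k})
      = (1 / real k) powr p * schatten_power p (partial_deviation ix k)"
proof -
  define t where "t = 1 / real k"
  have t: "real k * t = 1" "\<bar>t\<bar> = t" using k by (auto simp: t_def)
  have Ac: "A (ix i) \<in> carrier_mat D D" if "i < k" for i using hermitian_carrier[OF hA] ix that by auto
  have ac: "a \<in> carrier_mat D D" using hermitian_carrier[OF barycentre_hermitian] .
  have "a - mat_sum D (\<lambda>i. of_real (t) \<cdot>\<^sub>m A (ix i)) {..<k} = of_real (- t) \<cdot>\<^sub>m partial_deviation ix k"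
  proof (rule square_mat_eqI[of _ D])
    fix r s assume rs: "r < D" "s < D"
    have 1: "(of_real t \<cdot>\<^sub>m A (ix i)) $$ (r, s) = complex_of_real t * A (ix i) $$ (r, s)"
      if "i < k" for i using Ac[OF that] rs by (rule index_smult_carrier)
    have "(of_real (- t) \<cdot>\<^sub>m partial_deviation ix k) $$ (r, s)
        = complex_of_real (- t) * (\<Sum>i<k. A (ix i) $$ (r, s) - a $$ (r, s))"
      using rs ac by (simp add: partial_deviation_def)
    also have "\<dots> = complex_of_real (real k) * complex_of_real t * a $$ (r, s) - complex_of_real t * (\<Sum>i<k. A (ix i) $$ (r, s))"
      by (simp add: sum_subtractf algebra_simps)
    also have "\<dots> = a $$ (r, s) - complex_of_real t * (\<Sum>i<k. A (ix i) $$ (r, s))"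
      unfolding of_real_mult[symmetric] t by simp
    also have "\<dots> = (a - mat_sum D (\<lambda>i. of_real t \<cdot>\<^sub>m A (ix i)) {..<k}) $$ (r, s)"
      using rs 1 by (simp add: sum_distrib_left del: index_smult_mat(1))
    finally show "(a - mat_sum D (\<lambda>i. of_real t \<cdot>\<^sub>m A (ix i)) {..<k}) $$ (r, s)
       = (of_real (- t) \<cdot>\<^sub>m partial_deviation ix k) $$ (r, s)" ..
  qed (auto simp: partial_deviation_def)
  then show ?thesis using schatten_power_smult[OF partial_deviation_hermitian[OF ix], of p "- t"] t(2) unfolding t_def by simp
qed

text \<open>The p-th power of the sum grows linearly in k, while passing to the mean divides it by
  k^p; p > 1 makes the quotient decay.\<close>

theorem approximate_caratheodory_low:
  assumes "p < 2" "k > 0"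
  shows "\<exists>ix. (\<forall>i<k. ix i < m) \<and>
    schatten_power p (a - mat_sum D (\<lambda>i. of_real (1 / real k) \<cdot>\<^sub>m A (ix i)) {..<k}) powr (1 / p)
      \<le> (2 * 2 powr p * real k powr (1 - p)) powr (1 / p)"
proof -
  obtain ix where ix: "\<forall>i<k. ix i < m" "schatten_power p (partial_deviation ix k) \<le> real k * (2 * 2 powr p)"
    using greedy_low[OF assms(1)] by blast
  have "(1 / real k) powr p * schatten_power p (partial_deviation ix k) \<le> (1 / real k) powr p * (real k * (2 * 2 powr p))"
    using ix by (intro mult_left_mono) auto
  also have "\<dots> = 2 * 2 powr p * real k powr (1 - p)"
    using assms by (simp add: powr_divide powr_diff)
  finally have "((1 / real k) powr p * schatten_power p (partial_deviation ix k)) powr (1 / p)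
      \<le> (2 * 2 powr p * real k powr (1 - p)) powr (1 / p)"
    using p1 schatten_power_nonneg by (intro powr_mono2) auto
  then show ?thesis using empirical_mean_deviation[OF ix(1) assms(2)] ix(1) by auto
qed

theorem approximate_caratheodory_high:
  assumes "p \<ge> 2" "k > 0"
  shows "\<exists>ix. (\<forall>i<k. ix i < m) \<and>
    schatten_power p (a - mat_sum D (\<lambda>i. of_real (1 / real k) \<cdot>\<^sub>m A (ix i)) {..<k}) powr (1 / p)
      \<le> sqrt (16 * (p - 1) / real k)"
proof -
  obtain ix where ix: "\<forall>i<k. ix i < m"
    "(schatten_power p (partial_deviation ix k) powr (1 / p))\<^sup>2 \<le> 4 * (p - 1) * real k * 2\<^sup>2"
    using greedy_high[OF assms(1)] by blast
  have "((1 / real k) powr p * schatten_power p (partial_deviation ix k)) powr (1 / p)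
     = 1 / real k * schatten_power p (partial_deviation ix k) powr (1 / p)"
    using assms schatten_power_nonneg by (simp add: powr_mult powr_powr)
  also have "\<dots> \<le> sqrt (16 * (p - 1) / real k)"
  proof (rule real_le_rsqrt)
    have "(1 / real k * schatten_power p (partial_deviation ix k) powr (1 / p))\<^sup>2
       = (1 / real k)\<^sup>2 * (schatten_power p (partial_deviation ix k) powr (1 / p))\<^sup>2" by (simp only: power_mult_distrib)
    also have "\<dots> \<le> (1 / real k)\<^sup>2 * (4 * (p - 1) * real k * 2\<^sup>2)" using ix(2) by (intro mult_left_mono) auto
    also have "\<dots> = 16 * (p - 1) / real k" using assms by (simp add: power2_eq_square)
    finally show "(1 / real k * schatten_power p (partial_deviation ix k) powr (1 / p))\<^sup>2 \<le> 16 * (p - 1) / real k" .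
  qed
  finally show ?thesis using empirical_mean_deviation[OF ix(1) assms(2)] ix(1) by auto
qed

end

section \<open>Tensor products and mixed-radix digits\<close>

text \<open>Place value of digit i; index 0 is the most significant, in accordance with
  \<open>kron_list\<close>.\<close>

definition place :: "nat \<Rightarrow> (nat \<Rightarrow> nat) \<Rightarrow> nat \<Rightarrow> nat" where
  "place n d i = (\<Prod>j\<in>{i<..n}. d j)"

lemma digit_place: "digit n d a i = a div place n d i mod d i"
  by (simp add: digit_def place_def)

lemma prod_place: "lo \<le> n \<Longrightarrow> (\<Prod>j\<in>{lo..n}. d j) = d lo * place n d lo"
proof -
  assume "lo \<le> n"
  then have "{lo..n} = insert lo {lo<..n}" by auto
  then show ?thesis by (simp add: place_def)
qed

lemma place_Suc: "place n d i = (\<Prod>j\<in>{Suc i..n}. d j)"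
  by (simp add: place_def atLeastSucAtMost_greaterThanAtMost)

lemma place_dvd:
  assumes "lo < i" "i \<le> n"
  shows "\<exists>R. place n d lo = place n d i * (d i * R)"
proof -
  have "{lo<..n} = {i<..n} \<union> insert i {lo<..<i}" using assms by auto
  moreover have "{i<..n} \<inter> insert i {lo<..<i} = {}" by auto
  ultimately have "place n d lo = place n d i * (\<Prod>j\<in>insert i {lo<..<i}. d j)"
    unfolding place_def by (metis finite_greaterThanAtMost finite_greaterThanLessThan finite_insert prod.union_disjoint)
  then show ?thesis by (auto simp: mult.assoc)
qed

lemma digit_mod_place:
  assumes "lo < i" "i \<le> n"
  shows "digit n d (a mod place n d lo) i = digit n d a i"
proof -
  obtain R where R: "place n d lo = place n d i * (d i * R)" using place_dvd[OF assms] by blast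
  have "a mod (place n d i * (d i * R)) = place n d i * (a div place n d i mod (d i * R)) + a mod place n d i"
    by (rule mod_mult2_eq)
  \<comment> \<open>The place value is 0 if a later dimension is 0; both digits are then 0.\<close>
  then have "(a mod place n d lo) div place n d i = a div place n d i mod (d i * R) \<or> place n d i = 0"
    unfolding R by (cases "place n d i = 0") auto
  then show ?thesis unfolding digit_place
  proof
    assume "(a mod place n d lo) div place n d i = a div place n d i mod (d i * R)"
    then show "(a mod place n d lo) div place n d i mod d i = a div place n d i mod d i"
      by (simp add: mod_mod_cancel)
  qed simp
qed

text \<open>Downward induction on the first factor \<open>lo\<close>: an index splits into its
  leading digit, which selects the entry of \<open>f lo\<close>, and a remainder whose later digits
  are unchanged.\<close>

lemma kron_list_carrier_entry:
  assumes f: "\<And>i. lo \<le> i \<Longrightarrow> i \<le> n \<Longrightarrow> f i \<in> carrier_mat (d i) (d i)" and "lo \<le> Suc n"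
  shows "kron_list (map f [lo..<Suc n]) \<in> carrier_mat (\<Prod>j\<in>{lo..n}. d j) (\<Prod>j\<in>{lo..n}. d j) \<and>
    (\<forall>a b. a < (\<Prod>j\<in>{lo..n}. d j) \<longrightarrow> b < (\<Prod>j\<in>{lo..n}. d j) \<longrightarrow>
      kron_list (map f [lo..<Suc n]) $$ (a, b) = (\<Prod>i\<in>{lo..n}. f i $$ (digit n d a i, digit n d b i)))"
  using assms(2) f
proof (induction lo rule: inc_induct)
  case base
  then show ?case by auto
next
  case (step lo)
  let ?K = "kron_list (map f [Suc lo..<Suc n])"
  let ?P = "place n d lo"
  have lo: "lo \<le> n" using step by simp
  have IH: "?K \<in> carrier_mat ?P ?P"
    "\<And>a b. a < ?P \<Longrightarrow> b < ?P \<Longrightarrow> ?K $$ (a, b) = (\<Prod>i\<in>{Suc lo..n}. f i $$ (digit n d a i, digit n d b i))"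
    using step.IH step.prems unfolding place_Suc by auto
  have flo: "f lo \<in> carrier_mat (d lo) (d lo)" using step.prems lo by auto
  have eq: "kron_list (map f [lo..<Suc n]) = kron (f lo) ?K"
    using lo by (simp add: upt_conv_Cons del: upt_Suc)
  have set: "{lo..n} = insert lo {Suc lo..n}" using lo by auto
  show ?case unfolding prod_place[OF lo] eq
  proof (intro conjI allI impI)
    show "kron (f lo) ?K \<in> carrier_mat (d lo * ?P) (d lo * ?P)"
      using flo IH(1) by (simp add: kron_def)
    fix a b assume ab: "a < d lo * ?P" "b < d lo * ?P"
    then have P0: "?P > 0" by (metis gr0I less_zeroE mult_0_right)
    have m: "x mod ?P < ?P" for x using P0 by simp
    have dg: "digit n d x lo = x div ?P" if "x < d lo * ?P" for x
      unfolding digit_place using that by (simp add: less_mult_imp_div_less)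
    have "kron (f lo) ?K $$ (a, b) = f lo $$ (a div ?P, b div ?P) * ?K $$ (a mod ?P, b mod ?P)"
      using flo IH(1) ab by (simp add: kron_def)
    also have "?K $$ (a mod ?P, b mod ?P) = (\<Prod>i\<in>{Suc lo..n}. f i $$ (digit n d a i, digit n d b i))"
      unfolding IH(2)[OF m m] by (intro prod.cong) (auto simp: digit_mod_place)
    finally show "kron (f lo) ?K $$ (a, b) = (\<Prod>i\<in>{lo..n}. f i $$ (digit n d a i, digit n d b i))"
      unfolding set using dg ab by simp
  qed
qed

lemma total_dim_prod: "total_dim n d = (\<Prod>j\<in>{0..n}. d j)"
  by (simp add: total_dim_def atMost_atLeast0)

lemma tensor_carrier:
  assumes "\<And>i. i \<le> n \<Longrightarrow> f i \<in> carrier_mat (d i) (d i)"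
  shows "tensor n f \<in> carrier_mat (total_dim n d) (total_dim n d)"
  unfolding tensor_def total_dim_prod using kron_list_carrier_entry[of 0 n f d] assms by auto

lemma tensor_entry:
  assumes "\<And>i. i \<le> n \<Longrightarrow> f i \<in> carrier_mat (d i) (d i)" "a < total_dim n d" "b < total_dim n d"
  shows "tensor n f $$ (a, b) = (\<Prod>i\<le>n. f i $$ (digit n d a i, digit n d b i))"
  unfolding tensor_def using kron_list_carrier_entry[of 0 n f d] assms by (auto simp: total_dim_prod atMost_atLeast0)

section \<open>Inverse relations between encoding and digits\<close>

lemma digit_less: "0 < d i \<Longrightarrow> digit n d a i < d i"
  by (simp add: digit_def)

lemma encode_digit_from:
  assumes "lo \<le> Suc n"
  shows "(\<Sum>i\<in>{lo..n}. digit n d a i * place n d i) = a mod (\<Prod>j\<in>{lo..n}. d j)"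
  using assms
proof (induction lo rule: inc_induct)
  case (step lo)
  then have lo: "lo \<le> n" by simp
  then have set: "{lo..n} = insert lo {Suc lo..n}" by auto
  have "a mod (d lo * place n d lo) = place n d lo * (a div place n d lo mod d lo) + a mod place n d lo"
    by (metis mod_mult2_eq mult.commute)
  then show ?case unfolding prod_place[OF lo] using step.IH
    by (simp add: set place_Suc[symmetric] digit_place mult.commute)
qed simp

lemma encode_place: "encode n d f = (\<Sum>i\<in>{0..n}. f i * place n d i)"
  by (simp add: encode_def place_def atMost_atLeast0)

lemma encode_digit:
  assumes "a < total_dim n d"
  shows "encode n d (digit n d a) = a"
  unfolding encode_place encode_digit_from[of 0, simplified]
  using assms by (simp add: total_dim_prod)

lemma encode_from_less:
  assumes f: "\<And>i. i \<le> n \<Longrightarrow> f i < d i" and "lo \<le> Suc n"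
  shows "(\<Sum>i\<in>{lo..n}. f i * place n d i) < (\<Prod>j\<in>{lo..n}. d j)"
  using assms(2)
proof (induction lo rule: inc_induct)
  case (step lo)
  then have lo: "lo \<le> n" by simp
  then have set: "{lo..n} = insert lo {Suc lo..n}" by auto
  have "(\<Sum>i\<in>{lo..n}. f i * place n d i) < f lo * place n d lo + place n d lo"
    using step.IH by (simp add: set place_Suc[symmetric])
  also have "\<dots> = Suc (f lo) * place n d lo" by simp
  also have "\<dots> \<le> d lo * place n d lo" using f[OF lo] by (intro mult_right_mono) auto
  finally show ?case unfolding prod_place[OF lo] .
qed simp

lemma encode_less: "(\<And>i. i \<le> n \<Longrightarrow> f i < d i) \<Longrightarrow> encode n d f < total_dim n d"
  unfolding encode_place total_dim_prod by (rule encode_from_less) auto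

lemma digit_encode:
  assumes f: "\<And>i. i \<le> n \<Longrightarrow> f i < d i" and i: "i \<le> n"
  shows "digit n d (encode n d f) i = f i"
proof -
  have set: "{0..n} = {0..<i} \<union> insert i {Suc i..n}" using i by auto
  have "encode n d f = (\<Sum>j\<in>{0..<i}. f j * place n d j) + (f i * place n d i + (\<Sum>j\<in>{Suc i..n}. f j * place n d j))"
    unfolding encode_place set by (subst sum.union_disjoint) auto
  \<comment> \<open>Terms of more significant digits are multiples of
    \<open>place n d i * d i\<close> and vanish modulo \<open>d i\<close> after the division; less
    significant ones sum to less than \<open>place n d i\<close>. The cofactor is chosen by
    \<open>SOME\<close> from \<open>place_dvd\<close>.\<close>
  also have "(\<Sum>j\<in>{0..<i}. f j * place n d j) = place n d i * (d i * (\<Sum>j\<in>{0..<i}. f j * (SOME R. place n d j = place n d i * (d i * R))))"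
    unfolding sum_distrib_left
  proof (rule sum.cong[OF refl])
    fix j assume "j \<in> {0..<i}"
    then have "\<exists>R. place n d j = place n d i * (d i * R)" using place_dvd i by auto
    then have "place n d j = place n d i * (d i * (SOME R. place n d j = place n d i * (d i * R)))" by (rule someI_ex)
    then show "f j * place n d j = place n d i * (d i * (f j * (SOME R. place n d j = place n d i * (d i * R))))"
      by (metis mult.left_commute)
  qed
  finally obtain Y where Y: "encode n d f = place n d i * (d i * Y) + (f i * place n d i + (\<Sum>j\<in>{Suc i..n}. f j * place n d j))"
    by blast
  have lt: "(\<Sum>j\<in>{Suc i..n}. f j * place n d j) < place n d i"
    unfolding place_Suc[of n d i] by (rule encode_from_less) (use f i in auto)
  have "encode n d f = place n d i * (d i * Y + f i) + (\<Sum>j\<in>{Suc i..n}. f j * place n d j)"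
    unfolding Y by (simp add: algebra_simps)
  then have "encode n d f div place n d i = d i * Y + f i" using lt by simp
  then show ?thesis unfolding digit_place using f[OF i] by simp
qed

section \<open>Elementary tensors, relabelled matrices and psd spanning sets\<close>

lemma tensor_hermitian:
  assumes "\<And>i. i \<le> n \<Longrightarrow> hermitian (d i) (f i)" and d: "\<And>i. i \<le> n \<Longrightarrow> 0 < d i"
  shows "hermitian (total_dim n d) (tensor n f)"
proof -
  have c: "f i \<in> carrier_mat (d i) (d i)" if "i \<le> n" for i using assms(1)[OF that] by (simp add: hermitian_def)
  have tc: "tensor n f \<in> carrier_mat (total_dim n d) (total_dim n d)" by (rule tensor_carrier[OF c])
  have "adj (tensor n f) = tensor n f"
  proof (rule square_mat_eqI[of _ "total_dim n d"])
    fix a b assume ab: "a < total_dim n d" "b < total_dim n d"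
    have "cnj (f i $$ (digit n d b i, digit n d a i)) = f i $$ (digit n d a i, digit n d b i)" if "i \<le> n" for i
    proof -
      have "adj (f i) $$ (digit n d a i, digit n d b i) = cnj (f i $$ (digit n d b i, digit n d a i))"
        using c[OF that] digit_less[of d i n] d[OF that] by (intro index_adj) auto
      then show ?thesis using assms(1)[OF that] by (simp add: hermitian_def)
    qed
    then show "adj (tensor n f) $$ (a, b) = tensor n f $$ (a, b)"
      using tc ab by (simp add: tensor_entry[of n f d, OF c])
  qed (use tc in auto)
  then show ?thesis using tc by (simp add: hermitian_def)
qed

text \<open>Elementary tensors in a decomposition carry no coefficients, so scalars have to be
  absorbed; factor 0 always exists.\<close>

lemma tensor_smult:
  assumes c: "\<And>i. i \<le> n \<Longrightarrow> f i \<in> carrier_mat (d i) (d i)" and d: "\<And>i. i \<le> n \<Longrightarrow> 0 < d i"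
  shows "tensor n (f(0 := z \<cdot>\<^sub>m f 0)) = z \<cdot>\<^sub>m tensor n f"
proof -
  have c': "(f(0 := z \<cdot>\<^sub>m f 0)) i \<in> carrier_mat (d i) (d i)" if "i \<le> n" for i using c[OF that] by auto
  have tc: "tensor n f \<in> carrier_mat (total_dim n d) (total_dim n d)"
    "tensor n (f(0 := z \<cdot>\<^sub>m f 0)) \<in> carrier_mat (total_dim n d) (total_dim n d)"
    using tensor_carrier[of n f d] tensor_carrier[of n "f(0 := z \<cdot>\<^sub>m f 0)" d] c c' by auto
  show ?thesis
  proof (rule square_mat_eqI[of _ "total_dim n d"])
    fix a b assume ab: "a < total_dim n d" "b < total_dim n d"
    have 0: "(z \<cdot>\<^sub>m f 0) $$ (digit n d a 0, digit n d b 0) = z * f 0 $$ (digit n d a 0, digit n d b 0)"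
      using c[of 0] d[of 0] digit_less[of d 0 n] by (intro index_smult_carrier) auto
    have split: "(\<Prod>i\<le>n. g i) = g 0 * (\<Prod>i\<in>{1..n}. g i)" for g :: "nat \<Rightarrow> complex"
    proof -
      have "{..n} = insert 0 {1..n}" by auto
      then show ?thesis by simp
    qed
    have te: "tensor n (f(0 := z \<cdot>\<^sub>m f 0)) $$ (a, b)
        = (\<Prod>i\<le>n. (f(0 := z \<cdot>\<^sub>m f 0)) i $$ (digit n d a i, digit n d b i))"
      by (rule tensor_entry[OF c' ab])
    have "tensor n (f(0 := z \<cdot>\<^sub>m f 0)) $$ (a, b) = z * (\<Prod>i\<le>n. f i $$ (digit n d a i, digit n d b i))"
      unfolding te split by (simp add: 0 mult.assoc del: index_smult_mat)
    then show "tensor n (f(0 := z \<cdot>\<^sub>m f 0)) $$ (a, b) = (z \<cdot>\<^sub>m tensor n f) $$ (a, b)"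
      using ab tc by (simp add: tensor_entry[of n f d, OF c])
  qed (use tc in auto)
qed

text \<open>Permuting rows and columns simultaneously permutes the entries of each eigenvector and
  keeps the eigenvalues.\<close>

lemma schatten_power_reindex:
  assumes M: "hermitian D M" and \<pi>: "bij_betw \<pi> {..<D} {..<D}"
  shows "hermitian D (mat D D (\<lambda>(a, b). M $$ (\<pi> a, \<pi> b)))"
    and "schatten_power p (mat D D (\<lambda>(a, b). M $$ (\<pi> a, \<pi> b))) = schatten_power p M"
proof -
  let ?M = "mat D D (\<lambda>(a, b). M $$ (\<pi> a, \<pi> b))"
  obtain U l where s: "spectral D M U l" using hermitian_spectral[OF M] by blast
  have Uc: "U \<in> carrier_mat D D" and UU: "adj U * U = 1\<^sub>m D" using s by (auto simp: spectral_def unitary_mat_def)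
  have Mc: "M \<in> carrier_mat D D" using M by (simp add: hermitian_def)
  have lt: "\<pi> a < D" if "a < D" for a using \<pi> that by (auto simp: bij_betw_def)
  define V where "V = mat D D (\<lambda>(a, b). U $$ (\<pi> a, b))"
  have Vc: "V \<in> carrier_mat D D" by (simp add: V_def)
  have MU: "M * U = U * real_diag D l"
    using s Uc UU unfolding spectral_def by (simp add: assoc_mult_mat[of _ D D _ D _ D])
  have "spectral D ?M V l"
  proof (rule spectralI)
    have "adj V * V = 1\<^sub>m D"
    proof (rule square_mat_eqI[of _ D])
      fix i j assume ij: "i < D" "j < D"
      have "(adj V * V) $$ (i, j) = (\<Sum>a<D. cnj (U $$ (\<pi> a, i)) * U $$ (\<pi> a, j))"
        using ij Vc by (subst index_mult_mat_sum[of _ D D _ D]) (auto simp: V_def intro!: sum.cong)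
      also have "\<dots> = (\<Sum>a<D. cnj (U $$ (a, i)) * U $$ (a, j))"
        by (rule sum.reindex_bij_betw[OF \<pi>])
      also have "\<dots> = (adj U * U) $$ (i, j)"
        using ij Uc by (subst index_mult_mat_sum[of _ D D _ D]) (auto intro!: sum.cong)
      finally show "(adj V * V) $$ (i, j) = 1\<^sub>m D $$ (i, j)" unfolding UU .
    qed (use Vc in auto)
    then show "unitary_mat D V" using Vc by (simp add: unitary_mat_def)
    show "?M * V = V * real_diag D l"
    proof (rule square_mat_eqI[of _ D])
      fix i j assume ij: "i < D" "j < D"
      have "(?M * V) $$ (i, j) = (\<Sum>a<D. M $$ (\<pi> i, \<pi> a) * U $$ (\<pi> a, j))"
        using ij Vc by (subst index_mult_mat_sum[of _ D D _ D]) (auto simp: V_def intro!: sum.cong)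
      also have "\<dots> = (\<Sum>a<D. M $$ (\<pi> i, a) * U $$ (a, j))"
        by (rule sum.reindex_bij_betw[OF \<pi>])
      also have "\<dots> = (M * U) $$ (\<pi> i, j)"
        using ij Uc Mc lt by (subst index_mult_mat_sum[of _ D D _ D]) (auto intro!: sum.cong)
      also have "\<dots> = (V * real_diag D l) $$ (i, j)"
        unfolding MU using ij Uc Vc lt by (simp add: index_mult_real_diag[of _ D D] del: index_mult_mat(1)) (simp add: V_def)
      finally show "(?M * V) $$ (i, j) = (V * real_diag D l) $$ (i, j)" .
    qed (use Vc in auto)
  qed simp
  then show "hermitian D ?M" "schatten_power p ?M = schatten_power p M"
    using spectral_hermitian by (auto simp: schatten_power_spectral[OF s] schatten_power_spectral)
qed

text \<open>The unit matrix \<open>E\<^sub>j\<^sub>k\<close> is a combination of the rank-one matrices \<open>v v\<^sup>*\<close> with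
  \<open>v = e\<^sub>j + \<i>^q e\<^sub>k\<close>, \<open>q < 4\<close> (polarisation).\<close>

definition polar_vec :: "nat \<Rightarrow> nat \<Rightarrow> nat \<Rightarrow> nat \<Rightarrow> complex" where
  "polar_vec q j k r = (if r = j then 1 else 0) + \<i> ^ q * (if r = k then 1 else 0)"

definition polar_mat :: "nat \<Rightarrow> nat \<Rightarrow> nat \<Rightarrow> nat \<Rightarrow> complex mat" where
  "polar_mat N q j k = mat N N (\<lambda>(r, s). polar_vec q j k r * cnj (polar_vec q j k s))"

text \<open>Of the four products of unit vectors only the wanted one has a phase cancelled by
  \<open>\<i> ^ q\<close>; the others are left with the phase \<open>\<i> ^ q\<close> or its square
  and sum to 0 over q.\<close>

lemma polar_decomposition:
  "(\<Sum>q<4. \<i> ^ q / 4 * (polar_vec q j k r * cnj (polar_vec q j k s))) = (if r = j \<and> s = k then 1 else 0)"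
  by (simp add: polar_vec_def eval_nat_numeral algebra_simps)

lemma psd_polar_mat: "psd N (polar_mat N q j k)"
proof -
  let ?v = "polar_vec q j k"
  have h: "hermitian N (polar_mat N q j k)"
    unfolding hermitian_def polar_mat_def by (auto intro!: eq_matI)
  have "0 \<le> Re (conjugate x \<bullet> (polar_mat N q j k *\<^sub>v x))" if x: "x \<in> carrier_vec N" for x
  proof -
    define y where "y = (\<Sum>s<N. cnj (?v s) * x $ s)"
    have "conjugate x \<bullet> (polar_mat N q j k *\<^sub>v x) = (\<Sum>r<N. cnj (x $ r) * (\<Sum>s<N. ?v r * cnj (?v s) * x $ s))"
      using x by (auto simp: scalar_prod_def polar_mat_def atLeast0LessThan intro!: sum.cong)
    also have "\<dots> = (\<Sum>r<N. cnj (x $ r) * ?v r) * y"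
      unfolding y_def sum_distrib_right by (simp add: sum_distrib_left mult_ac)
    also have "(\<Sum>r<N. cnj (x $ r) * ?v r) = cnj y" by (simp add: y_def mult.commute)
    finally have "conjugate x \<bullet> (polar_mat N q j k *\<^sub>v x) = of_real ((cmod y)\<^sup>2)"
      by (simp only: complex_norm_square mult.commute)
    then show ?thesis by simp
  qed
  then show ?thesis using h by (simp add: psd_def)
qed

lemma psd_smult:
  assumes A: "psd N A" and c: "c \<ge> 0"
  shows "psd N (of_real c \<cdot>\<^sub>m A)"
proof -
  have Ac: "A \<in> carrier_mat N N" using A by (simp add: psd_def hermitian_def)
  have "conjugate x \<bullet> ((of_real c \<cdot>\<^sub>m A) *\<^sub>v x) = of_real c * (conjugate x \<bullet> (A *\<^sub>v x))"
    if x: "x \<in> carrier_vec N" for x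
  proof -
    have "(of_real c \<cdot>\<^sub>m A) *\<^sub>v x = of_real c \<cdot>\<^sub>v (A *\<^sub>v x)"
      by (rule eq_vecI) (use Ac x in \<open>auto simp: row_smult smult_scalar_prod_distrib[of _ N]\<close>)
    then show ?thesis using x Ac by (simp add: scalar_prod_smult_distrib[of _ N])
  qed
  then show ?thesis using A c hermitian_smult unfolding psd_def by auto
qed

text \<open>A matrix unit of the total space is the tensor product of matrix units of the factors.
  Polarising every factor and multiplying out expands it in tensors of psd matrices, indexed by the
  maps \<kappa>.\<close>

lemma hermitian_psd_tensor_combination:
  assumes M: "hermitian (total_dim n d) M" and d: "\<And>i. i \<le> n \<Longrightarrow> 0 < d i"
  obtains m x \<rho> where "\<And>k i. k < m \<Longrightarrow> i \<le> n \<Longrightarrow> psd (d i) (\<rho> k i)"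
    "M = mat_sum (total_dim n d) (\<lambda>k. of_real (x k) \<cdot>\<^sub>m tensor n (\<rho> k)) {..<m::nat}"
proof -
  let ?D = "total_dim n d"
  have Mc: "M \<in> carrier_mat ?D ?D" and Mh: "adj M = M" using M by (auto simp: hermitian_def)
  define T where "T = {..<?D} \<times> {..<?D} \<times> ({..n} \<rightarrow>\<^sub>E {..<4::nat})"
  have finT: "finite T" unfolding T_def by (intro finite_cartesian_product finite_PiE) auto
  define R where "R \<tau> i = (case \<tau> of (a, b, \<kappa>) \<Rightarrow> polar_mat (d i) (\<kappa> i) (digit n d a i) (digit n d b i))"
    for \<tau> :: "nat \<times> nat \<times> (nat \<Rightarrow> nat)" and i
  define \<gamma> where "\<gamma> \<tau> = (case \<tau> of (a, b, \<kappa>) \<Rightarrow> M $$ (a, b) * (\<Prod>i\<le>n. \<i> ^ \<kappa> i / 4))"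
    for \<tau> :: "nat \<times> nat \<times> (nat \<Rightarrow> nat)"
  have Rp: "psd (d i) (R \<tau> i)" for \<tau> i unfolding R_def by (auto simp: psd_polar_mat split: prod.splits)
  have Rc: "R \<tau> i \<in> carrier_mat (d i) (d i)" for \<tau> i using Rp[of i \<tau>] by (simp add: psd_def hermitian_def)
  have Rh: "hermitian ?D (tensor n (R \<tau>))" for \<tau> using Rp d by (intro tensor_hermitian) (auto simp: psd_def)
  have entry: "M $$ (r, s) = (\<Sum>\<tau>\<in>T. \<gamma> \<tau> * tensor n (R \<tau>) $$ (r, s))" if rs: "r < ?D" "s < ?D" for r s
  proof -
    have E: "(\<Sum>\<kappa>\<in>{..n} \<rightarrow>\<^sub>E {..<4}. (\<Prod>i\<le>n. \<i> ^ \<kappa> i / 4) * tensor n (R (a, b, \<kappa>)) $$ (r, s)) = (if r = a \<and> s = b then 1 else 0)"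
      if ab: "a < ?D" "b < ?D" for a b
    proof -
      have "(\<Sum>\<kappa>\<in>{..n} \<rightarrow>\<^sub>E {..<4}. (\<Prod>i\<le>n. \<i> ^ \<kappa> i / 4) * tensor n (R (a, b, \<kappa>)) $$ (r, s))
        = (\<Sum>\<kappa>\<in>{..n} \<rightarrow>\<^sub>E {..<4}. (\<Prod>i\<le>n. \<i> ^ \<kappa> i / 4 * (polar_vec (\<kappa> i) (digit n d a i) (digit n d b i) (digit n d r i)
             * cnj (polar_vec (\<kappa> i) (digit n d a i) (digit n d b i) (digit n d s i)))))"
        unfolding tensor_entry[OF Rc rs] prod.distrib[symmetric] using d digit_less
        by (intro sum.cong prod.cong refl) (auto simp: R_def polar_mat_def)
      also have "\<dots> = (\<Prod>i\<le>n. \<Sum>q<4. \<i> ^ q / 4 * (polar_vec q (digit n d a i) (digit n d b i) (digit n d r i)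
             * cnj (polar_vec q (digit n d a i) (digit n d b i) (digit n d s i))))"
        by (rule prod_sum_PiE[symmetric]) auto
      also have "\<dots> = (\<Prod>i\<le>n. if digit n d r i = digit n d a i \<and> digit n d s i = digit n d b i then 1 else 0)"
        unfolding polar_decomposition ..
      also have "\<dots> = (if r = a \<and> s = b then 1 else 0)"
      proof (cases "r = a \<and> s = b")
        case False
        have "\<exists>i\<le>n. \<not> (digit n d r i = digit n d a i \<and> digit n d s i = digit n d b i)"
        proof (rule ccontr)
          assume "\<not> ?thesis"
          then have "\<And>i. i \<le> n \<Longrightarrow> digit n d r i = digit n d a i" "\<And>i. i \<le> n \<Longrightarrow> digit n d s i = digit n d b i" by auto
          then have "encode n d (digit n d r) = encode n d (digit n d a)" "encode n d (digit n d s) = encode n d (digit n d b)"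
            unfolding encode_def by auto
          then show False using False encode_digit rs ab by metis
        qed
        then show ?thesis using False by (subst prod_zero) auto
      qed simp
      finally show ?thesis .
    qed
    have "(\<Sum>\<tau>\<in>T. \<gamma> \<tau> * tensor n (R \<tau>) $$ (r, s)) = (\<Sum>a<?D. \<Sum>b<?D. M $$ (a, b) *
        (\<Sum>\<kappa>\<in>{..n} \<rightarrow>\<^sub>E {..<4}. (\<Prod>i\<le>n. \<i> ^ \<kappa> i / 4) * tensor n (R (a, b, \<kappa>)) $$ (r, s)))"
      unfolding T_def \<gamma>_def by (simp add: sum.cartesian_product sum_distrib_left mult.assoc split_def)
    also have "\<dots> = (\<Sum>a<?D. \<Sum>b<?D. M $$ (a, b) * (if r = a \<and> s = b then 1 else 0))"
      using E by (intro sum.cong refl) auto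
    also have "\<dots> = (\<Sum>a<?D. \<Sum>b<?D. if b = s then (if a = r then M $$ (r, s) else 0) else 0)"
      by (intro sum.cong refl) auto
    also have "\<dots> = M $$ (r, s)" using rs by simp
    finally show ?thesis ..
  qed
  \<comment> \<open>The coefficients \<gamma> are complex, but \<open>M\<close> and the tensors are
    Hermitian: the mean of the expansion and its adjoint has their real parts as
    coefficients.\<close>
  have real_entry: "M $$ (r, s) = (\<Sum>\<tau>\<in>T. of_real (Re (\<gamma> \<tau>)) * tensor n (R \<tau>) $$ (r, s))" if rs: "r < ?D" "s < ?D" for r s
  proof -
    have sw: "cnj (tensor n (R \<tau>) $$ (s, r)) = tensor n (R \<tau>) $$ (r, s)" for \<tau>
      using Rh[of \<tau>] rs unfolding hermitian_def by (metis index_adj carrier_matD)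
    have "M $$ (r, s) = cnj (M $$ (s, r))" using Mh Mc rs by (metis index_adj carrier_matD)
    also have "\<dots> = (\<Sum>\<tau>\<in>T. cnj (\<gamma> \<tau>) * tensor n (R \<tau>) $$ (r, s))"
      unfolding entry[OF rs(2,1)] by (simp add: sw)
    finally have "2 * M $$ (r, s) = (\<Sum>\<tau>\<in>T. (\<gamma> \<tau> + cnj (\<gamma> \<tau>)) * tensor n (R \<tau>) $$ (r, s))"
      using entry[OF rs] by (simp add: distrib_right sum.distrib)
    also have "\<dots> = 2 * (\<Sum>\<tau>\<in>T. of_real (Re (\<gamma> \<tau>)) * tensor n (R \<tau>) $$ (r, s))"
      by (simp add: complex_add_cnj sum_distrib_left mult.assoc)
    finally show ?thesis by simp
  qed
  obtain h where h: "bij_betw h {..<card T} T"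
    using ex_bij_betw_nat_finite[OF finT] by (auto simp: atLeast0LessThan)
  show ?thesis
  proof (rule that[of "card T" "\<lambda>k i. R (h k) i" "\<lambda>k. Re (\<gamma> (h k))"])
    show "M = mat_sum ?D (\<lambda>k. of_real (Re (\<gamma> (h k))) \<cdot>\<^sub>m tensor n (\<lambda>i. R (h k) i)) {..<card T}"
    proof (rule square_mat_eqI[of _ "?D"])
      fix r s assume rs: "r < ?D" "s < ?D"
      have "M $$ (r, s) = (\<Sum>k<card T. of_real (Re (\<gamma> (h k))) * tensor n (R (h k)) $$ (r, s))"
        unfolding real_entry[OF rs] by (rule sum.reindex_bij_betw[OF h, symmetric])
      then show "M $$ (r, s) = mat_sum ?D (\<lambda>k. of_real (Re (\<gamma> (h k))) \<cdot>\<^sub>m tensor n (\<lambda>i. R (h k) i)) {..<card T} $$ (r, s)"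
        using rs hermitian_carrier[OF Rh] by (simp add: index_smult_carrier[of _ ?D] del: index_smult_mat(1))
    qed (use Mc in auto)
  qed (use Rp in auto)
qed

section \<open>The convex body of the gauge\<close>

lemma P_setI:
  assumes \<rho>: "\<And>i. i \<le> n \<Longrightarrow> psd (d i) (\<rho> i)" and d: "\<And>i. i \<le> n \<Longrightarrow> 0 < d i"
    and p: "p > 0" and c: "\<bar>c\<bar> powr p * schatten_power p (tensor n \<rho>) \<le> 1"
  shows "of_real c \<cdot>\<^sub>m tensor n \<rho> \<in> P_set p n d"
proof -
  define s :: complex where "s = (if c \<ge> 0 then 1 else -1)"
  define \<rho>' where "\<rho>' = \<rho>(0 := of_real \<bar>c\<bar> \<cdot>\<^sub>m \<rho> 0)"
  have \<rho>c: "\<rho> i \<in> carrier_mat (d i) (d i)" if "i \<le> n" for i using \<rho>[OF that] by (simp add: psd_def hermitian_def)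
  have t: "tensor n \<rho>' = of_real \<bar>c\<bar> \<cdot>\<^sub>m tensor n \<rho>" unfolding \<rho>'_def by (rule tensor_smult[OF \<rho>c d])
  have h: "hermitian (total_dim n d) (tensor n \<rho>)" using \<rho> d by (intro tensor_hermitian) (auto simp: psd_def)
  have "schatten_norm p (tensor n \<rho>') \<le> 1"
    unfolding schatten_norm_power t schatten_power_smult[OF h]
    using c p schatten_power_nonneg by (intro powr_le1) auto
  moreover have "psd (d i) (\<rho>' i)" if "i \<le> n" for i using \<rho>[OF that] psd_smult unfolding \<rho>'_def by auto
  moreover have "of_real c \<cdot>\<^sub>m tensor n \<rho> = s \<cdot>\<^sub>m tensor n \<rho>'"
    unfolding t s_def by (auto intro!: eq_matI)
  moreover have "s = 1 \<or> s = -1" by (simp add: s_def)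
  ultimately show ?thesis unfolding P_set_def by blast
qed

text \<open>The set in \<open>mu\<close> must be nonempty for its infimum to be meaningful. The
  coefficients of a psd tensor expansion are rescaled to convex weights, with their signs moved into
  the tensors.\<close>

lemma B_set_absorbing:
  assumes M: "hermitian (total_dim n d) M" and d: "\<And>i. i \<le> n \<Longrightarrow> 0 < d i" and p: "p > 1"
  shows "\<exists>t>0. of_real (1 / t) \<cdot>\<^sub>m M \<in> B_set p n d"
proof -
  let ?D = "total_dim n d"
  obtain m x \<rho> where \<rho>: "\<And>k i. k < m \<Longrightarrow> i \<le> n \<Longrightarrow> psd (d i) (\<rho> k i)"
    and Meq: "M = mat_sum ?D (\<lambda>k. of_real (x k) \<cdot>\<^sub>m tensor n (\<rho> k)) {..<m::nat}"
    using hermitian_psd_tensor_combination[OF M d] by metis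
  have h: "hermitian ?D (tensor n (\<rho> k))" if "k < m" for k using \<rho> d that by (intro tensor_hermitian) (auto simp: psd_def)
  \<comment> \<open>At least 1 and above the p-th power of the norm; division by it moves the tensor
    into the unit ball, because (1 / \<nu>)^p \<le> 1 / \<nu>.\<close>
  define \<nu> where "\<nu> k = 1 + schatten_power p (tensor n (\<rho> k))" for k
  have nu: "\<nu> k \<ge> 1" for k using schatten_power_nonneg by (simp add: \<nu>_def)
  define t where "t = 1 + (\<Sum>k<m. \<bar>x k\<bar> * \<nu> k)"
  have sum_nn: "(\<Sum>k<m. \<bar>x k\<bar> * \<nu> k) \<ge> 0"
  proof (rule sum_nonneg)
    fix k show "0 \<le> \<bar>x k\<bar> * \<nu> k" using nu[of k] by simp
  qed
  then have t: "t > 0" by (simp add: t_def)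
  \<comment> \<open>The first m weights sum to 1 - 1 / t; the missing 1 / t goes to the extra index
    m, which carries the zero matrix.\<close>
  define c where "c k = (if k < m then \<bar>x k\<bar> * \<nu> k / t else 1 / t)" for k
  define A where "A k = (if k < m then of_real (sgn (x k) / \<nu> k) \<cdot>\<^sub>m tensor n (\<rho> k)
      else of_real 0 \<cdot>\<^sub>m tensor n (\<lambda>i. polar_mat (d i) 0 0 0))" for k
  have pt: "tensor n (\<lambda>i. polar_mat (d i) 0 0 0) \<in> carrier_mat ?D ?D"
    by (rule tensor_carrier) (simp add: polar_mat_def)
  have "A k \<in> P_set p n d" if "k < Suc m" for k
  proof (cases "k < m")
    case True
    have "\<bar>sgn (x k) / \<nu> k\<bar> \<le> 1 / \<nu> k" using nu[of k] by (auto simp: sgn_if)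
    then have "\<bar>sgn (x k) / \<nu> k\<bar> powr p \<le> (1 / \<nu> k) powr p" using p by (intro powr_mono2) auto
    also have "\<dots> \<le> (1 / \<nu> k) powr 1" using p nu[of k] by (intro powr_mono') auto
    finally have "\<bar>sgn (x k) / \<nu> k\<bar> powr p * schatten_power p (tensor n (\<rho> k)) \<le> 1 / \<nu> k * \<nu> k"
      using nu[of k] schatten_power_nonneg by (intro mult_mono) (auto simp: \<nu>_def)
    then have "\<bar>sgn (x k) / \<nu> k\<bar> powr p * schatten_power p (tensor n (\<rho> k)) \<le> 1" using nu[of k] by simp
    then show ?thesis unfolding A_def using True \<rho> d p by (simp del: of_real_divide) (intro P_setI, auto)
  next
    case False
    then show ?thesis unfolding A_def if_not_P[OF False] using psd_polar_mat d p by (intro P_setI) auto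
  qed
  moreover have "c k \<ge> 0" for k unfolding c_def using t nu[of k] by auto
  moreover have "(\<Sum>k<Suc m. c k) = 1"
  proof -
    have "(\<Sum>k<Suc m. c k) = (\<Sum>k<m. \<bar>x k\<bar> * \<nu> k) / t + 1 / t" by (simp add: c_def sum_divide_distrib)
    also have "\<dots> = ((\<Sum>k<m. \<bar>x k\<bar> * \<nu> k) + 1) / t" by (simp only: add_divide_distrib)
    also have "(\<Sum>k<m. \<bar>x k\<bar> * \<nu> k) + 1 = t" by (simp add: t_def)
    finally show ?thesis using t by simp
  qed
  moreover have "of_real (1 / t) \<cdot>\<^sub>m M = mat_sum ?D (\<lambda>k. of_real (c k) \<cdot>\<^sub>m A k) {..<Suc m}"
  proof (rule square_mat_eqI[of _ "?D"])
    fix r s assume rs: "r < ?D" "s < ?D"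
    have hk: "tensor n (\<rho> k) \<in> carrier_mat ?D ?D" if "k < m" for k using hermitian_carrier[OF h[OF that]] .
    have 1: "(of_real (c k) \<cdot>\<^sub>m A k) $$ (r, s) = of_real (x k / t) * tensor n (\<rho> k) $$ (r, s)" if k: "k < m" for k
    proof -
      have "(of_real (c k) \<cdot>\<^sub>m A k) $$ (r, s) = of_real (c k) * (of_real (sgn (x k) / \<nu> k) * tensor n (\<rho> k) $$ (r, s))"
        unfolding A_def if_P[OF k] using hk[OF k] rs by (simp add: index_smult_carrier[of _ ?D] del: index_smult_mat(1))
      also have "\<dots> = of_real (c k * (sgn (x k) / \<nu> k)) * tensor n (\<rho> k) $$ (r, s)" by simp
      also have "c k * (sgn (x k) / \<nu> k) = x k / t"
        using nu[of k] k by (simp add: c_def) (metis abs_mult_sgn mult.commute)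
      finally show ?thesis .
    qed
    have 2: "(of_real (c m) \<cdot>\<^sub>m A m) $$ (r, s) = 0"
      unfolding A_def using pt rs by simp
    have 3: "(of_real (x k) \<cdot>\<^sub>m tensor n (\<rho> k)) $$ (r, s) = of_real (x k) * tensor n (\<rho> k) $$ (r, s)" if "k < m" for k
      using hk[OF that] rs by (rule index_smult_carrier)
    have "(of_real (1 / t) \<cdot>\<^sub>m M) $$ (r, s) = of_real (1 / t) * M $$ (r, s)"
      using hermitian_carrier[OF M] rs by (rule index_smult_carrier)
    also have "M $$ (r, s) = (\<Sum>k<m. of_real (x k) * tensor n (\<rho> k) $$ (r, s))"
      unfolding Meq using rs 3 by (simp del: index_smult_mat(1))
    also have "of_real (1 / t) * \<dots> = (\<Sum>k<m. of_real (x k / t) * tensor n (\<rho> k) $$ (r, s))"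
      by (simp add: sum_distrib_left)
    also have "\<dots> = mat_sum ?D (\<lambda>k. of_real (c k) \<cdot>\<^sub>m A k) {..<Suc m} $$ (r, s)"
      using rs 1 2 by (simp del: index_smult_mat(1))
    finally show "(of_real (1 / t) \<cdot>\<^sub>m M) $$ (r, s) = mat_sum ?D (\<lambda>k. of_real (c k) \<cdot>\<^sub>m A k) {..<Suc m} $$ (r, s)" .
  qed (use hermitian_carrier[OF M] in auto)
  ultimately have "of_real (1 / t) \<cdot>\<^sub>m M \<in> B_set p n d"
    unfolding B_set_def conv_mat_def by blast
  then show ?thesis using t by blast
qed

section \<open>Decompositions of symmetrised sums of elementary tensors\<close>

locale free_wsc = group G for G :: "('g, 'b) monoid_scheme" (structure) +
  fixes n :: nat and \<Omega> :: "nat set \<Rightarrow> nat"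
    and \<phi> :: "'g \<Rightarrow> nat \<Rightarrow> nat" and \<psi> :: "'g \<Rightarrow> nat set \<times> nat \<Rightarrow> nat set \<times> nat"
    and d :: "nat \<Rightarrow> nat"
  assumes finite_group: "finite (carrier G)"
    and wsc: "wsc n \<Omega>" and connected: "wsc_connected n \<Omega>"
    and free_action: "free_wsc_action G n \<Omega> \<phi> \<psi>"
    and d_pos: "\<And>i. i \<le> n \<Longrightarrow> 0 < d i"
    and d_inv: "\<And>g i. g \<in> carrier G \<Longrightarrow> i \<le> n \<Longrightarrow> d (\<phi> g i) = d i"
begin

lemma vertex_action: "group_action G {0..n} \<phi>" and facet_action: "group_action G (Ftilde n \<Omega>) \<psi>"
  using free_action by (auto simp: free_wsc_action_def wsc_action_def)

lemma fst_facet_action: "g \<in> carrier G \<Longrightarrow> x \<in> Ftilde n \<Omega> \<Longrightarrow> fst (\<psi> g x) = \<phi> g ` fst x"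
  using free_action by (auto simp: free_wsc_action_def wsc_action_def)

lemma facet_action_free: "g \<in> carrier G \<Longrightarrow> x \<in> Ftilde n \<Omega> \<Longrightarrow> \<psi> g x = x \<Longrightarrow> g = \<one>"
  using free_action by (auto simp: free_wsc_action_def)

lemma phi_le: "g \<in> carrier G \<Longrightarrow> i \<le> n \<Longrightarrow> \<phi> g i \<le> n"
  using group_action.element_image[OF vertex_action, of g i] by auto

lemma phi_mult: "g \<in> carrier G \<Longrightarrow> h \<in> carrier G \<Longrightarrow> i \<le> n \<Longrightarrow> \<phi> (g \<otimes> h) i = \<phi> g (\<phi> h i)"
  using group_action.composition_rule[OF vertex_action, of i g h] by auto

lemma phi_one: "i \<le> n \<Longrightarrow> \<phi> \<one> i = i"
  by (subst group_action.id_eq_one[OF vertex_action, symmetric]) simp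

lemma phi_inv: "g \<in> carrier G \<Longrightarrow> i \<le> n \<Longrightarrow> \<phi> (inv g) (\<phi> g i) = i"
  using phi_mult[of "inv g" g i] by (simp add: phi_one)

lemma phi_inv': "g \<in> carrier G \<Longrightarrow> i \<le> n \<Longrightarrow> \<phi> g (\<phi> (inv g) i) = i"
  using phi_mult[of g "inv g" i] by (simp add: phi_one)

lemma phi_bij: "g \<in> carrier G \<Longrightarrow> bij_betw (\<phi> g) {..n} {..n}"
  by (rule bij_betwI[where g = "\<phi> (inv g)"]) (auto simp: phi_le phi_inv phi_inv')

lemma psi_closed: "g \<in> carrier G \<Longrightarrow> x \<in> Ftilde n \<Omega> \<Longrightarrow> \<psi> g x \<in> Ftilde n \<Omega>"
  using group_action.element_image[OF facet_action, of g x] by auto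

lemma psi_mult: "g \<in> carrier G \<Longrightarrow> h \<in> carrier G \<Longrightarrow> x \<in> Ftilde n \<Omega> \<Longrightarrow> \<psi> (g \<otimes> h) x = \<psi> g (\<psi> h x)"
  using group_action.composition_rule[OF facet_action, of x g h] by auto

lemma psi_one: "x \<in> Ftilde n \<Omega> \<Longrightarrow> \<psi> \<one> x = x"
  by (subst group_action.id_eq_one[OF facet_action, symmetric]) simp

lemma psi_inj_group:
  assumes "g \<in> carrier G" "h \<in> carrier G" "x \<in> Ftilde n \<Omega>" "\<psi> g x = \<psi> h x"
  shows "g = h"
proof -
  have "\<psi> (inv h \<otimes> g) x = x"
    using assms by (metis psi_mult psi_one inv_closed l_inv)
  then have "inv h \<otimes> g = \<one>" using facet_action_free assms by simp
  then show ?thesis using assms by (metis inv_equality inv_inv inv_closed)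
qed

text \<open>A representative is fixed in each orbit, and \<open>z x\<close> is the group element
  carrying it to x. Freeness makes this element unique, and uniqueness gives equivariance.\<close>

lemma equivariant_map_exists:
  obtains z where "\<And>x. x \<in> Ftilde n \<Omega> \<Longrightarrow> z x \<in> carrier G"
    "\<And>g x. g \<in> carrier G \<Longrightarrow> x \<in> Ftilde n \<Omega> \<Longrightarrow> z (\<psi> g x) = g \<otimes> z x"
proof -
  define orb where "orb x = {\<psi> g x | g. g \<in> carrier G}" for x
  define rep where "rep x = (SOME y. y \<in> orb x)" for x
  define z where "z x = (SOME g. g \<in> carrier G \<and> \<psi> g (rep x) = x)" for x
  have rep_orb: "rep x \<in> orb x" if "x \<in> Ftilde n \<Omega>" for x
  proof -
    have "\<psi> \<one> x \<in> orb x" unfolding orb_def by blast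
    then show ?thesis unfolding rep_def by (rule someI)
  qed
  have orb_eq: "orb (\<psi> g x) = orb x" if g: "g \<in> carrier G" and x: "x \<in> Ftilde n \<Omega>" for g x
  proof
    show "orb (\<psi> g x) \<subseteq> orb x"
    proof
      fix y assume "y \<in> orb (\<psi> g x)"
      then obtain h where "h \<in> carrier G" "y = \<psi> h (\<psi> g x)" by (auto simp: orb_def)
      then have "y = \<psi> (h \<otimes> g) x" "h \<otimes> g \<in> carrier G" using g x psi_mult by auto
      then show "y \<in> orb x" unfolding orb_def by blast
    qed
    show "orb x \<subseteq> orb (\<psi> g x)"
    proof
      fix y assume "y \<in> orb x"
      then obtain h where h: "h \<in> carrier G" "y = \<psi> h x" by (auto simp: orb_def)
      have "\<psi> (h \<otimes> inv g) (\<psi> g x) = \<psi> (h \<otimes> inv g \<otimes> g) x" using g h x by (intro psi_mult[symmetric]) auto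
      also have "h \<otimes> inv g \<otimes> g = h" using g h by (simp add: m_assoc)
      finally have "y = \<psi> (h \<otimes> inv g) (\<psi> g x)" using h by simp
      then show "y \<in> orb (\<psi> g x)" unfolding orb_def using g h by blast
    qed
  qed
  have z: "z x \<in> carrier G \<and> \<psi> (z x) (rep x) = x" if x: "x \<in> Ftilde n \<Omega>" for x
    unfolding z_def
  proof (rule someI_ex)
    obtain g where g: "g \<in> carrier G" "rep x = \<psi> g x" using rep_orb[OF x] by (auto simp: orb_def)
    then have "\<psi> (inv g) (rep x) = x" using x by (metis psi_mult psi_one inv_closed l_inv)
    then show "\<exists>g. g \<in> carrier G \<and> \<psi> g (rep x) = x" using g by blast
  qed
  have rep_in: "rep x \<in> Ftilde n \<Omega>" if x: "x \<in> Ftilde n \<Omega>" for x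
  proof -
    obtain g where "g \<in> carrier G" "rep x = \<psi> g x" using rep_orb[OF x] by (auto simp: orb_def)
    then show ?thesis using psi_closed x by simp
  qed
  show ?thesis
  proof (rule that)
    show "z x \<in> carrier G" if "x \<in> Ftilde n \<Omega>" for x using z[OF that] by simp
    fix g x assume g: "g \<in> carrier G" and x: "x \<in> Ftilde n \<Omega>"
    \<comment> \<open>\<open>rep\<close> is chosen from the orbit as a set, hence agrees on all
      points of an orbit.\<close>
    have r: "rep (\<psi> g x) = rep x" unfolding rep_def orb_eq[OF g x] ..
    have "\<psi> (z (\<psi> g x)) (rep x) = \<psi> g x" using z[OF psi_closed[OF g x]] r by simp
    also have "\<dots> = \<psi> (g \<otimes> z x) (rep x)" using z[OF x] g rep_in[OF x] by (simp add: psi_mult)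
    finally show "z (\<psi> g x) = g \<otimes> z x"
      using z[OF x] z[OF psi_closed[OF g x]] g rep_in[OF x] by (intro psi_inj_group) auto
  qed
qed

section \<open>Vertices and facets of the complex\<close>

lemma finite_facets: "finite (facets n \<Omega>)"
  by (rule finite_subset[of _ "Pow {0..n}"]) (auto simp: facets_def simplex_def)

lemma finite_Ftilde: "finite (Ftilde n \<Omega>)"
proof -
  have "Ftilde n \<Omega> = Sigma (facets n \<Omega>) (\<lambda>F. {..<\<Omega> F})" by (auto simp: Ftilde_def)
  then show ?thesis using finite_facets by auto
qed

lemma vertex_in_facet:
  assumes "i \<le> n"
  obtains F where "F \<in> facets n \<Omega>" "i \<in> F"
proof -
  let ?A = "{S. simplex n \<Omega> S \<and> i \<in> S}"
  have fin: "finite ?A" by (rule finite_subset[of _ "Pow {0..n}"]) (auto simp: simplex_def)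
  have "{i} \<in> ?A" using wsc assms by (auto simp: simplex_def wsc_def)
  then obtain F where F: "F \<in> ?A" "\<forall>S\<in>?A. F \<subseteq> S \<longrightarrow> F = S"
    using finite_has_maximal[OF fin] by auto
  then have "F \<in> facets n \<Omega>" unfolding facets_def by blast
  then show ?thesis using that F by auto
qed

lemma facet_in_Ftilde: "F \<in> facets n \<Omega> \<Longrightarrow> (F, 0) \<in> Ftilde n \<Omega>"
  by (auto simp: Ftilde_def facets_def simplex_def)

lemma Ftilde_nonempty_facet:
  assumes "x \<in> Ftilde n \<Omega>"
  obtains i where "i \<le> n" "i \<in> fst x"
proof -
  have F: "fst x \<in> facets n \<Omega>" using assms by (auto simp: Ftilde_def)
  have "fst x \<noteq> {}"
  proof
    assume "fst x = {}"
    moreover have "simplex n \<Omega> {0}" using wsc by (auto simp: simplex_def wsc_def)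
    ultimately show False using F by (auto simp: facets_def)
  qed
  then obtain i where "i \<in> fst x" by blast
  moreover have "fst x \<subseteq> {0..n}" using F by (auto simp: facets_def simplex_def)
  ultimately show ?thesis by (intro that[of i]) auto
qed

lemma Ftilde_at_nonempty:
  assumes "i \<le> n"
  obtains x where "x \<in> Ftilde_at n \<Omega> i"
proof -
  obtain F where "F \<in> facets n \<Omega>" "i \<in> F" using vertex_in_facet[OF assms] .
  then have "(F, 0) \<in> Ftilde_at n \<Omega> i" using facet_in_Ftilde by (simp add: Ftilde_at_def)
  then show ?thesis by (rule that)
qed

lemma Ftilde_at_sub: "x \<in> Ftilde_at n \<Omega> i \<Longrightarrow> x \<in> Ftilde n \<Omega>"
  by (simp add: Ftilde_at_def)

lemma psi_Ftilde_at: "g \<in> carrier G \<Longrightarrow> x \<in> Ftilde_at n \<Omega> i \<Longrightarrow> \<psi> g x \<in> Ftilde_at n \<Omega> (\<phi> g i)"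
  by (auto simp: Ftilde_at_def psi_closed fst_facet_action)

text \<open>A pair (j, h) is written on facet F as the code of
  \<open>(j, inv (z F) \<otimes> h)\<close>. Equivariance of z turns the action of g on labels into
  the replacement of h by g h, and \<open>T j (\<phi> (inv h) i)\<close> is unchanged if h and i are
  both moved by g. Local labels not arising from a pair get the zero vector, so only the global
  labellings of pairs contribute.\<close>

theorem symmetrised_tensors_has_decomp:
  assumes T: "\<And>j i. j < k \<Longrightarrow> i \<le> n \<Longrightarrow> T j i \<in> carrier_mat (d i) (d i)"
  shows "has_decomp G n \<Omega> \<phi> \<psi> d
    (mat_sum (total_dim n d) (\<lambda>(j, h). tensor n (\<lambda>i. T j (\<phi> h i))) ({..<k} \<times> carrier G)) (k * card (carrier G))"
proof -
  let ?r = "k * card (carrier G)" and ?D = "total_dim n d" and ?F = "Ftilde n \<Omega>" and ?at = "Ftilde_at n \<Omega>"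
  let ?J = "{..<k} \<times> carrier G"
  obtain z where z: "\<And>x. x \<in> ?F \<Longrightarrow> z x \<in> carrier G"
    and zg: "\<And>g x. g \<in> carrier G \<Longrightarrow> x \<in> ?F \<Longrightarrow> z (\<psi> g x) = g \<otimes> z x"
    using equivariant_map_exists by metis
  have finJ: "finite ?J" using finite_group by simp
  obtain code where code: "bij_betw code ?J {..<?r}"
    using finite_same_card_bij[OF finJ, of "{..<?r}"] by (auto simp: card_cartesian_product)
  have code_inj: "inj_on code ?J" and code_lt: "\<And>x. x \<in> ?J \<Longrightarrow> code x < ?r"
    using code by (auto simp: bij_betw_def)
  define al where "al x = (\<lambda>F\<in>?F. code (fst x, inv (z F) \<otimes> snd x))" for x
  define lc where "lc i x = restrict (al x) (?at i)" for i x
  have lc_apply: "lc i x F = code (fst x, inv (z F) \<otimes> snd x)" if "F \<in> ?at i" for i x F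
    using that Ftilde_at_sub by (auto simp: lc_def al_def)
  \<comment> \<open>One facet common to i and j suffices to recover the pair from its label.\<close>
  have lc_inj_at: "x = y" if x: "x \<in> ?J" and y: "y \<in> ?J" and F: "F \<in> ?at i" "F \<in> ?at j" and eq: "lc i x F = lc j y F" for x y F i j
  proof -
    have zF: "z F \<in> carrier G" using z F Ftilde_at_sub by blast
    have "code (fst x, inv (z F) \<otimes> snd x) = code (fst y, inv (z F) \<otimes> snd y)" using eq lc_apply F by simp
    then have "(fst x, inv (z F) \<otimes> snd x) = (fst y, inv (z F) \<otimes> snd y)"
      using x y zF by (intro inj_onD[OF code_inj]) auto
    then show ?thesis using x y zF by (auto simp: prod_eq_iff)
  qed
  have lc_inj: "x = y" if i: "i \<le> n" and x: "x \<in> ?J" and y: "y \<in> ?J" and eq: "lc i x = lc i y" for i x y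
  proof -
    obtain F where "F \<in> ?at i" using Ftilde_at_nonempty[OF i] .
    then show ?thesis using lc_inj_at[OF x y, of F i i] eq by simp
  qed
  define v where "v i \<beta> = (if \<exists>x\<in>?J. \<beta> = lc i x
      then (let x = (THE x. x \<in> ?J \<and> \<beta> = lc i x) in T (fst x) (\<phi> (inv (snd x)) i)) else 0\<^sub>m (d i) (d i))" for i \<beta>
  have v_lc: "v i (lc i x) = T (fst x) (\<phi> (inv (snd x)) i)" if i: "i \<le> n" and x: "x \<in> ?J" for i x
  proof -
    have the: "(THE y. y \<in> ?J \<and> lc i x = lc i y) = x"
    proof (rule the_equality)
      show "y = x" if "y \<in> ?J \<and> lc i x = lc i y" for y using lc_inj[OF i x, of y] that by simp
    qed (use x in simp)
    have ex: "\<exists>y\<in>?J. lc i x = lc i y" using x by blast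
    show ?thesis unfolding v_def if_P[OF ex] the Let_def ..
  qed
  have v_zero: "v i \<beta> = 0\<^sub>m (d i) (d i)" if "\<not> (\<exists>x\<in>?J. \<beta> = lc i x)" for i \<beta>
    using that unfolding v_def by (rule if_not_P)
  have T_c: "T (fst x) (\<phi> (inv (snd x)) i) \<in> carrier_mat (d i) (d i)" if i: "i \<le> n" and x: "x \<in> ?J" for i x
    using T[of "fst x" "\<phi> (inv (snd x)) i"] i x by (auto simp: phi_le d_inv)
  have v_c: "v i \<beta> \<in> carrier_mat (d i) (d i)" if "i \<le> n" for i \<beta>
  proof (cases "\<exists>x\<in>?J. \<beta> = lc i x")
    case True
    then show ?thesis using v_lc[OF that] T_c[OF that] by auto
  qed (simp add: v_zero)
  have tw: "twist G n \<Omega> \<phi> \<psi> g i (lc i x) = lc (\<phi> g i) (fst x, g \<otimes> snd x)"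
    if g: "g \<in> carrier G" and i: "i \<le> n" and x: "x \<in> ?J" for g i x
  proof
    fix F
    show "twist G n \<Omega> \<phi> \<psi> g i (lc i x) F = lc (\<phi> g i) (fst x, g \<otimes> snd x) F"
    proof (cases "F \<in> ?at (\<phi> g i)")
      case True
      then have F: "F \<in> ?F" by (rule Ftilde_at_sub)
      have "\<psi> (inv g) F \<in> ?at i" using psi_Ftilde_at[OF inv_closed[OF g] True] phi_inv[OF g i] by simp
      then have "twist G n \<Omega> \<phi> \<psi> g i (lc i x) F = code (fst x, inv (inv g \<otimes> z F) \<otimes> snd x)"
        using True F g by (simp add: twist_def lc_apply zg)
      also have "inv (inv g \<otimes> z F) \<otimes> snd x = inv (z F) \<otimes> (g \<otimes> snd x)"
        using g x z[OF F] by (simp add: inv_mult_group m_assoc mem_Times_iff)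
      finally show ?thesis using lc_apply[OF True] by simp
    qed (simp add: twist_def lc_def)
  qed
  \<comment> \<open>Invertibility of the twist is needed for labels that come from no pair: their
    twists must come from no pair either.\<close>
  have untwist: "twist G n \<Omega> \<phi> \<psi> (inv g) (\<phi> g i) (twist G n \<Omega> \<phi> \<psi> g i \<beta>) = \<beta>"
    if g: "g \<in> carrier G" and i: "i \<le> n" and \<beta>: "\<beta> \<in> ?at i \<rightarrow>\<^sub>E {..<?r}" for g i \<beta>
  proof
    fix F
    show "twist G n \<Omega> \<phi> \<psi> (inv g) (\<phi> g i) (twist G n \<Omega> \<phi> \<psi> g i \<beta>) F = \<beta> F"
    proof (cases "F \<in> ?at i")
      case True
      then have F: "F \<in> ?F" by (rule Ftilde_at_sub)
      have "\<psi> g F \<in> ?at (\<phi> g i)" using psi_Ftilde_at[OF g True] .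
      moreover have "\<psi> (inv g) (\<psi> g F) = F" using g F by (metis psi_mult psi_one inv_closed l_inv)
      ultimately show ?thesis using True g by (simp add: twist_def phi_inv[OF g i])
    next
      case False
      then show ?thesis using PiE_arb[OF \<beta> False] by (simp add: twist_def phi_inv[OF g i])
    qed
  qed
  have sym: "v i \<beta> = v (\<phi> g i) (twist G n \<Omega> \<phi> \<psi> g i \<beta>)"
    if i: "i \<le> n" and g: "g \<in> carrier G" and \<beta>: "\<beta> \<in> ?at i \<rightarrow>\<^sub>E {..<?r}" for i g \<beta>
  proof (cases "\<exists>x\<in>?J. \<beta> = lc i x")
    case True
    then obtain x where x: "x \<in> ?J" "\<beta> = lc i x" by blast
    have x2: "snd x \<in> carrier G" using x(1) by auto
    have gx: "(fst x, g \<otimes> snd x) \<in> ?J" using x(1) x2 g by (simp add: mem_Times_iff)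
    have "\<phi> (inv (g \<otimes> snd x)) (\<phi> g i) = \<phi> (inv (snd x)) i"
    proof -
      have "\<phi> (inv (g \<otimes> snd x)) (\<phi> g i) = \<phi> (inv (snd x) \<otimes> inv g) (\<phi> g i)"
        using g x2 by (simp add: inv_mult_group)
      also have "\<dots> = \<phi> (inv (snd x)) (\<phi> (inv g) (\<phi> g i))" using g x2 i by (intro phi_mult) (auto simp: phi_le)
      finally show ?thesis by (simp add: phi_inv[OF g i])
    qed
    then show ?thesis
      unfolding x(2) tw[OF g i x(1)] v_lc[OF i x(1)] v_lc[OF phi_le[OF g i] gx] by simp
  next
    case False
    have "\<not> (\<exists>x\<in>?J. twist G n \<Omega> \<phi> \<psi> g i \<beta> = lc (\<phi> g i) x)"
    proof
      assume "\<exists>x\<in>?J. twist G n \<Omega> \<phi> \<psi> g i \<beta> = lc (\<phi> g i) x"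
      then obtain x where x: "x \<in> ?J" "twist G n \<Omega> \<phi> \<psi> g i \<beta> = lc (\<phi> g i) x" by blast
      have "\<beta> = lc (\<phi> (inv g) (\<phi> g i)) (fst x, inv g \<otimes> snd x)"
        using untwist[OF g i \<beta>] tw[OF inv_closed[OF g] phi_le[OF g i] x(1)] unfolding x(2) by simp
      then have "\<beta> = lc i (fst x, inv g \<otimes> snd x)" by (simp add: phi_inv[OF g i])
      moreover have "(fst x, inv g \<otimes> snd x) \<in> ?J" using x(1) g by (simp add: mem_Times_iff)
      ultimately show False using False by blast
    qed
    then show ?thesis using v_zero[OF False] v_zero by (simp add: d_inv[OF g i])
  qed
  \<comment> \<open>Neighbours share a facet and hence the pair; connectedness makes the pair the
    same at all vertices. Every facet has a vertex, so \<alpha> is determined everywhere.\<close>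
  have glue: "\<exists>x\<in>?J. \<alpha> = al x" if \<alpha>: "\<alpha> \<in> ?F \<rightarrow>\<^sub>E {..<?r}" and loc: "\<And>i. i \<le> n \<Longrightarrow> \<exists>x\<in>?J. restrict \<alpha> (?at i) = lc i x" for \<alpha>
  proof -
    obtain X where X: "\<And>i. i \<le> n \<Longrightarrow> X i \<in> ?J" "\<And>i. i \<le> n \<Longrightarrow> restrict \<alpha> (?at i) = lc i (X i)"
      using loc by metis
    have step: "X i = X j \<and> j \<le> n" if nb: "neighbours n \<Omega> i j" and i: "i \<le> n" for i j
    proof -
      obtain F where F: "F \<in> facets n \<Omega>" "i \<in> F" "j \<in> F" using nb by (auto simp: neighbours_def)
      have j: "j \<le> n" using F by (auto simp: facets_def simplex_def)
      have at: "(F, 0) \<in> ?at i" "(F, 0) \<in> ?at j" using F facet_in_Ftilde by (auto simp: Ftilde_at_def)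
      have "lc i (X i) (F, 0) = lc j (X j) (F, 0)" using X(2)[OF i] X(2)[OF j] at by (metis restrict_apply)
      then show ?thesis using lc_inj_at[OF X(1)[OF i] X(1)[OF j] at] j by blast
    qed
    have const: "X i = X 0" if i: "i \<le> n" for i
    proof -
      have "(neighbours n \<Omega>)\<^sup>*\<^sup>* 0 i" using connected i by (auto simp: wsc_connected_def)
      then have "X i = X 0 \<and> i \<le> n"
        by (induction rule: rtranclp_induct) (use step in auto)
      then show ?thesis by simp
    qed
    have "\<alpha> = al (X 0)"
    proof
      fix F
      show "\<alpha> F = al (X 0) F"
      proof (cases "F \<in> ?F")
        case True
        then obtain i where i: "i \<le> n" "i \<in> fst F" using Ftilde_nonempty_facet by blast
        then have at: "F \<in> ?at i" using True by (simp add: Ftilde_at_def)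
        have "\<alpha> F = lc i (X 0) F" using X(2)[OF i(1)] const[OF i(1)] at by (metis restrict_apply)
        then show ?thesis using at by (simp add: lc_def)
      next
        case False
        then show ?thesis using PiE_arb[OF \<alpha> False] by (simp add: al_def)
      qed
    qed
    then show ?thesis using X(1)[of 0] by (intro bexI[of _ "X 0"]) simp_all
  qed
  have al_PiE: "al x \<in> ?F \<rightarrow>\<^sub>E {..<?r}" if "x \<in> ?J" for x
    unfolding al_def
  proof (rule restrict_PiE_iff[THEN iffD2], rule ballI)
    fix F assume "F \<in> ?F"
    then have "(fst x, inv (z F) \<otimes> snd x) \<in> ?J" using that z by (simp add: mem_Times_iff)
    then show "code (fst x, inv (z F) \<otimes> snd x) \<in> {..<?r}" using code_lt by blast
  qed
  have al_inj: "inj_on al ?J"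
  proof (rule inj_onI)
    fix x y assume "x \<in> ?J" "y \<in> ?J" "al x = al y"
    then show "x = y" using lc_inj[of 0 x y] by (simp add: lc_def)
  qed
  have finA: "finite (?F \<rightarrow>\<^sub>E {..<?r})" using finite_Ftilde by (intro finite_PiE) auto
  let ?N = "mat_sum ?D (\<lambda>(j, h). tensor n (\<lambda>i. T j (\<phi> h i))) ?J"
  have N: "?N = mat_sum ?D (\<lambda>\<alpha>. tensor n (\<lambda>i. v i (restrict \<alpha> (?at i)))) (?F \<rightarrow>\<^sub>E {..<?r})"
  proof (rule square_mat_eqI[of _ "?D"])
    fix a b assume ab: "a < ?D" "b < ?D"
    define S where "S \<alpha> = tensor n (\<lambda>i. v i (restrict \<alpha> (?at i))) $$ (a, b)" for \<alpha>
    have S_prod: "S \<alpha> = (\<Prod>i\<le>n. v i (restrict \<alpha> (?at i)) $$ (digit n d a i, digit n d b i))" for \<alpha>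
      unfolding S_def using v_c ab by (intro tensor_entry) auto
    \<comment> \<open>Outside the image of \<open>al\<close> some vertex sees a label of no pair,
      and its zero vector annihilates the whole tensor.\<close>
    have "S \<alpha> = 0" if \<alpha>: "\<alpha> \<in> (?F \<rightarrow>\<^sub>E {..<?r}) - al ` ?J" for \<alpha>
    proof -
      obtain i where i: "i \<le> n" "\<not> (\<exists>x\<in>?J. restrict \<alpha> (?at i) = lc i x)" using glue[of \<alpha>] \<alpha> by blast
      have "v i (restrict \<alpha> (?at i)) $$ (digit n d a i, digit n d b i) = 0"
        unfolding v_zero[OF i(2)] using digit_less[of d i n] d_pos[OF i(1)] by simp
      then show ?thesis unfolding S_prod using i(1) by (intro prod_zero) auto
    qed
    then have "(\<Sum>\<alpha>\<in>?F \<rightarrow>\<^sub>E {..<?r}. S \<alpha>) = (\<Sum>\<alpha>\<in>al ` ?J. S \<alpha>)"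
      using al_PiE finA by (intro sum.mono_neutral_right) (simp_all add: image_subset_iff)
    also have "\<dots> = (\<Sum>x\<in>?J. S (al x))" using al_inj by (simp add: sum.reindex)
    also have "\<dots> = (\<Sum>x\<in>?J. tensor n (\<lambda>i. T (fst x) (\<phi> (inv (snd x)) i)) $$ (a, b))"
    proof (rule sum.cong[OF refl])
      fix x assume x: "x \<in> ?J"
      have "S (al x) = (\<Prod>i\<le>n. T (fst x) (\<phi> (inv (snd x)) i) $$ (digit n d a i, digit n d b i))"
        unfolding S_prod using v_lc[OF _ x] by (intro prod.cong) (simp_all add: lc_def)
      also have "\<dots> = tensor n (\<lambda>i. T (fst x) (\<phi> (inv (snd x)) i)) $$ (a, b)"
        using T_c[OF _ x] ab by (intro tensor_entry[symmetric])
      finally show "S (al x) = tensor n (\<lambda>i. T (fst x) (\<phi> (inv (snd x)) i)) $$ (a, b)" .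
    qed
    \<comment> \<open>Inversion permutes the group, so \<open>inv h\<close> may be replaced by h in
      the sum.\<close>
    also have "\<dots> = (\<Sum>x\<in>?J. tensor n (\<lambda>i. T (fst x) (\<phi> (snd x) i)) $$ (a, b))"
    proof (rule sum.reindex_bij_witness[where i = "\<lambda>x. (fst x, inv (snd x))" and j = "\<lambda>x. (fst x, inv (snd x))"])
    qed auto
    finally show "?N $$ (a, b) = mat_sum ?D (\<lambda>\<alpha>. tensor n (\<lambda>i. v i (restrict \<alpha> (?at i)))) (?F \<rightarrow>\<^sub>E {..<?r}) $$ (a, b)"
      using ab unfolding S_def by (simp add: split_def)
  qed auto
  show ?thesis unfolding has_decomp_def
  proof (intro exI[of _ v] conjI allI impI ballI)
    show "v i \<beta> \<in> carrier_mat (d i) (d i)" if "i \<le> n" for i \<beta> using v_c[OF that] .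
    show "v i \<beta> = v (\<phi> g i) (twist G n \<Omega> \<phi> \<psi> g i \<beta>)"
      if "i \<le> n" "g \<in> carrier G" "\<beta> \<in> ?at i \<rightarrow>\<^sub>E {..<?r}" for i g \<beta> using sym[OF that] .
  qed (rule N)
qed

section \<open>Symmetrisation\<close>

text \<open>Turns the action on tensors into a permutation of flat indices, to which
  \<open>schatten_power_reindex\<close> applies.\<close>

definition perm_index :: "'g \<Rightarrow> nat \<Rightarrow> nat" where
  "perm_index g a = encode n d (\<lambda>j. digit n d a (\<phi> (inv g) j))"

lemma perm_act_index: "perm_act G \<phi> n d g M = mat (total_dim n d) (total_dim n d) (\<lambda>(a, b). M $$ (perm_index g a, perm_index g b))"
  unfolding perm_act_def perm_index_def ..

lemma perm_index_digits:
  assumes g: "g \<in> carrier G" and i: "i \<le> n"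
  shows "digit n d a (\<phi> (inv g) i) < d i" "digit n d (perm_index g a) i = digit n d a (\<phi> (inv g) i)"
proof -
  have lt: "digit n d a (\<phi> (inv g) j) < d j" if "j \<le> n" for j
    using digit_less[of d "\<phi> (inv g) j" n a] d_pos[OF phi_le[OF inv_closed[OF g] that]] d_inv[OF inv_closed[OF g] that] by simp
  then show "digit n d a (\<phi> (inv g) i) < d i" using i by blast
  show "digit n d (perm_index g a) i = digit n d a (\<phi> (inv g) i)"
    unfolding perm_index_def using lt i by (intro digit_encode)
qed

lemma perm_index_less:
  assumes "g \<in> carrier G"
  shows "perm_index g a < total_dim n d"
proof -
  have "encode n d (\<lambda>j. digit n d a (\<phi> (inv g) j)) < total_dim n d"
    by (rule encode_less, rule perm_index_digits(1)[OF assms])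
  then show ?thesis unfolding perm_index_def .
qed

lemma perm_index_bij:
  assumes g: "g \<in> carrier G"
  shows "bij_betw (perm_index g) {..<total_dim n d} {..<total_dim n d}"
proof -
  have "inj_on (perm_index g) {..<total_dim n d}"
  proof (rule inj_onI)
    fix a b assume ab: "a \<in> {..<total_dim n d}" "b \<in> {..<total_dim n d}" and eq: "perm_index g a = perm_index g b"
    have "digit n d a i = digit n d b i" if i: "i \<le> n" for i
      using perm_index_digits(2)[OF g phi_le[OF g i]] eq phi_inv[OF g i] by metis
    then have "encode n d (digit n d a) = encode n d (digit n d b)" by (simp add: encode_def)
    then show "a = b" using ab encode_digit by auto
  qed
  moreover have "perm_index g ` {..<total_dim n d} \<subseteq> {..<total_dim n d}" using perm_index_less[OF g] by auto
  ultimately show ?thesis by (simp add: bij_betw_def endo_inj_surj)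
qed

lemma perm_act_tensor:
  assumes g: "g \<in> carrier G" and f: "\<And>i. i \<le> n \<Longrightarrow> f i \<in> carrier_mat (d i) (d i)"
  shows "perm_act G \<phi> n d g (tensor n f) = tensor n (\<lambda>i. f (\<phi> g i))"
proof -
  have f': "f (\<phi> g i) \<in> carrier_mat (d i) (d i)" if "i \<le> n" for i
    using f[OF phi_le[OF g that]] d_inv[OF g that] by simp
  have tc: "tensor n (\<lambda>i. f (\<phi> g i)) \<in> carrier_mat (total_dim n d) (total_dim n d)" by (rule tensor_carrier[OF f'])
  show ?thesis
  proof (rule square_mat_eqI[of _ "total_dim n d"])
    fix a b assume ab: "a < total_dim n d" "b < total_dim n d"
    have "perm_act G \<phi> n d g (tensor n f) $$ (a, b) = tensor n f $$ (perm_index g a, perm_index g b)"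
      using ab by (simp add: perm_act_index)
    also have "\<dots> = (\<Prod>i\<le>n. f i $$ (digit n d (perm_index g a) i, digit n d (perm_index g b) i))"
      by (rule tensor_entry[OF f perm_index_less[OF g] perm_index_less[OF g]])
    also have "\<dots> = (\<Prod>i\<le>n. f i $$ (digit n d a (\<phi> (inv g) i), digit n d b (\<phi> (inv g) i)))"
      using perm_index_digits(2)[OF g] by (intro prod.cong) auto
    also have "\<dots> = (\<Prod>i\<le>n. f (\<phi> g i) $$ (digit n d a (\<phi> (inv g) (\<phi> g i)), digit n d b (\<phi> (inv g) (\<phi> g i))))"
      by (rule prod.reindex_bij_betw[OF phi_bij[OF g], symmetric])
    also have "\<dots> = (\<Prod>i\<le>n. f (\<phi> g i) $$ (digit n d a i, digit n d b i))"
      using phi_inv[OF g] by (intro prod.cong) auto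
    also have "\<dots> = tensor n (\<lambda>i. f (\<phi> g i)) $$ (a, b)"
      by (rule tensor_entry[OF f' ab, symmetric])
    finally show "perm_act G \<phi> n d g (tensor n f) $$ (a, b) = tensor n (\<lambda>i. f (\<phi> g i)) $$ (a, b)" .
  qed (use tc in \<open>auto simp: perm_act_def\<close>)
qed

end

section \<open>Averaging an approximation over the group\<close>

lemma P_setD:
  assumes A: "A \<in> P_set p n d" and d: "\<And>i. i \<le> n \<Longrightarrow> 0 < d i" and p: "p > 1"
  shows "hermitian (total_dim n d) A" "schatten_power p A \<le> 1"
    and "\<exists>z \<rho>. A = z \<cdot>\<^sub>m tensor n \<rho> \<and> (\<forall>i\<le>n. \<rho> i \<in> carrier_mat (d i) (d i))"
proof -
  obtain s \<rho> where s: "s = 1 \<or> s = -1" and \<rho>: "\<And>i. i \<le> n \<Longrightarrow> psd (d i) (\<rho> i)"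
    and nrm: "schatten_norm p (tensor n \<rho>) \<le> 1" and Aeq: "A = s \<cdot>\<^sub>m tensor n \<rho>"
    using A unfolding P_set_def by blast
  have h: "hermitian (total_dim n d) (tensor n \<rho>)" using \<rho> d by (intro tensor_hermitian) (auto simp: psd_def)
  obtain r where r: "s = of_real r" "\<bar>r\<bar> = 1"
    using s by (metis abs_1 abs_minus_cancel of_real_1 of_real_minus)
  show "hermitian (total_dim n d) A" unfolding Aeq r(1) using hermitian_smult[OF h] .
  have "schatten_power p (tensor n \<rho>) \<le> 1"
  proof (rule ccontr)
    assume "\<not> schatten_power p (tensor n \<rho>) \<le> 1"
    then have "schatten_power p (tensor n \<rho>) powr (1 / p) > 1" using p by simp
    then show False using nrm by (simp add: schatten_norm_power)
  qed
  then show "schatten_power p A \<le> 1" unfolding Aeq r(1) schatten_power_smult[OF h] r(2) by simp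
  have "\<forall>i\<le>n. \<rho> i \<in> carrier_mat (d i) (d i)" using \<rho> by (auto simp: psd_def hermitian_def)
  then show "\<exists>z \<rho>. A = z \<cdot>\<^sub>m tensor n \<rho> \<and> (\<forall>i\<le>n. \<rho> i \<in> carrier_mat (d i) (d i))" using Aeq by blast
qed

context free_wsc
begin

text \<open>By invariance of \<open>M\<close>, the error after symmetrisation is the mean over the
  group of the permuted errors \<open>M - N'\<close>. These all have the same Schatten power, and by
  convexity the mean has no larger one.\<close>

lemma approx_rank_le_of_P_set_sum:
  assumes M: "hermitian (total_dim n d) M" and inv: "G_invariant G \<phi> n d M" and p: "p > 1"
    and A: "\<And>j. j < k \<Longrightarrow> A j \<in> P_set p n d"
    and close: "schatten_norm p (M - mat_sum (total_dim n d) (\<lambda>j. of_real c \<cdot>\<^sub>m A j) {..<k}) \<le> \<epsilon>"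
  shows "approx_rank_OG \<epsilon> p G n \<Omega> \<phi> \<psi> d M \<le> enat (k * card (carrier G))"
proof -
  let ?D = "total_dim n d" and ?C = "carrier G"
  define N' where "N' = mat_sum ?D (\<lambda>j. of_real c \<cdot>\<^sub>m A j) {..<k}"
  have hA: "hermitian ?D (A j)" if "j < k" for j using P_setD(1)[OF A[OF that] d_pos p] .
  have hE: "hermitian ?D (M - N')"
    unfolding N'_def using M hA by (intro hermitian_minus hermitian_mat_sum hermitian_smult) auto
  have "\<forall>j. \<exists>z \<rho>. j < k \<longrightarrow> A j = z \<cdot>\<^sub>m tensor n \<rho> \<and> (\<forall>i\<le>n. \<rho> i \<in> carrier_mat (d i) (d i))"
    using P_setD(3)[OF A d_pos p] by blast
  then obtain z \<rho> where z\<rho>: "\<And>j. j < k \<Longrightarrow> A j = z j \<cdot>\<^sub>m tensor n (\<rho> j)"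
    and \<rho>: "\<And>j i. j < k \<Longrightarrow> i \<le> n \<Longrightarrow> \<rho> j i \<in> carrier_mat (d i) (d i)"
    by metis
  define w where "w = 1 / real (card ?C)"
  have cardpos: "card ?C > 0" using finite_group one_closed by (auto simp: card_gt_0_iff)
  have w: "w \<ge> 0" "(\<Sum>h\<in>?C. w) = 1" using cardpos by (auto simp: w_def)
  \<comment> \<open>Factor 0 absorbs the scalar \<open>z j\<close>, the coefficient c and the
    averaging weight 1 / |G|.\<close>
  define T where "T j = (\<rho> j)(0 := (of_real (w * c) * z j) \<cdot>\<^sub>m \<rho> j 0)" for j
  have Tc: "T j i \<in> carrier_mat (d i) (d i)" if "j < k" "i \<le> n" for j i
    using \<rho>[OF that] unfolding T_def by auto
  have \<rho>t: "tensor n (\<rho> j) \<in> carrier_mat ?D ?D" if "j < k" for j by (rule tensor_carrier[OF \<rho>[OF that]])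
  have Tt: "tensor n (T j) = of_real (w * c) \<cdot>\<^sub>m A j" if j: "j < k" for j
  proof -
    have "tensor n (T j) = (of_real (w * c) * z j) \<cdot>\<^sub>m tensor n (\<rho> j)"
      unfolding T_def by (rule tensor_smult[OF \<rho>[OF j] d_pos])
    then show ?thesis unfolding z\<rho>[OF j] by (intro eq_matI) auto
  qed
  define N where "N = mat_sum ?D (\<lambda>(j, h). tensor n (\<lambda>i. T j (\<phi> h i))) ({..<k} \<times> ?C)"
  have Minv: "M $$ (perm_index h a, perm_index h b) = M $$ (a, b)" if h: "h \<in> ?C" and ab: "a < ?D" "b < ?D" for h a b
  proof -
    have "perm_act G \<phi> n d h M = M" using inv h by (simp add: G_invariant_def)
    then have "perm_act G \<phi> n d h M $$ (a, b) = M $$ (a, b)" by simp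
    then show ?thesis using ab by (simp add: perm_act_index)
  qed
  have "M - N = mat_sum ?D (\<lambda>h. of_real w \<cdot>\<^sub>m perm_act G \<phi> n d h (M - N')) ?C"
  proof (rule square_mat_eqI[of _ "?D"])
    fix a b assume ab: "a < ?D" "b < ?D"
    have Ac: "A j \<in> carrier_mat ?D ?D" if "j < k" for j using hermitian_carrier[OF hA[OF that]] .
    have 1: "(of_real w \<cdot>\<^sub>m perm_act G \<phi> n d h (M - N')) $$ (a, b)
       = of_real w * M $$ (a, b) - (\<Sum>j<k. of_real (w * c) * A j $$ (perm_index h a, perm_index h b))"
      if h: "h \<in> ?C" for h
    proof -
      have pi: "perm_index h a < ?D" "perm_index h b < ?D" using perm_index_less[OF h] by auto
      have "(of_real w \<cdot>\<^sub>m perm_act G \<phi> n d h (M - N')) $$ (a, b)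
          = of_real w * (M - N') $$ (perm_index h a, perm_index h b)"
        using ab by (simp add: perm_act_index del: index_minus_mat)
      also have "(M - N') $$ (perm_index h a, perm_index h b)
          = M $$ (perm_index h a, perm_index h b) - N' $$ (perm_index h a, perm_index h b)"
        using pi unfolding N'_def by (intro index_minus_carrier[of _ ?D]) auto
      also have "N' $$ (perm_index h a, perm_index h b) = (\<Sum>j<k. of_real c * A j $$ (perm_index h a, perm_index h b))"
        unfolding N'_def using pi Ac by (simp add: index_smult_carrier[of _ ?D] del: index_smult_mat(1))
      finally show ?thesis unfolding Minv[OF h ab] by (simp add: right_diff_distrib sum_distrib_left mult.assoc)
    qed
    have 2: "tensor n (\<lambda>i. T j (\<phi> h i)) $$ (a, b) = of_real (w * c) * A j $$ (perm_index h a, perm_index h b)"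
      if j: "j < k" and h: "h \<in> ?C" for j h
    proof -
      have pi: "perm_index h a < ?D" "perm_index h b < ?D" using perm_index_less[OF h] by auto
      have "tensor n (\<lambda>i. T j (\<phi> h i)) = perm_act G \<phi> n d h (tensor n (T j))"
        by (rule perm_act_tensor[OF h Tc[OF j], symmetric])
      also have "\<dots> $$ (a, b) = tensor n (T j) $$ (perm_index h a, perm_index h b)"
        using ab by (simp add: perm_act_index)
      also have "\<dots> = of_real (w * c) * A j $$ (perm_index h a, perm_index h b)"
        unfolding Tt[OF j] by (rule index_smult_carrier[OF Ac[OF j] pi])
      finally show ?thesis .
    qed
    have "(M - N) $$ (a, b) = M $$ (a, b) - N $$ (a, b)"
      using ab unfolding N_def by (intro index_minus_carrier[of _ ?D]) auto
    also have "N $$ (a, b) = (\<Sum>x\<in>{..<k} \<times> ?C. tensor n (\<lambda>i. T (fst x) (\<phi> (snd x) i)) $$ (a, b))"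
      using ab unfolding N_def by (simp add: split_def)
    also have "\<dots> = (\<Sum>j<k. \<Sum>h\<in>?C. tensor n (\<lambda>i. T j (\<phi> h i)) $$ (a, b))"
      by (simp add: sum.cartesian_product split_def)
    also have "\<dots> = (\<Sum>j<k. \<Sum>h\<in>?C. of_real (w * c) * A j $$ (perm_index h a, perm_index h b))"
      using 2 by (intro sum.cong refl) auto
    also have "\<dots> = (\<Sum>h\<in>?C. \<Sum>j<k. of_real (w * c) * A j $$ (perm_index h a, perm_index h b))"
      by (rule sum.swap)
    also have "M $$ (a, b) = (\<Sum>h\<in>?C. of_real w * M $$ (a, b))"
      using cardpos by (simp add: w_def)
    finally have "(M - N) $$ (a, b) = (\<Sum>h\<in>?C. of_real w * M $$ (a, b)
        - (\<Sum>j<k. of_real (w * c) * A j $$ (perm_index h a, perm_index h b)))"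
      by (simp only: sum_subtractf)
    then show "(M - N) $$ (a, b) = mat_sum ?D (\<lambda>h. of_real w \<cdot>\<^sub>m perm_act G \<phi> n d h (M - N')) ?C $$ (a, b)"
      using ab 1 by (simp del: index_smult_mat(1) index_minus_mat(1))
  qed (auto simp: N_def)
  then have "schatten_power p (M - N) = schatten_power p (mat_sum ?D (\<lambda>h. of_real w \<cdot>\<^sub>m perm_act G \<phi> n d h (M - N')) ?C)"
    by (rule arg_cong)
  also have "\<dots> \<le> (\<Sum>h\<in>?C. w * schatten_power p (perm_act G \<phi> n d h (M - N')))"
    unfolding perm_act_index
    using schatten_power_reindex(1)[OF hE perm_index_bij] w p by (intro schatten_power_convex) auto
  also have "\<dots> = (\<Sum>h\<in>?C. w * schatten_power p (M - N'))"
    unfolding perm_act_index by (intro sum.cong refl) (simp add: schatten_power_reindex(2)[OF hE perm_index_bij])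
  also have "\<dots> = schatten_power p (M - N')" by (simp only: sum_distrib_right[symmetric] w(2) mult_1)
  finally have "schatten_norm p (M - N) \<le> schatten_norm p (M - N')"
    unfolding schatten_norm_power using p schatten_power_nonneg by (intro powr_mono2) auto
  then have "schatten_norm p (M - N) \<le> \<epsilon>" using close unfolding N'_def by linarith
  moreover have "N \<in> carrier_mat ?D ?D" by (simp add: N_def)
  ultimately have "approx_rank_OG \<epsilon> p G n \<Omega> \<phi> \<psi> d M \<le> rank_OG G n \<Omega> \<phi> \<psi> d N"
    unfolding approx_rank_OG_def by (intro Inf_lower) blast
  also have "\<dots> \<le> enat (k * card ?C)"
  proof -
    have "has_decomp G n \<Omega> \<phi> \<psi> d N (k * card ?C)"
      unfolding N_def by (rule symmetrised_tensors_has_decomp[OF Tc])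
    then show ?thesis unfolding rank_OG_def by (intro Inf_lower) blast
  qed
  finally show ?thesis .
qed

text \<open>Since the infimum in \<open>mu\<close> need not be attained, the error bound \<open>b\<close> is required to leave room
  for a scaling factor up to twice its value.\<close>

lemma approx_rank_le_of_caratheodory:
  assumes M: "hermitian (total_dim n d) M" and inv: "G_invariant G \<phi> n d M" and p: "p > 1" and \<epsilon>: "\<epsilon> > 0"
    and carath: "\<And>(m::nat) c A a. \<lbrakk>\<And>l. l < m \<Longrightarrow> hermitian (total_dim n d) (A l); \<And>l. l < m \<Longrightarrow> schatten_power p (A l) \<le> 1;
        \<And>l. l < m \<Longrightarrow> c l \<ge> 0; (\<Sum>l<m. c l) = 1;
        a = mat_sum (total_dim n d) (\<lambda>l. of_real (c l) \<cdot>\<^sub>m A l) {..<m}; k > 0\<rbrakk> \<Longrightarrow>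
      \<exists>ix. (\<forall>i<k. ix i < m) \<and>
        schatten_power p (a - mat_sum (total_dim n d) (\<lambda>i. of_real (1 / real k) \<cdot>\<^sub>m A (ix i)) {..<k}) powr (1 / p) \<le> b"
    and b: "mu p n d M > 0 \<Longrightarrow> k > 0 \<and> 2 * mu p n d M * b \<le> \<epsilon>"
    and k0: "mu p n d M = 0 \<Longrightarrow> k = 0"
  shows "approx_rank_OG \<epsilon> p G n \<Omega> \<phi> \<psi> d M \<le> enat (k * card (carrier G))"
proof -
  let ?D = "total_dim n d"
  define X where "X = {t::real. 0 < t \<and> of_real (1 / t) \<cdot>\<^sub>m M \<in> B_set p n d}"
  have mu: "mu p n d M = Inf X" by (simp add: mu_def X_def)
  have ne: "X \<noteq> {}" using B_set_absorbing[OF M d_pos p] by (auto simp: X_def)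
  have mu0: "mu p n d M \<ge> 0" unfolding mu using ne by (intro cInf_greatest) (auto simp: X_def)
  have Mc: "M \<in> carrier_mat ?D ?D" using hermitian_carrier[OF M] .
  \<comment> \<open>For positive \<open>mu\<close> a scaling factor t below twice its value exists.
    For \<open>mu\<close> equal to 0 there is even one below \<epsilon>.\<close>
  define x where "x = (if mu p n d M = 0 then \<epsilon> else 2 * mu p n d M)"
  have "Inf X < x" using mu0 \<epsilon> unfolding x_def mu[symmetric] by auto
  then obtain t where t: "t \<in> X" "t < x" using cInf_lessD[OF ne] by blast
  have t0: "t > 0" and tB: "of_real (1 / t) \<cdot>\<^sub>m M \<in> B_set p n d" using t by (auto simp: X_def)
  obtain m c A where cA: "\<And>l. l < m \<Longrightarrow> 0 \<le> c l \<and> A l \<in> P_set p n d" and c1: "(\<Sum>l<m. c l) = 1"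
    and aeq: "of_real (1 / t) \<cdot>\<^sub>m M = mat_sum ?D (\<lambda>l. of_real (c l) \<cdot>\<^sub>m A l) {..<m::nat}"
    using tB unfolding B_set_def conv_mat_def by auto
  define a where "a = of_real (1 / t) \<cdot>\<^sub>m M"
  have Ma: "M = of_real t \<cdot>\<^sub>m a"
    unfolding a_def using t0 by (intro eq_matI) auto
  have hA: "hermitian ?D (A l)" and uA: "schatten_power p (A l) \<le> 1" if "l < m" for l
    using P_setD(1,2)[OF _ d_pos p] cA[OF that] by auto
  have ha: "hermitian ?D a" unfolding a_def by (rule hermitian_smult[OF M])
  have scale: "schatten_power p (of_real t \<cdot>\<^sub>m Z) powr (1 / p) = t * schatten_power p Z powr (1 / p)"
    if "hermitian ?D Z" for Z
    unfolding schatten_power_smult[OF that] using t0 p schatten_power_nonneg by (simp add: powr_mult powr_powr)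
  show ?thesis
  proof (cases "mu p n d M = 0")
    case True
    \<comment> \<open>The barycentre lies in the unit ball, so \<open>M\<close> has norm at most t <
      \<epsilon> and is approximated by the empty sum, in accordance with k = 0.\<close>
    have "schatten_power p a \<le> 1"
      by (rule barycentre_schatten_power_le[of m D A p c for D]) (use hA uA cA c1 aeq p in \<open>auto simp: a_def\<close>)
    then have "schatten_power p a powr (1 / p) \<le> 1" using schatten_power_nonneg p by (intro powr_le1) auto
    then have "schatten_norm p M \<le> t"
      unfolding schatten_norm_power by (subst Ma, subst scale[OF ha]) (use t0 in simp)
    moreover have "M - mat_sum ?D (\<lambda>j. of_real 0 \<cdot>\<^sub>m A j) {..<0} = M"
      by (rule eq_matI) (use Mc in auto)
    ultimately have "schatten_norm p (M - mat_sum ?D (\<lambda>j. of_real 0 \<cdot>\<^sub>m A j) {..<0}) \<le> \<epsilon>"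
      using t True by (simp add: x_def)
    then show ?thesis using approx_rank_le_of_P_set_sum[OF M inv p, of 0 A 0 \<epsilon>] k0[OF True] by simp
  next
    case False
    then have mupos: "mu p n d M > 0" using mu0 by simp
    have k: "k > 0" and bb: "2 * mu p n d M * b \<le> \<epsilon>" using b[OF mupos] by auto
    obtain ix where ix: "\<forall>i<k. ix i < m"
      and le: "schatten_power p (a - mat_sum ?D (\<lambda>i. of_real (1 / real k) \<cdot>\<^sub>m A (ix i)) {..<k}) powr (1 / p) \<le> b"
      using carath[of m A c a] hA uA cA c1 aeq k by (auto simp: a_def)
    let ?E = "a - mat_sum ?D (\<lambda>i. of_real (1 / real k) \<cdot>\<^sub>m A (ix i)) {..<k}"
    have hE: "hermitian ?D ?E"
      using ha hA ix by (intro hermitian_minus hermitian_mat_sum hermitian_smult) auto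
    have "M - mat_sum ?D (\<lambda>i. of_real (t / real k) \<cdot>\<^sub>m A (ix i)) {..<k} = of_real t \<cdot>\<^sub>m ?E"
    proof (rule square_mat_eqI[of _ "?D"])
      fix r s assume rs: "r < ?D" "s < ?D"
      have ac: "a \<in> carrier_mat ?D ?D" using hermitian_carrier[OF ha] .
      have sm: "(y \<cdot>\<^sub>m A (ix i)) $$ (r, s) = y * A (ix i) $$ (r, s)" if "i < k" for i y
        using hermitian_carrier[OF hA] ix that rs by (intro index_smult_carrier[of _ ?D]) auto
      have "(M - mat_sum ?D (\<lambda>i. of_real (t / real k) \<cdot>\<^sub>m A (ix i)) {..<k}) $$ (r, s)
          = M $$ (r, s) - (\<Sum>i<k. of_real (t / real k) * A (ix i) $$ (r, s))"
        using rs sm by (simp del: index_smult_mat(1))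
      also have "M $$ (r, s) = of_real t * a $$ (r, s)"
        by (subst Ma) (rule index_smult_carrier[OF ac rs])
      also have "of_real t * a $$ (r, s) - (\<Sum>i<k. of_real (t / real k) * A (ix i) $$ (r, s))
          = of_real t * (a $$ (r, s) - (\<Sum>i<k. of_real (1 / real k) * A (ix i) $$ (r, s)))"
        by (simp add: right_diff_distrib sum_distrib_left)
      also have "\<dots> = of_real t * ?E $$ (r, s)"
        using rs sm by (simp del: index_smult_mat(1))
      also have "\<dots> = (of_real t \<cdot>\<^sub>m ?E) $$ (r, s)"
        by (rule index_smult_carrier[OF hermitian_carrier[OF hE] rs, symmetric])
      finally show "(M - mat_sum ?D (\<lambda>i. of_real (t / real k) \<cdot>\<^sub>m A (ix i)) {..<k}) $$ (r, s) = (of_real t \<cdot>\<^sub>m ?E) $$ (r, s)" .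
    qed (use Mc in auto)
    then have "schatten_norm p (M - mat_sum ?D (\<lambda>i. of_real (t / real k) \<cdot>\<^sub>m A (ix i)) {..<k})
        = t * schatten_power p ?E powr (1 / p)"
      unfolding schatten_norm_power using scale[OF hE] by (simp only:)
    also have "\<dots> \<le> t * b" using le t0 by (intro mult_left_mono) auto
    also have "\<dots> \<le> 2 * mu p n d M * b"
    proof -
      have "b \<ge> 0" using le by (metis order_trans powr_ge_zero)
      then show ?thesis using t(2) mupos unfolding x_def by (intro mult_right_mono) auto
    qed
    also note bb
    finally have close: "schatten_norm p (M - mat_sum ?D (\<lambda>i. of_real (t / real k) \<cdot>\<^sub>m A (ix i)) {..<k}) \<le> \<epsilon>" .
    have "A (ix j) \<in> P_set p n d" if "j < k" for j using ix cA that by blast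
    then show ?thesis using approx_rank_le_of_P_set_sum[OF M inv p _ close] by blast
  qed
qed

section \<open>Numerical constants of the two regimes\<close>

lemma approx_rank_low:
  assumes M: "hermitian (total_dim n d) M" and inv: "G_invariant G \<phi> n d M" and p: "1 < p" "p \<le> 4 / 3" and \<epsilon>: "\<epsilon> > 0"
  shows "approx_rank_OG \<epsilon> p G n \<Omega> \<phi> \<psi> d M
      \<le> enat (nat \<lceil>((2 * exp 2 / p powr (1 / p)) powr (p / (p - 1))) * (2 * mu p n d M / \<epsilon>) powr (p / (p - 1))\<rceil> * card (carrier G))"
proof -
  define K where "K = 2 * exp 2 / p powr (1 / p)"
  define q where "q = p / (p - 1)"
  define \<mu> where "\<mu> = mu p n d M"
  define k where "k = nat \<lceil>K powr q * (2 * \<mu> / \<epsilon>) powr q\<rceil>"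
  have p2: "p < 2" using p by simp
  have q: "q > 0" "1 / q = (p - 1) / p" using p by (auto simp: q_def)
  \<comment> \<open>The greedy error is 2 * 2^(1/p) \<le> 4 times
    \<open>real k powr (- 1 / q)\<close>, so 4 is the value that K has to reach.\<close>
  have K4: "K \<ge> 4"
  proof -
    have "p powr (1 / p) \<le> p powr 1" using p by (intro powr_mono) auto
    then have "p powr (1 / p) \<le> 4 / 3" using p by simp
    moreover have "exp 2 \<ge> (3::real)" using exp_ge_add_one_self[of "2::real"] by simp
    ultimately have "4 * p powr (1 / p) \<le> 2 * exp 2" by linarith
    then show ?thesis unfolding K_def using p by (simp add: pos_le_divide_eq)
  qed
  have "approx_rank_OG \<epsilon> p G n \<Omega> \<phi> \<psi> d M \<le> enat (k * card (carrier G))"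
  proof (rule approx_rank_le_of_caratheodory[OF M inv p(1) \<epsilon>, where b = "(2 * 2 powr p * real k powr (1 - p)) powr (1 / p)"])
    assume "mu p n d M > 0"
    then have mu: "\<mu> > 0" by (simp add: \<mu>_def)
    define y where "y = K * (2 * \<mu> / \<epsilon>)"
    have y: "y > 0" using mu K4 \<epsilon> by (simp add: y_def)
    have ky: "real k \<ge> y powr q"
    proof -
      have "y powr q = K powr q * (2 * \<mu> / \<epsilon>) powr q" unfolding y_def using K4 mu \<epsilon> by (intro powr_mult) 
      then show ?thesis unfolding k_def by linarith
    qed
    have kpos: "k > 0" using ky y by (metis not_gr_zero not_le of_nat_0 powr_gt_zero less_irrefl)
    have "(y powr q) powr (1 / q) \<le> real k powr (1 / q)" using ky q(1) by (intro powr_mono2) auto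
    then have yk: "y \<le> real k powr (1 / q)" using q(1) y by (simp add: powr_powr)
    have "(2 * 2 powr p * real k powr (1 - p)) powr (1 / p) = 2 powr (1 / p) * 2 / real k powr (1 / q)"
    proof -
      have "(real k powr (1 - p)) powr (1 / p) = 1 / real k powr (1 / q)"
      proof -
        have "(1 - p) * (1 / p) = - (1 / q)" unfolding q(2) using p by (simp add: field_simps)
        then show ?thesis by (simp only: powr_powr powr_minus_divide)
      qed
      then show ?thesis using p by (simp add: powr_mult powr_powr)
    qed
    also have "\<dots> \<le> 2 * 2 / y"
    proof -
      have "2 powr (1 / p) \<le> (2::real) powr 1" using p by (intro powr_mono) auto
      then show ?thesis using yk y by (intro frac_le) auto
    qed
    finally have "2 * \<mu> * (2 * 2 powr p * real k powr (1 - p)) powr (1 / p) \<le> 2 * \<mu> * (2 * 2 / y)"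
      using mu by (intro mult_left_mono) auto
    also have "\<dots> = \<epsilon> * (4 / K)" unfolding y_def using mu \<epsilon> by (simp add: field_simps)
    also have "\<dots> \<le> \<epsilon> * 1" using K4 \<epsilon> by (intro mult_left_mono) auto
    finally show "k > 0 \<and> 2 * mu p n d M * (2 * 2 powr p * real k powr (1 - p)) powr (1 / p) \<le> \<epsilon>"
      using kpos by (simp add: \<mu>_def)
  next
    assume "mu p n d M = 0"
    then show "k = 0" by (simp add: k_def \<mu>_def)
  qed (rule approximate_caratheodory_low[OF _ p(1) _ _ _ _ p2]; assumption)
  then show ?thesis unfolding k_def K_def q_def \<mu>_def .
qed

lemma approx_rank_high:
  assumes M: "hermitian (total_dim n d) M" and inv: "G_invariant G \<phi> n d M" and p: "p \<ge> 2" and \<epsilon>: "\<epsilon> > 0"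
  shows "approx_rank_OG \<epsilon> p G n \<Omega> \<phi> \<psi> d M
      \<le> enat (nat \<lceil>(2 * (p - 1) * exp 4) * (2 * mu p n d M / \<epsilon>)\<^sup>2\<rceil> * card (carrier G))"
proof -
  define \<mu> where "\<mu> = mu p n d M"
  define k where "k = nat \<lceil>(2 * (p - 1) * exp 4) * (2 * \<mu> / \<epsilon>)\<^sup>2\<rceil>"
  have p1: "p > 1" using p by simp
  \<comment> \<open>The greedy bound 16 (p - 1) / k against the constant 2 (p - 1) e^4 leaves the
    quotient 8 / e^4, which must be at most 1.\<close>
  have e8: "exp 4 \<ge> (8::real)"
  proof -
    have "exp 2 \<ge> (3::real)" using exp_ge_add_one_self[of "2::real"] by simp
    then have "3 * 3 \<le> exp 2 * (exp 2 :: real)" by (intro mult_mono) auto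
    then show ?thesis by (simp flip: exp_add)
  qed
  have "approx_rank_OG \<epsilon> p G n \<Omega> \<phi> \<psi> d M \<le> enat (k * card (carrier G))"
  proof (rule approx_rank_le_of_caratheodory[OF M inv p1 \<epsilon>, where b = "sqrt (16 * (p - 1) / real k)"])
    assume "mu p n d M > 0"
    then have mu: "\<mu> > 0" by (simp add: \<mu>_def)
    define y where "y = (2 * (p - 1) * exp 4) * (2 * \<mu> / \<epsilon>)\<^sup>2"
    have y: "y > 0" using mu \<epsilon> p by (simp add: y_def)
    have ky: "real k \<ge> y" unfolding k_def y_def by linarith
    have kpos: "k > 0" using ky y by simp
    have "16 * (p - 1) / real k \<le> 16 * (p - 1) / y" using ky y p by (intro divide_left_mono) auto
    also have "\<dots> = (8 / exp 4) * (\<epsilon> / (2 * \<mu>))\<^sup>2"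
      unfolding y_def using mu \<epsilon> p by (simp add: power2_eq_square field_simps)
    also have "\<dots> \<le> 1 * (\<epsilon> / (2 * \<mu>))\<^sup>2" using e8 by (intro mult_right_mono) auto
    finally have "sqrt (16 * (p - 1) / real k) \<le> \<epsilon> / (2 * \<mu>)"
      using mu \<epsilon> by (intro real_le_lsqrt) auto
    then have "2 * \<mu> * sqrt (16 * (p - 1) / real k) \<le> \<epsilon>" using mu by (simp add: field_simps)
    then show "k > 0 \<and> 2 * mu p n d M * sqrt (16 * (p - 1) / real k) \<le> \<epsilon>" using kpos by (simp add: \<mu>_def)
  next
    assume "mu p n d M = 0"
    then show "k = 0" by (simp add: k_def \<mu>_def)
  qed (rule approximate_caratheodory_high[OF _ p1 _ _ _ _ p]; assumption)
  then show ?thesis unfolding k_def \<mu>_def .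
qed

end

theorem mainTheorem6:
  fixes G :: "('g, 'b) monoid_scheme"
    and n :: nat and \<Omega> :: "nat set \<Rightarrow> nat"
    and \<phi> :: "'g \<Rightarrow> nat \<Rightarrow> nat" and \<psi> :: "'g \<Rightarrow> nat set \<times> nat \<Rightarrow> nat set \<times> nat"
    and d :: "nat \<Rightarrow> nat" and \<epsilon> p :: real and M :: "complex mat"
  assumes "group G" and "finite (carrier G)"
    and "wsc n \<Omega>" and "wsc_connected n \<Omega>"
    and "free_wsc_action G n \<Omega> \<phi> \<psi>"
    and "\<forall>i\<le>n. 0 < d i"
    and "\<forall>g\<in>carrier G. \<forall>i\<le>n. d (\<phi> g i) = d i"
    and "0 < \<epsilon>"
    and "hermitian (total_dim n d) M"
    and "G_invariant G \<phi> n d M"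
  shows "(1 < p \<and> p \<le> 4 / 3 \<longrightarrow>
            approx_rank_OG \<epsilon> p G n \<Omega> \<phi> \<psi> d M
              \<le> enat (nat \<lceil>((2 * exp 2 / p powr (1 / p)) powr (p / (p - 1)))
                             * (2 * mu p n d M / \<epsilon>) powr (p / (p - 1))\<rceil> * card (carrier G)))
       \<and> ((p = 2 \<or> 4 \<le> p) \<longrightarrow>
            approx_rank_OG \<epsilon> p G n \<Omega> \<phi> \<psi> d M
              \<le> enat (nat \<lceil>(2 * (p - 1) * exp 4) * (2 * mu p n d M / \<epsilon>)\<^sup>2\<rceil> * card (carrier G)))"
proof -
  interpret free_wsc G n \<Omega> \<phi> \<psi> d
    using assms by (intro free_wsc.intro free_wsc_axioms.intro) auto
  show ?thesis
  proof (intro conjI impI)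
    assume "p = 2 \<or> 4 \<le> p"
    then have "p \<ge> 2" by auto
    then show "approx_rank_OG \<epsilon> p G n \<Omega> \<phi> \<psi> d M
        \<le> enat (nat \<lceil>(2 * (p - 1) * exp 4) * (2 * mu p n d M / \<epsilon>)\<^sup>2\<rceil> * card (carrier G))"
      using approx_rank_high[OF assms(9,10)] assms(8) by blast
  qed (use approx_rank_low[OF assms(9,10)] assms(8) in blast)
qed

end
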